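(* A Legendrian curve $\gamma:I\to\mathcal S$ is critical for the total strain functional if and only if its stress density $\mathtt t$ vanishes identically on $I$. Moreover, a Legendrian curve with $\mathtt t\equiv0$ is either a cycle ($a\equiv0$ on $I$) or generic ($a(t)\neq0$ for all $t\in I$).
   Context: Let $\mathbb C^{2,1}$ denote $\mathbb C^3$ with the pseudo-Hermitian form $\langle z,w\rangle=i(\bar z^1w^3-\bar z^3w^1)+\bar z^2w^2$ (conjugate-linear in the first slot); $\mathcal S=\{[z]\in\mathbb{CP}^2:\langle z,z\rangle=0\}$ with contact distribution $\ker\zeta$, $\zeta=-\frac{i}{\bar z^tz}\langle z,dz\rangle|_{T\mathcal S}$. A Legendrian curve is a smooth immersion $\gamma:I\to\mathcal S$ ($I$ an open interval) tangent to the contact distribution. A normalized lift is a smooth $\Gamma:I\to\mathbb C^3\setminus\{0\}$ with $\gamma=[\Gamma]$ and $\det(\Gamma,\Gamma',\Gamma'')=i$ (exists, unique up to a cube root of unity). The Fubini densities are $a=\mathrm{Im}\langle\Gamma''',\Gamma''\rangle$, $b=\frac12\langle\Gamma'',\Gamma''\rangle$, and the strain density is $\mathtt s=\sqrt[3]{|a|}$. $\gamma$ is a cycle if $a\equiv0$ and generic if $a$ never vanishes. The stress density is $$\begin{aligned}\mathtt t=&\tfrac{4400}{81}aa'^3a''+a^2\big(-\tfrac{400}{27}ba'^3-\tfrac{200}{9}a'a''^2-\tfrac{400}{27}a'^2a'''\big)+a^3\big(\tfrac{25}{3}a'^2b'+\tfrac{50}{3}ba'a''+\tfrac{50}{9}a''a'''+\tfrac{25}{9}a'a^{(4)}\big)\\&+a^4\big(-\tfrac{16}{3}b^2a'-5b'a''-3a'b''-\tfrac{10}{3}ba'''-\tfrac13a^{(5)}\big)+a^5\big(8bb'+b'''\big)-\tfrac{6160}{243}a'^5.\end{aligned}$$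 An admissible variation of $\gamma$ is a smooth map $\mathbf g:I\times(-\epsilon,\epsilon)\to\mathcal S$ such that $\mathbf g(t,0)=\gamma(t)$; each $g_\tau=\mathbf g(\cdot,\tau)$ is a Legendrian curve; the variational vector field $t\mapsto \mathbf g_*|_{(t,0)}(\partial_\tau)$ has compact support $K_{\mathbf g}$; and, with $\mathtt s_\tau$ the strain density of $g_\tau$, the function $\mathfrak S_{\mathbf g}(\tau)=\int_{K_{\mathbf g}}\mathtt s_\tau\,dt$ is differentiable at $\tau=0$. $\gamma$ is critical for the total strain functional if $\mathfrak S_{\mathbf g}'(0)=0$ for every admissible variation $\mathbf g$. *)

theory Defs
  imports "HOL-Analysis.Analysis"
begin

type_synonym cvec = "complex^3"
type_synonym cpt = "cvec set"   (* a point of CP^2 = a complex line through 0 in C^3 *)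

definition hform :: "cvec \<Rightarrow> cvec \<Rightarrow> complex" where
  "hform z w = \<i> * (cnj (z$1) * w$3 - cnj (z$3) * w$1) + cnj (z$2) * w$2"

definition proj :: "cvec \<Rightarrow> cpt" where
  "proj z = range (\<lambda>c::complex. c *s z)"

definition CP2 :: "cpt set" where
  "CP2 = {proj z | z. z \<noteq> 0}"

definition heisS :: "cpt set" where
  "heisS = {proj z | z. z \<noteq> 0 \<and> hform z z = 0}"

definition zeta :: "cvec \<Rightarrow> cvec \<Rightarrow> complex" where
  "zeta z v = - (\<i> / (\<Sum>i\<in>UNIV. cnj (z$i) * z$i)) * hform z v"

definition det3 :: "cvec \<Rightarrow> cvec \<Rightarrow> cvec \<Rightarrow> complex" where
  "det3 u v w = det (\<chi> i j. (if j = 1 then u else if j = 2 then v else w) $ i)"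

definition vd :: "(real \<Rightarrow> 'a::real_normed_vector) \<Rightarrow> real \<Rightarrow> 'a" where
  "vd f = (\<lambda>t. vector_derivative f (at t))"

definition smooth_on1 :: "real set \<Rightarrow> (real \<Rightarrow> 'a::real_normed_vector) \<Rightarrow> bool" where
  "smooth_on1 U f \<longleftrightarrow> (\<forall>n. \<forall>t\<in>U. (vd ^^ n) f differentiable (at t))"

definition pd1 :: "(real \<times> real \<Rightarrow> 'a::real_normed_vector) \<Rightarrow> real \<times> real \<Rightarrow> 'a" where
  "pd1 f = (\<lambda>(s, \<sigma>). vector_derivative (\<lambda>r. f (r, \<sigma>)) (at s))"

definition pd2 :: "(real \<times> real \<Rightarrow> 'a::real_normed_vector) \<Rightarrow> real \<times> real \<Rightarrow> 'a" where
  "pd2 f = (\<lambda>(s, \<sigma>). vector_derivative (\<lambda>r. f (s, r)) (at \<sigma>))"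

definition smooth_on2 :: "(real \<times> real) set \<Rightarrow> (real \<times> real \<Rightarrow> 'a::real_normed_vector) \<Rightarrow> bool" where
  "smooth_on2 U f \<longleftrightarrow>
     (\<forall>ws::bool list. let h = foldr (\<lambda>b h. if b then pd1 h else pd2 h) ws f in
        continuous_on U h \<and>
        (\<forall>s \<sigma>. (s, \<sigma>) \<in> U \<longrightarrow> (\<lambda>r. h (r, \<sigma>)) differentiable (at s) \<and> (\<lambda>r. h (s, r)) differentiable (at \<sigma>)))"

definition local_lift :: "real set \<Rightarrow> (real \<Rightarrow> cpt) \<Rightarrow> (real \<Rightarrow> cvec) \<Rightarrow> bool" where
  "local_lift U \<gamma> \<Gamma> \<longleftrightarrow> open U \<and> smooth_on1 U \<Gamma> \<and> (\<forall>t\<in>U. \<Gamma> t \<noteq> 0 \<and> \<gamma> t = proj (\<Gamma> t))"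

text \<open>Legendrian curve on I: smooth immersion into S tangent to ker zeta.
  Smoothness into CP^2 = existence of local smooth lifts; immersion = the derivative of a
  lift is not in the line of the lift (the tangent vector of CP^2 is nonzero).\<close>
definition legendrian :: "real set \<Rightarrow> (real \<Rightarrow> cpt) \<Rightarrow> bool" where
  "legendrian I \<gamma> \<longleftrightarrow> (\<forall>t\<in>I. \<gamma> t \<in> heisS) \<and>
     (\<forall>t0\<in>I. \<exists>U \<Gamma>. t0 \<in> U \<and> U \<subseteq> I \<and> local_lift U \<gamma> \<Gamma> \<and>
        (\<forall>t\<in>U. (\<nexists>c. vd \<Gamma> t = c *s \<Gamma> t) \<and> zeta (\<Gamma> t) (vd \<Gamma> t) = 0))"

definition normalized_lift :: "real set \<Rightarrow> (real \<Rightarrow> cpt) \<Rightarrow> (real \<Rightarrow> cvec) \<Rightarrow> bool" where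
  "normalized_lift I \<gamma> \<Gamma> \<longleftrightarrow> smooth_on1 I \<Gamma> \<and>
     (\<forall>t\<in>I. \<Gamma> t \<noteq> 0 \<and> \<gamma> t = proj (\<Gamma> t) \<and> det3 (\<Gamma> t) (vd \<Gamma> t) ((vd ^^ 2) \<Gamma> t) = \<i>)"

definition nlift :: "real set \<Rightarrow> (real \<Rightarrow> cpt) \<Rightarrow> real \<Rightarrow> cvec" where
  "nlift I \<gamma> = (SOME \<Gamma>. normalized_lift I \<gamma> \<Gamma>)"

text \<open>Fubini densities (b is real since the form is Hermitian; we take its real part).\<close>
definition fub_a :: "real set \<Rightarrow> (real \<Rightarrow> cpt) \<Rightarrow> real \<Rightarrow> real" where
  "fub_a I \<gamma> t = Im (hform ((vd ^^ 3) (nlift I \<gamma>) t) ((vd ^^ 2) (nlift I \<gamma>) t))"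

definition fub_b :: "real set \<Rightarrow> (real \<Rightarrow> cpt) \<Rightarrow> real \<Rightarrow> real" where
  "fub_b I \<gamma> t = Re (hform ((vd ^^ 2) (nlift I \<gamma>) t) ((vd ^^ 2) (nlift I \<gamma>) t)) / 2"

definition strain :: "real set \<Rightarrow> (real \<Rightarrow> cpt) \<Rightarrow> real \<Rightarrow> real" where
  "strain I \<gamma> t = root 3 \<bar>fub_a I \<gamma> t\<bar>"

definition stress :: "real set \<Rightarrow> (real \<Rightarrow> cpt) \<Rightarrow> real \<Rightarrow> real" where
  "stress I \<gamma> t =
    (let a = (\<lambda>k. (deriv ^^ k) (fub_a I \<gamma>) t); b = (\<lambda>k. (deriv ^^ k) (fub_b I \<gamma>) t) in
       4400/81 * a 0 * a 1 ^ 3 * a 2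
     + a 0 ^ 2 * (- 400/27 * b 0 * a 1 ^ 3 - 200/9 * a 1 * a 2 ^ 2 - 400/27 * a 1 ^ 2 * a 3)
     + a 0 ^ 3 * (25/3 * a 1 ^ 2 * b 1 + 50/3 * b 0 * a 1 * a 2 + 50/9 * a 2 * a 3 + 25/9 * a 1 * a 4)
     + a 0 ^ 4 * (- 16/3 * b 0 ^ 2 * a 1 - 5 * b 1 * a 2 - 3 * a 1 * b 2 - 10/3 * b 0 * a 3 - 1/3 * a 5)
     + a 0 ^ 5 * (8 * b 0 * b 1 + b 3)
     - 6160/243 * a 1 ^ 5)"

definition vdom :: "real set \<Rightarrow> real \<Rightarrow> (real \<times> real) set" where
  "vdom I \<epsilon> = I \<times> {-\<epsilon><..<\<epsilon>}"

definition local_lift2 :: "(real \<times> real) set \<Rightarrow> (real \<times> real \<Rightarrow> cpt) \<Rightarrow> (real \<times> real \<Rightarrow> cvec) \<Rightarrow> bool" where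
  "local_lift2 U g G \<longleftrightarrow> open U \<and> smooth_on2 U G \<and> (\<forall>q\<in>U. G q \<noteq> 0 \<and> g q = proj (G q))"

definition smooth_variation_map :: "real set \<Rightarrow> real \<Rightarrow> (real \<times> real \<Rightarrow> cpt) \<Rightarrow> bool" where
  "smooth_variation_map I \<epsilon> g \<longleftrightarrow> (\<forall>q\<in>vdom I \<epsilon>. g q \<in> heisS) \<and>
     (\<forall>p\<in>vdom I \<epsilon>. \<exists>U G. p \<in> U \<and> U \<subseteq> vdom I \<epsilon> \<and> local_lift2 U g G)"

text \<open>The variational vector field g_*(t,0)(d/dtau) vanishes at t iff, for a local lift G,
  d/dtau G(t,0) lies in the complex line of G(t,0).\<close>
definition varfield_vanishes :: "real set \<Rightarrow> real \<Rightarrow> (real \<times> real \<Rightarrow> cpt) \<Rightarrow> real \<Rightarrow> bool" where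
  "varfield_vanishes I \<epsilon> g t \<longleftrightarrow> (\<exists>U G. (t, 0) \<in> U \<and> U \<subseteq> vdom I \<epsilon> \<and> local_lift2 U g G \<and>
       (\<exists>c. pd2 G (t, 0) = c *s G (t, 0)))"

definition var_support :: "real set \<Rightarrow> real \<Rightarrow> (real \<times> real \<Rightarrow> cpt) \<Rightarrow> real set" where
  "var_support I \<epsilon> g = closure {t \<in> I. \<not> varfield_vanishes I \<epsilon> g t}"

definition total_strain :: "real set \<Rightarrow> real \<Rightarrow> (real \<times> real \<Rightarrow> cpt) \<Rightarrow> real \<Rightarrow> real" where
  "total_strain I \<epsilon> g \<tau> = integral (var_support I \<epsilon> g) (\<lambda>t. strain I (\<lambda>s. g (s, \<tau>)) t)"

definition admissible_variation :: "real set \<Rightarrow> (real \<Rightarrow> cpt) \<Rightarrow> real \<Rightarrow> (real \<times> real \<Rightarrow> cpt) \<Rightarrow> bool" where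
  "admissible_variation I \<gamma> \<epsilon> g \<longleftrightarrow> 0 < \<epsilon> \<and> smooth_variation_map I \<epsilon> g \<and>
     (\<forall>t\<in>I. g (t, 0) = \<gamma> t) \<and>
     (\<forall>\<tau>\<in>{-\<epsilon><..<\<epsilon>}. legendrian I (\<lambda>t. g (t, \<tau>))) \<and>
     compact (var_support I \<epsilon> g) \<and> var_support I \<epsilon> g \<subseteq> I \<and>
     total_strain I \<epsilon> g differentiable (at 0)"

definition strain_critical :: "real set \<Rightarrow> (real \<Rightarrow> cpt) \<Rightarrow> bool" where
  "strain_critical I \<gamma> \<longleftrightarrow>
     (\<forall>\<epsilon> g. admissible_variation I \<gamma> \<epsilon> g \<longrightarrow> deriv (total_strain I \<epsilon> g) 0 = 0)"

end

theory Submission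
  imports Defs
begin

text \<open>
  On the null cone \<open>z\<^sub>1 - \<i> z\<^sub>3\<close> does not vanish, so every curve and every variation in \<open>\<S>\<close> has a global lift,
  which can be rescaled to a normalized lift \<open>\<Gamma>\<close>. It satisfies
  \<open>\<Gamma>''' = (- b' + \<i> a) \<Gamma> - 2 b \<Gamma>'\<close>; pairing the variation field with \<open>\<Gamma>, \<Gamma>', \<Gamma>''\<close> expresses it by a tangential
  function \<open>v\<close> and a contact Hamiltonian \<open>w\<close>, and
  \<open>\<delta>a = v a' + 3 v' a + L w\<close> with a skew-adjoint operator \<open>L\<close> of order five. Since \<open>3 a\<^sup>5 L (\<bar>a\<bar>\<^sup>-\<^sup>2\<^sup>/\<^sup>3)\<close> is
  \<open>\<bar>a\<bar>\<^sup>-\<^sup>2\<^sup>/\<^sup>3\<close> times the stress density, integration by parts gives the first variation of the total strain where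
  \<open>a \<noteq> 0\<close>. Every bump function is realised as \<open>w\<close> up to a positive factor, so critical curves have zero stress.

  Conversely, where \<open>a \<noteq> 0\<close>, zero stress is the equation \<open>\<kappa>''' + 8 \<kappa> \<kappa>' = 0\<close> for the curvature \<open>\<kappa>\<close> with respect to
  the arc element \<open>\<bar>a\<bar>\<^sup>1\<^sup>/\<^sup>3 dt\<close>. Its energy integral bounds \<open>\<kappa>\<close> from above, and a Sturm comparison shows that \<open>a\<close>
  cannot tend to zero at an interior point: the curve is a cycle, where the total strain is minimal, or it is generic.
\<close>

section \<open>Smooth functions of one and two variables\<close>

text \<open>The strain is the cube root of |a|, which is not differentiable in \<open>a\<close> at
  0, so a first variation formula is available only where \<open>a\<close> has no zero. This shapes
  both directions: the bump is placed where \<open>a\<close> is nonzero (nonzero stress forces such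
  points nearby), and for zero stress the mixed case must be excluded before anything is varied.

  Why a zero is excluded: \<open>y'' + b y / 2 = 0\<close> is covariant under change of parameter
  for densities of weight -1/2. In the parameter \<open>u\<close> with
  \<open>du = a^(1/3) dt\<close> the function \<open>y\<close> becomes \<open>Y = a^(1/6) y\<close>,
  and \<open>Y_uu + \<kappa> Y / 2 = 0\<close>. The factor forces \<open>Y\<close> to 0 at a zero of
  \<open>a\<close>, which lies at finite arc length, while an upper bound on \<kappa> forbids a
  quick return to 0.

  The Legendrian condition is quadratic in the perturbation. A localized change of the plane curve
  therefore leaves a displacement of order \<open>\<tau>\<^sup>2\<close> beyond its support; this is
  harmless, since only the first order field has to be compactly supported.\<close>

definition has_partials :: "(real \<times> real) set \<Rightarrow> (real \<times> real \<Rightarrow> 'a::real_normed_vector) \<Rightarrow>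
    (real \<times> real \<Rightarrow> 'a) \<Rightarrow> (real \<times> real \<Rightarrow> 'a) \<Rightarrow> bool" where
  "has_partials U f f1 f2 \<longleftrightarrow> (\<forall>s \<sigma>. (s, \<sigma>) \<in> U \<longrightarrow>
     ((\<lambda>r. f (r, \<sigma>)) has_vector_derivative f1 (s, \<sigma>)) (at s) \<and>
     ((\<lambda>r. f (s, r)) has_vector_derivative f2 (s, \<sigma>)) (at \<sigma>))"

text \<open>\<open>smooth_on2\<close> speaks of literal iterates of \<open>pd1\<close> and
  \<open>pd2\<close>. Here the partial derivatives are existentially quantified, so any formula
  valid on \<open>U\<close> may serve as the witness and the closure properties become inductions on
  the order.\<close>

primrec Ck :: "nat \<Rightarrow> (real \<times> real) set \<Rightarrow> (real \<times> real \<Rightarrow> 'a::real_normed_vector) \<Rightarrow> bool" where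
  "Ck 0 U f \<longleftrightarrow> continuous_on U f"
| "Ck (Suc n) U f \<longleftrightarrow> continuous_on U f \<and> (\<exists>f1 f2. has_partials U f f1 f2 \<and> Ck n U f1 \<and> Ck n U f2)"

lemma Ck_continuous: "Ck n U f \<Longrightarrow> continuous_on U f"
  by (cases n) auto

lemma Ck_Suc_imp: "Ck (Suc n) U f \<Longrightarrow> Ck n U f"
proof (induction n arbitrary: f)
  case (Suc n)
  from Suc.prems obtain f1 f2 where h: "continuous_on U f" "has_partials U f f1 f2"
    "Ck (Suc n) U f1" "Ck (Suc n) U f2" by (subst (asm) Ck.simps(2)) blast
  then show ?case using Suc.IH by (subst Ck.simps(2)) blast
qed simp

lemma open_slice1:
  assumes "open U" "(s, \<sigma>) \<in> U"
  shows "open {r. (r, \<sigma>) \<in> U}" "s \<in> {r. (r, \<sigma>) \<in> U}"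
proof -
  have "open ((\<lambda>r. (r, \<sigma>)) -` U)" by (intro open_vimage assms continuous_intros)
  then show "open {r. (r, \<sigma>) \<in> U}" by (simp add: vimage_def)
qed (use assms in auto)

lemma open_slice2:
  assumes "open U" "(s, \<sigma>) \<in> U"
  shows "open {r. (s, r) \<in> U}" "\<sigma> \<in> {r. (s, r) \<in> U}"
proof -
  have "open ((\<lambda>r. (s, r)) -` U)" by (intro open_vimage assms continuous_intros)
  then show "open {r. (s, r) \<in> U}" by (simp add: vimage_def)
qed (use assms in auto)

lemma has_partials_cong:
  assumes "open U" "\<And>q. q \<in> U \<Longrightarrow> f q = g q" "has_partials U f f1 f2"
  shows "has_partials U g f1 f2"
  unfolding has_partials_def
proof (intro allI impI conjI)
  fix s \<sigma> assume q: "(s, \<sigma>) \<in> U"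
  show "((\<lambda>r. g (r, \<sigma>)) has_vector_derivative f1 (s, \<sigma>)) (at s)"
    by (rule has_vector_derivative_transform_within_open[OF _ open_slice1[OF assms(1) q], of "\<lambda>r. f (r, \<sigma>)"])
       (use assms(2,3) q in \<open>auto simp: has_partials_def\<close>)
  show "((\<lambda>r. g (s, r)) has_vector_derivative f2 (s, \<sigma>)) (at \<sigma>)"
    by (rule has_vector_derivative_transform_within_open[OF _ open_slice2[OF assms(1) q], of "\<lambda>r. f (s, r)"])
       (use assms(2,3) q in \<open>auto simp: has_partials_def\<close>)
qed

lemma Ck_cong:
  assumes "open U" "\<And>q. q \<in> U \<Longrightarrow> f q = g q" "Ck n U f"
  shows "Ck n U g"
proof -
  have c: "continuous_on U g"
    using Ck_continuous[OF assms(3)] assms(2) continuous_on_cong[of U U f g] by auto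
  show ?thesis
  proof (cases n)
    case (Suc m)
    with assms(3) obtain f1 f2 where "has_partials U f f1 f2" "Ck m U f1" "Ck m U f2" by auto
    moreover have "has_partials U g f1 f2" using \<open>has_partials U f f1 f2\<close> by (rule has_partials_cong[OF assms(1) assms(2), rotated])
    ultimately show ?thesis using c Suc by auto
  qed (use c in auto)
qed

lemma has_partials_pd:
  assumes "has_partials U f f1 f2" "q \<in> U"
  shows "pd1 f q = f1 q" "pd2 f q = f2 q"
  using assms by (auto simp: has_partials_def pd1_def pd2_def split: prod.splits intro: vector_derivative_at)

lemma Ck_pd:
  assumes "open U" "Ck (Suc n) U f"
  shows "has_partials U f (pd1 f) (pd2 f)" "Ck n U (pd1 f)" "Ck n U (pd2 f)"
proof -
  obtain f1 f2 where h: "has_partials U f f1 f2" "Ck n U f1" "Ck n U f2" using assms by auto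
  show "has_partials U f (pd1 f) (pd2 f)"
    using h(1) has_partials_pd[OF h(1)] by (auto simp: has_partials_def)
  show "Ck n U (pd1 f)" "Ck n U (pd2 f)"
    using Ck_cong[OF assms(1) _ h(2)] Ck_cong[OF assms(1) _ h(3)] has_partials_pd[OF h(1)] by metis+
qed

lemma smooth_on2_imp_partials:
  assumes "smooth_on2 U f"
  shows "has_partials U f (pd1 f) (pd2 f)" "continuous_on U f" "smooth_on2 U (pd1 f)" "smooth_on2 U (pd2 f)"
proof -
  let ?D = "\<lambda>ws::bool list. foldr (\<lambda>b h. if b then pd1 h else pd2 h) ws f"
  have D: "continuous_on U (?D ws)"
     "\<And>s \<sigma>. (s, \<sigma>) \<in> U \<Longrightarrow> (\<lambda>r. (?D ws) (r, \<sigma>)) differentiable (at s) \<and> (\<lambda>r. (?D ws) (s, r)) differentiable (at \<sigma>)" for ws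
    using assms unfolding smooth_on2_def Let_def by blast+
  show "continuous_on U f" using D(1)[of "[]"] by simp
  show "has_partials U f (pd1 f) (pd2 f)"
    using D(2)[of _ _ "[]"] by (simp add: has_partials_def pd1_def pd2_def vector_derivative_works)
  show "smooth_on2 U (pd1 f)" unfolding smooth_on2_def Let_def
    using D(1)[of "ws @ [True]" for ws] D(2)[of _ _ "ws @ [True]" for ws] by simp
  show "smooth_on2 U (pd2 f)" unfolding smooth_on2_def Let_def
    using D(1)[of "ws @ [False]" for ws] D(2)[of _ _ "ws @ [False]" for ws] by simp
qed

lemma smooth_on2_iff_Ck:
  assumes "open U"
  shows "smooth_on2 U f \<longleftrightarrow> (\<forall>n. Ck n U f)"
proof
  assume "smooth_on2 U f"
  then have "Ck n U f" for n
  proof (induction n arbitrary: f)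
    case (Suc n)
    then show ?case using smooth_on2_imp_partials[OF Suc.prems] by auto
  qed (simp add: smooth_on2_imp_partials)
  then show "\<forall>n. Ck n U f" by blast
next
  assume C: "\<forall>n. Ck n U f"
  have "\<forall>n. Ck n U (foldr (\<lambda>b h. if b then pd1 h else pd2 h) ws f)" for ws :: "bool list"
  proof (induction ws)
    case (Cons b ws)
    then have "Ck (Suc n) U (foldr (\<lambda>b h. if b then pd1 h else pd2 h) ws f)" for n by blast
    from Ck_pd[OF assms this] show ?case by (cases b) auto
  qed (use C in simp)
  note * = this
  show "smooth_on2 U f" unfolding smooth_on2_def Let_def
  proof (intro allI conjI impI)
    fix ws s \<sigma>
    let ?h = "foldr (\<lambda>b h. if b then pd1 h else pd2 h) ws f"
    show "continuous_on U ?h" using * Ck_continuous by blast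
    assume q: "(s, \<sigma>) \<in> U"
    have "has_partials U ?h (pd1 ?h) (pd2 ?h)" using Ck_pd(1)[OF assms] * by blast
    then show "(\<lambda>r. ?h (r, \<sigma>)) differentiable at s" "(\<lambda>r. ?h (s, r)) differentiable at \<sigma>"
      using q unfolding has_partials_def by (blast intro: differentiableI_vector)+
  qed
qed

lemma Ck_const: "Ck n U (\<lambda>q. c)"
proof (induction n arbitrary: c)
  case (Suc n)
  have "has_partials U (\<lambda>q. c) (\<lambda>q. 0) (\<lambda>q. 0)" by (auto simp: has_partials_def)
  with Suc show ?case by (auto intro!: exI[of _ "\<lambda>q. 0"])
qed simp

lemma Ck_add:
  assumes "Ck n U f" "Ck n U g" shows "Ck n U (\<lambda>q. f q + g q)"
  using assms
proof (induction n arbitrary: f g)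
  case (Suc n)
  then obtain f1 f2 g1 g2 where h: "has_partials U f f1 f2" "has_partials U g g1 g2"
    "Ck n U f1" "Ck n U f2" "Ck n U g1" "Ck n U g2" by auto
  have "has_partials U (\<lambda>q. f q + g q) (\<lambda>q. f1 q + g1 q) (\<lambda>q. f2 q + g2 q)"
    using h(1,2) by (auto simp: has_partials_def intro!: derivative_eq_intros)
  then show ?case using h Suc by (auto intro!: continuous_intros exI)
qed (auto intro: continuous_intros)

lemma Ck_bounded_linear:
  assumes "bounded_linear L" "Ck n U f" shows "Ck n U (\<lambda>q. L (f q))"
  using assms(2)
proof (induction n arbitrary: f)
  case 0 then show ?case using assms(1) by (simp add: bounded_linear.continuous_on)
next
  case (Suc n)
  then obtain f1 f2 where h: "has_partials U f f1 f2" "Ck n U f1" "Ck n U f2" by auto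
  have "has_partials U (\<lambda>q. L (f q)) (\<lambda>q. L (f1 q)) (\<lambda>q. L (f2 q))"
    using h(1) by (auto simp: has_partials_def intro: bounded_linear.has_vector_derivative[OF assms(1)])
  then show ?case using h Suc bounded_linear.continuous_on[OF assms(1)] by (auto intro!: exI)
qed

lemma Ck_bounded_bilinear:
  assumes "bounded_bilinear B" "Ck n U f" "Ck n U g" shows "Ck n U (\<lambda>q. B (f q) (g q))"
  using assms(2,3)
proof (induction n arbitrary: f g)
  case 0 then show ?case using assms(1) by (simp add: bounded_bilinear.continuous_on)
next
  case (Suc n)
  then obtain f1 f2 g1 g2 where h: "has_partials U f f1 f2" "has_partials U g g1 g2"
    "Ck n U f1" "Ck n U f2" "Ck n U g1" "Ck n U g2" by auto
  have "has_partials U (\<lambda>q. B (f q) (g q)) (\<lambda>q. B (f q) (g1 q) + B (f1 q) (g q)) (\<lambda>q. B (f q) (g2 q) + B (f2 q) (g q))"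
    using h(1,2) by (auto simp: has_partials_def intro!: bounded_bilinear.has_vector_derivative[OF assms(1)])
  moreover have "Ck n U f" "Ck n U g" using Suc.prems Ck_Suc_imp by blast+
  moreover have "continuous_on U (\<lambda>q. B (f q) (g q))"
    using Suc.prems bounded_bilinear.continuous_on[OF assms(1)] by auto
  ultimately show ?case using h Suc.IH Ck_add by (subst Ck.simps(2)) blast
qed

text \<open>Tailored to functions whose derivative is a polynomial in the function itself, such as
  \<open>inverse\<close> and \<open>exp\<close>: regularity of order \<open>m\<close> of the
  composite passes to \<open>d\<close>, and this yields order \<open>m + 1\<close> for the
  composite.\<close>

lemma Ck_chain:
  fixes f :: "real \<times> real \<Rightarrow> 'a::real_normed_field"
  assumes "Ck n U f"
    and der: "\<And>q. q \<in> U \<Longrightarrow> (\<phi> has_field_derivative d q) (at (f q))"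
    and IH: "\<And>m. m < n \<Longrightarrow> Ck m U (\<lambda>q. \<phi> (f q)) \<Longrightarrow> Ck m U d"
  shows "Ck n U (\<lambda>q. \<phi> (f q))"
  using assms(1) IH
proof (induction n)
  case 0
  have "isCont \<phi> (f q)" if "q \<in> U" for q using der[OF that] DERIV_isCont by blast
  then show ?case using 0 continuous_on_compose2[of "f ` U" \<phi> U f]
    by (auto simp: continuous_at_imp_continuous_on)
next
  case (Suc n)
  then have IH: "Ck n U (\<lambda>q. \<phi> (f q))" using Ck_Suc_imp by (metis less_SucI)
  then have d: "Ck n U d" using Suc.prems(2) by blast
  obtain f1 f2 where h: "has_partials U f f1 f2" "Ck n U f1" "Ck n U f2" using Suc.prems by auto
  have ch: "((\<lambda>r. \<phi> (g r)) has_vector_derivative (d q * g')) (at x)"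
    if "(g has_vector_derivative g') (at x)" "q \<in> U" "f q = g x" for g g' x q
  proof -
    have "((\<phi> \<circ> g) has_vector_derivative (g' * d q)) (at x)"
      using field_vector_diff_chain_at[OF that(1)] der[OF that(2)] that(3) by simp
    then show ?thesis by (simp add: o_def mult.commute)
  qed
  have "has_partials U (\<lambda>q. \<phi> (f q)) (\<lambda>q. d q * f1 q) (\<lambda>q. d q * f2 q)"
    using h(1) by (auto simp: has_partials_def intro!: ch)
  moreover have "Ck n U (\<lambda>q. d q * f1 q)" "Ck n U (\<lambda>q. d q * f2 q)"
    using Ck_bounded_bilinear[OF bounded_bilinear_mult] d h by blast+
  ultimately show ?case using Ck_continuous[OF IH] by auto
qed

section \<open>Closure properties of smooth functions of two variables\<close>

named_theorems smooth_intros

lemma smooth_on2_continuous: "smooth_on2 U f \<Longrightarrow> continuous_on U f"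
  by (rule smooth_on2_imp_partials)

lemma smooth_on2_pd1 [smooth_intros]: "smooth_on2 U f \<Longrightarrow> smooth_on2 U (pd1 f)"
  and smooth_on2_pd2 [smooth_intros]: "smooth_on2 U f \<Longrightarrow> smooth_on2 U (pd2 f)"
  by (rule smooth_on2_imp_partials; assumption)+

lemma smooth_on2_pd1_funpow [smooth_intros]: "smooth_on2 U f \<Longrightarrow> smooth_on2 U ((pd1 ^^ n) f)"
  by (induction n) (auto intro: smooth_intros)

lemma
  assumes "smooth_on2 U f" "(t, \<tau>) \<in> U"
  shows smooth_on2_has_pd1: "((\<lambda>r. f (r, \<tau>)) has_vector_derivative pd1 f (t, \<tau>)) (at t)"
  and smooth_on2_has_pd2: "((\<lambda>r. f (t, r)) has_vector_derivative pd2 f (t, \<tau>)) (at \<tau>)"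
  using smooth_on2_imp_partials(1)[OF assms(1)] assms(2) by (auto simp: has_partials_def)

lemma smooth_on2_const [smooth_intros]: "open U \<Longrightarrow> smooth_on2 U (\<lambda>q. c)"
  by (simp add: smooth_on2_iff_Ck Ck_const)

lemma smooth_on2_add [smooth_intros]:
  "open U \<Longrightarrow> smooth_on2 U f \<Longrightarrow> smooth_on2 U g \<Longrightarrow> smooth_on2 U (\<lambda>q. f q + g q)"
  by (simp add: smooth_on2_iff_Ck Ck_add)

lemma smooth_on2_bounded_linear:
  "open U \<Longrightarrow> bounded_linear L \<Longrightarrow> smooth_on2 U f \<Longrightarrow> smooth_on2 U (\<lambda>q. L (f q))"
  by (simp add: smooth_on2_iff_Ck Ck_bounded_linear)

lemma smooth_on2_bounded_bilinear:
  "open U \<Longrightarrow> bounded_bilinear B \<Longrightarrow> smooth_on2 U f \<Longrightarrow> smooth_on2 U g \<Longrightarrow> smooth_on2 U (\<lambda>q. B (f q) (g q))"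
  by (simp add: smooth_on2_iff_Ck Ck_bounded_bilinear)

lemmas smooth_on2_mult [smooth_intros] = smooth_on2_bounded_bilinear[OF _ bounded_bilinear_mult]
lemmas smooth_on2_minus [smooth_intros] = smooth_on2_bounded_linear[OF _ bounded_linear_minus[OF bounded_linear_ident]]
lemmas smooth_on2_cnj [smooth_intros] = smooth_on2_bounded_linear[OF _ bounded_linear_cnj]
lemmas smooth_on2_Re [smooth_intros] = smooth_on2_bounded_linear[OF _ bounded_linear_Re]
lemmas smooth_on2_Im [smooth_intros] = smooth_on2_bounded_linear[OF _ bounded_linear_Im]
lemmas smooth_on2_of_real [smooth_intros] = smooth_on2_bounded_linear[OF _ bounded_linear_of_real]
lemmas smooth_on2_nth [smooth_intros] = smooth_on2_bounded_linear[OF _ bounded_linear_vec_nth]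

lemma smooth_on2_diff [smooth_intros]:
  "open U \<Longrightarrow> smooth_on2 U f \<Longrightarrow> smooth_on2 U g \<Longrightarrow> smooth_on2 U (\<lambda>q. f q - g q)"
  using smooth_on2_add[of U f "\<lambda>q. - g q"] smooth_on2_minus[of U g] by simp

lemma smooth_on2_power [smooth_intros]:
  fixes f :: "_ \<Rightarrow> 'a::real_normed_field"
  shows "open U \<Longrightarrow> smooth_on2 U f \<Longrightarrow> smooth_on2 U (\<lambda>q. f q ^ n)"
  by (induction n) (auto intro!: smooth_intros)

lemma smooth_on2_sum [smooth_intros]:
  "open U \<Longrightarrow> finite S \<Longrightarrow> (\<And>i. i \<in> S \<Longrightarrow> smooth_on2 U (f i)) \<Longrightarrow> smooth_on2 U (\<lambda>q. \<Sum>i\<in>S. f i q)"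
  by (rotate_tac 1, induction S rule: finite_induct) (auto intro!: smooth_intros)

lemma smooth_on2_inverse [smooth_intros]:
  fixes f :: "_ \<Rightarrow> 'a::real_normed_field"
  assumes "open U" "smooth_on2 U f" "\<And>q. q \<in> U \<Longrightarrow> f q \<noteq> 0"
  shows "smooth_on2 U (\<lambda>q. inverse (f q))"
proof -
  have "Ck n U (\<lambda>q. inverse (f q))" for n
  proof (rule Ck_chain[where \<phi> = inverse and f = f])
    show "(inverse has_field_derivative - (inverse (f q) * inverse (f q))) (at (f q))" if "q \<in> U" for q
      using DERIV_inverse[OF assms(3)[OF that]] by (simp add: power2_eq_square numeral_2_eq_2)
    show "Ck m U (\<lambda>q. - (inverse (f q) * inverse (f q)))" if "m < n" and that: "Ck m U (\<lambda>q. inverse (f q))" for m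
      using Ck_bounded_linear[OF bounded_linear_minus[OF bounded_linear_ident]] Ck_bounded_bilinear[OF bounded_bilinear_mult that that] by blast
    show "Ck n U f" using assms by (simp add: smooth_on2_iff_Ck)
  qed
  then show ?thesis using assms(1) by (simp add: smooth_on2_iff_Ck)
qed

lemma smooth_on2_divide [smooth_intros]:
  fixes f :: "_ \<Rightarrow> 'a::real_normed_field"
  assumes "open U" "smooth_on2 U f" "smooth_on2 U g" "\<And>q. q \<in> U \<Longrightarrow> g q \<noteq> 0"
  shows "smooth_on2 U (\<lambda>q. f q / g q)"
  unfolding divide_inverse by (intro smooth_intros assms)

lemma smooth_on2_exp [smooth_intros]:
  fixes f :: "_ \<Rightarrow> 'a::{real_normed_field,banach}"
  assumes "open U" "smooth_on2 U f"
  shows "smooth_on2 U (\<lambda>q. exp (f q))"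
proof -
  have "Ck n U (\<lambda>q. exp (f q))" for n
    by (rule Ck_chain[where \<phi> = exp and f = f and d = "\<lambda>q. exp (f q)"])
       (use assms in \<open>simp_all add: smooth_on2_iff_Ck DERIV_exp\<close>)
  then show ?thesis using assms(1) by (simp add: smooth_on2_iff_Ck)
qed

lemma smooth_on2_cong:
  assumes "open U" "\<And>q. q \<in> U \<Longrightarrow> f q = g q" "smooth_on2 U f"
  shows "smooth_on2 U g"
proof -
  have "Ck n U g" for n
    by (rule Ck_cong[OF assms(1), of f]) (use assms in \<open>simp_all add: smooth_on2_iff_Ck\<close>)
  then show ?thesis by (simp add: smooth_on2_iff_Ck assms(1))
qed

lemma smooth_on2_subset: "smooth_on2 U f \<Longrightarrow> V \<subseteq> U \<Longrightarrow> smooth_on2 V f"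
  unfolding smooth_on2_def Let_def by (blast intro: continuous_on_subset)

text \<open>Every condition in \<open>smooth_on2\<close> concerns neighbourhoods of points. This is
  how the local lifts of a variation lead to one smooth map on \<open>vdom\<close>.\<close>

lemma smooth_on2_local:
  assumes "\<And>p. p \<in> V \<Longrightarrow> \<exists>U. p \<in> U \<and> open U \<and> smooth_on2 U f"
  shows "smooth_on2 V f"
proof -
  obtain U where U: "\<And>p. p \<in> V \<Longrightarrow> p \<in> U p \<and> open (U p) \<and> smooth_on2 (U p) f" using assms by metis
  have c: "continuous_on V (foldr (\<lambda>b h. if b then pd1 h else pd2 h) ws f)" for ws :: "bool list"
  proof (rule continuous_at_imp_continuous_on, intro ballI)
    fix p assume "p \<in> V"
    then have "continuous_on (U p) (foldr (\<lambda>b h. if b then pd1 h else pd2 h) ws f)"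
      using U unfolding smooth_on2_def Let_def by blast
    then show "isCont (foldr (\<lambda>b h. if b then pd1 h else pd2 h) ws f) p"
      using U[OF \<open>p \<in> V\<close>] continuous_on_eq_continuous_at by blast
  qed
  show ?thesis unfolding smooth_on2_def Let_def
  proof (intro allI conjI impI c)
    fix ws s \<sigma> assume "(s, \<sigma>) \<in> V"
    from U[OF this] show "(\<lambda>r. foldr (\<lambda>b h. if b then pd1 h else pd2 h) ws f (r, \<sigma>)) differentiable at s"
      "(\<lambda>r. foldr (\<lambda>b h. if b then pd1 h else pd2 h) ws f (s, r)) differentiable at \<sigma>"
      unfolding smooth_on2_def Let_def by blast+
  qed
qed

lemma bounded_linear_axis3: "bounded_linear (\<lambda>x::complex. axis i x :: complex^3)"
  unfolding linear_conv_bounded_linear[symmetric]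
  by (rule linearI) (auto simp: axis_def vec_eq_iff)

lemma sum_axis3: "(\<Sum>i\<in>UNIV. axis i (z $ i)) = (z :: complex^3)"
  by (simp add: vec_eq_iff axis_def if_distrib sum.delta' cong: if_cong)

lemma smooth_on2_vec:
  fixes F :: "real \<times> real \<Rightarrow> complex^3"
  assumes "open U" "\<And>i. smooth_on2 U (\<lambda>q. F q $ i)"
  shows "smooth_on2 U F"
proof -
  have "smooth_on2 U (\<lambda>q. \<Sum>i\<in>UNIV. axis i (F q $ i))"
    by (intro smooth_intros assms smooth_on2_bounded_linear[OF assms(1) bounded_linear_axis3]) auto
  then show ?thesis by (simp add: sum_axis3)
qed

lemma smooth_on2_smult [smooth_intros]:
  fixes F :: "real \<times> real \<Rightarrow> complex^3"
  assumes "open U" "smooth_on2 U f" "smooth_on2 U F"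
  shows "smooth_on2 U (\<lambda>q. f q *s F q)"
  by (rule smooth_on2_vec) (auto intro!: smooth_intros assms)

lemma smooth_on2_hform [smooth_intros]:
  "open U \<Longrightarrow> smooth_on2 U F \<Longrightarrow> smooth_on2 U G \<Longrightarrow> smooth_on2 U (\<lambda>q. hform (F q) (G q))"
  unfolding hform_def by (intro smooth_intros)

lemma det3_expand:
  "det3 u v w = u$1 * v$2 * w$3 + v$1 * w$2 * u$3 + w$1 * u$2 * v$3
              - u$1 * w$2 * v$3 - v$1 * u$2 * w$3 - w$1 * v$2 * u$3"
  unfolding det3_def by (simp add: det_3)

lemma smooth_on2_det3 [smooth_intros]:
  "open U \<Longrightarrow> smooth_on2 U F \<Longrightarrow> smooth_on2 U G \<Longrightarrow> smooth_on2 U H \<Longrightarrow> smooth_on2 U (\<lambda>q. det3 (F q) (G q) (H q))"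
  unfolding det3_expand by (intro smooth_intros)

section \<open>Functions of one variable as functions of the first coordinate\<close>

lemma pd1_fst: "pd1 (\<lambda>q. f (fst q)) = (\<lambda>q. vd f (fst q))"
  by (auto simp: pd1_def vd_def fun_eq_iff)

lemma pd1_funpow_fst: "(pd1 ^^ n) (\<lambda>q. f (fst q)) = (\<lambda>q. (vd ^^ n) f (fst q))"
  by (induction n) (auto simp: pd1_fst)

lemma vd_slice: "vd (\<lambda>t. F (t, \<tau>)) = (\<lambda>t. pd1 F (t, \<tau>))"
  by (auto simp: pd1_def vd_def)

lemma vd_funpow_slice: "(vd ^^ n) (\<lambda>t. F (t, \<tau>)) = (\<lambda>t. (pd1 ^^ n) F (t, \<tau>))"
  by (induction n) (auto simp: vd_slice)

lemma smooth_on1_vd: "smooth_on1 U f \<Longrightarrow> smooth_on1 U (vd f)"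
  unfolding smooth_on1_def by (metis funpow_Suc_right o_apply)

lemma smooth_on1_has_vd:
  "smooth_on1 U f \<Longrightarrow> t \<in> U \<Longrightarrow> (f has_vector_derivative vd f t) (at t)"
  unfolding smooth_on1_def vd_def using vector_derivative_works[of f "at t"]
  by (metis funpow_0)

text \<open>Carries the calculus of \<open>smooth_on2\<close> over to one variable: the derivative
  in the second direction is 0.\<close>

lemma smooth_on1_iff_fst:
  assumes "open U" "open V" "V \<noteq> {}"
  shows "smooth_on1 U f \<longleftrightarrow> smooth_on2 (U \<times> V) (\<lambda>q. f (fst q))"
proof
  assume "smooth_on1 U f"
  then have "Ck n (U \<times> V) (\<lambda>q. f (fst q))" for n
  proof (induction n arbitrary: f)
    case 0
    have "continuous_on U f"
      using smooth_on1_has_vd[OF 0] has_vector_derivative_continuous continuous_at_imp_continuous_on by blast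
    then show ?case by (auto intro!: continuous_on_compose2[of U f] continuous_intros)
  next
    case (Suc n)
    have "has_partials (U \<times> V) (\<lambda>q. f (fst q)) (\<lambda>q. vd f (fst q)) (\<lambda>q. 0)"
      using smooth_on1_has_vd[OF Suc.prems] by (auto simp: has_partials_def)
    then show ?case using Suc Suc.IH[OF smooth_on1_vd[OF Suc.prems]] Ck_const[of n _ 0]
       Ck_continuous[OF Suc.IH[OF Suc.prems]] by auto
  qed
  then show "smooth_on2 (U \<times> V) (\<lambda>q. f (fst q))" by (simp add: smooth_on2_iff_Ck assms open_Times)
next
  assume s: "smooth_on2 (U \<times> V) (\<lambda>q. f (fst q))"
  obtain v where v: "v \<in> V" using assms by auto
  show "smooth_on1 U f" unfolding smooth_on1_def
  proof (intro allI ballI)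
    fix n t assume "t \<in> U"
    have "smooth_on2 (U \<times> V) (\<lambda>q. (vd ^^ n) f (fst q))"
      using smooth_on2_pd1_funpow[OF s, of n] by (simp add: pd1_funpow_fst)
    from smooth_on2_has_pd1[OF this, of t v] show "(vd ^^ n) f differentiable at t"
      using \<open>t \<in> U\<close> v by (auto intro: differentiableI_vector)
  qed
qed

lemma smooth_on2_fst:
  assumes "open U" "open V" "smooth_on1 U f"
  shows "smooth_on2 (U \<times> V) (\<lambda>q. f (fst q))"
  using smooth_on1_iff_fst[OF assms(1,2)] assms(3)
  by (cases "V = {}") (auto simp: smooth_on2_def Let_def)

lemma smooth_on1_slice:
  assumes "smooth_on2 (U \<times> V) F" "\<tau> \<in> V"
  shows "smooth_on1 U (\<lambda>t. F (t, \<tau>))"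
  unfolding smooth_on1_def vd_funpow_slice
  using smooth_on2_has_pd1[OF smooth_on2_pd1_funpow[OF assms(1)]] assms(2)
  by (auto intro: differentiableI_vector)

text \<open>Schwarz's theorem through Leibniz' rule: \<open>f (t, \<tau>) - f (c, \<tau>)\<close> is
  the integral of \<open>pd1 f\<close>; differentiating in \<open>\<tau>\<close> under the integral
  sign and then in \<open>t\<close> produces both mixed derivatives.\<close>

lemma partials_commute:
  fixes f :: "real \<times> real \<Rightarrow> 'a::banach"
  assumes U: "open U" and f: "smooth_on2 U f" and q: "q \<in> U"
  shows "pd1 (pd2 f) q = pd2 (pd1 f) q"
proof -
  obtain t0 \<tau>0 where q': "q = (t0, \<tau>0)" by (cases q)
  obtain A B where "open A" "open B" "(t0, \<tau>0) \<in> A \<times> B" "A \<times> B \<subseteq> U"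
    by (rule open_prod_elim[OF U q[unfolded q']])
  then have AB: "open A" "open B" "t0 \<in> A" "\<tau>0 \<in> B" "A \<times> B \<subseteq> U" by auto
  obtain d where d: "d > 0" "cball t0 d \<subseteq> A" using AB open_contains_cball by blast
  obtain e where e: "e > 0" "cball \<tau>0 e \<subseteq> B" using AB open_contains_cball by blast
  define c where "c = t0 - d"
  define J where "J = cball \<tau>0 e"
  have inU: "(s, \<tau>) \<in> U" if "s \<in> {c..t0+d}" "\<tau> \<in> J" for s \<tau>
  proof -
    have "s \<in> cball t0 d" using that(1) by (auto simp: dist_real_def c_def)
    then show ?thesis using that(2) d e AB(5) unfolding J_def by blast
  qed
  have eqn: "pd2 f (t, \<tau>0) = pd2 f (c, \<tau>0) + integral {c..t} (\<lambda>s. pd2 (pd1 f) (s, \<tau>0))" if t: "t \<in> {c..t0+d}" for t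
  proof -
    have "((\<lambda>\<tau>. integral (cbox c t) (\<lambda>s. pd1 f (s, \<tau>))) has_vector_derivative
            integral (cbox c t) (\<lambda>s. pd2 (pd1 f) (s, \<tau>0))) (at \<tau>0 within J)"
    proof (rule leibniz_rule_vector_derivative)
      fix \<tau> s assume "\<tau> \<in> J" "s \<in> cbox c t"
      then have "(s, \<tau>) \<in> U" using inU t by auto
      from smooth_on2_has_pd2[OF smooth_on2_pd1[OF f] this]
      show "((\<lambda>\<tau>. pd1 f (s, \<tau>)) has_vector_derivative pd2 (pd1 f) (s, \<tau>)) (at \<tau> within J)"
        by (rule has_vector_derivative_at_within)
    next
      fix \<tau> assume "\<tau> \<in> J"
      then show "(\<lambda>s. pd1 f (s, \<tau>)) integrable_on cbox c t"
        using inU t by (intro integrable_continuous continuous_on_compose2[OF smooth_on2_continuous[OF smooth_on2_pd1[OF f]]] continuous_intros) auto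
    next
      have "(\<lambda>x. (snd x, fst x)) ` (J \<times> cbox c t) \<subseteq> U" using inU t by auto
      then show "continuous_on (J \<times> cbox c t) (\<lambda>(\<tau>, s). pd2 (pd1 f) (s, \<tau>))"
        unfolding split_def
        by (intro continuous_on_compose2[OF smooth_on2_continuous[OF smooth_on2_pd2[OF smooth_on2_pd1[OF f]]]] continuous_intros)
    qed (use e in \<open>auto simp: J_def\<close>)
    then have 1: "((\<lambda>\<tau>. integral {c..t} (\<lambda>s. pd1 f (s, \<tau>))) has_vector_derivative
            integral {c..t} (\<lambda>s. pd2 (pd1 f) (s, \<tau>0))) (at \<tau>0)"
      using at_within_interior[of \<tau>0 J] e by (simp add: J_def)
    have 2: "integral {c..t} (\<lambda>s. pd1 f (s, \<tau>)) = f (t, \<tau>) - f (c, \<tau>)" if "\<tau> \<in> J" for \<tau>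
      by (intro integral_unique fundamental_theorem_of_calculus)
         (use t inU that in \<open>auto intro!: has_vector_derivative_at_within smooth_on2_has_pd1[OF f]\<close>)
    have "((\<lambda>\<tau>. f (t, \<tau>) - f (c, \<tau>)) has_vector_derivative
            integral {c..t} (\<lambda>s. pd2 (pd1 f) (s, \<tau>0))) (at \<tau>0)"
      by (rule has_vector_derivative_transform_within_open[OF 1, of "ball \<tau>0 e"]) (use e 2 in \<open>auto simp: J_def\<close>)
    moreover have "((\<lambda>\<tau>. f (t, \<tau>) - f (c, \<tau>)) has_vector_derivative (pd2 f (t, \<tau>0) - pd2 f (c, \<tau>0))) (at \<tau>0)"
      by (intro has_vector_derivative_diff smooth_on2_has_pd2[OF f] inU) (use t d e in \<open>auto simp: J_def c_def\<close>)
    ultimately show ?thesis using vector_derivative_unique_at by (metis add.commute diff_add_cancel)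
  qed
  have "((\<lambda>t. integral {c..t} (\<lambda>s. pd2 (pd1 f) (s, \<tau>0))) has_vector_derivative pd2 (pd1 f) (t0, \<tau>0)) (at t0 within {c..t0+d})"
    by (intro integral_has_vector_derivative continuous_on_compose2[OF smooth_on2_continuous[OF smooth_on2_pd2[OF smooth_on2_pd1[OF f]]]] continuous_intros)
       (use inU d e in \<open>auto simp: c_def J_def\<close>)
  then have "((\<lambda>t. integral {c..t} (\<lambda>s. pd2 (pd1 f) (s, \<tau>0))) has_vector_derivative pd2 (pd1 f) (t0, \<tau>0)) (at t0)"
    using at_within_interior[of t0 "{c..t0+d}"] d by (simp add: c_def)
  then have "((\<lambda>t. pd2 f (c, \<tau>0) + integral {c..t} (\<lambda>s. pd2 (pd1 f) (s, \<tau>0))) has_vector_derivative pd2 (pd1 f) (t0, \<tau>0)) (at t0)"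
    using has_vector_derivative_add[OF has_vector_derivative_const[of "pd2 f (c, \<tau>0)"]] by force
  then have "((\<lambda>t. pd2 f (t, \<tau>0)) has_vector_derivative pd2 (pd1 f) (t0, \<tau>0)) (at t0)"
  proof (rule has_vector_derivative_transform_within_open)
    show "pd2 f (c, \<tau>0) + integral {c..t} (\<lambda>s. pd2 (pd1 f) (s, \<tau>0)) = pd2 f (t, \<tau>0)" if "t \<in> {c<..<t0+d}" for t
      by (rule eqn[symmetric]) (use that in auto)
  qed (use d in \<open>auto simp: c_def\<close>)
  then show ?thesis unfolding q' using smooth_on2_has_pd1[OF smooth_on2_pd2[OF f] q[unfolded q']]
    by (metis vector_derivative_at)
qed

lemma pd_cong:
  assumes "open U" "\<And>q. q \<in> U \<Longrightarrow> f q = g q" "has_partials U f f1 f2" "q \<in> U"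
  shows "pd1 g q = pd1 f q" "pd2 g q = pd2 f q"
proof -
  have "has_partials U g f1 f2" using assms(1,2,3) by (rule has_partials_cong)
  then show "pd1 g q = pd1 f q" "pd2 g q = pd2 f q"
    using has_partials_pd[OF _ assms(4)] assms(3) by metis+
qed

lemma smooth_on2_pd_cong:
  assumes "open U" "smooth_on2 U f" "\<And>q. q \<in> U \<Longrightarrow> f q = g q" "q \<in> U"
  shows "pd1 g q = pd1 f q" "pd2 g q = pd2 f q"
  using pd_cong[OF assms(1,3) smooth_on2_imp_partials(1)[OF assms(2)] assms(4)] by blast+

lemma pd_bilinear:
  assumes B: "bounded_bilinear B" and "smooth_on2 U f" "smooth_on2 U g" "q \<in> U"
  shows "pd1 (\<lambda>q. B (f q) (g q)) q = B (f q) (pd1 g q) + B (pd1 f q) (g q)"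
    "pd2 (\<lambda>q. B (f q) (g q)) q = B (f q) (pd2 g q) + B (pd2 f q) (g q)"
proof -
  obtain t \<tau> where q: "q = (t, \<tau>)" by (cases q)
  note h = smooth_on2_imp_partials(1)[OF assms(2)] smooth_on2_imp_partials(1)[OF assms(3)] \<open>q \<in> U\<close>
  show "pd1 (\<lambda>q. B (f q) (g q)) q = B (f q) (pd1 g q) + B (pd1 f q) (g q)"
    unfolding q pd1_def[of "\<lambda>q. B (f q) (g q)"] prod.case
    by (rule vector_derivative_at, rule bounded_bilinear.has_vector_derivative[OF B])
       (use h in \<open>auto simp: has_partials_def q\<close>)
  show "pd2 (\<lambda>q. B (f q) (g q)) q = B (f q) (pd2 g q) + B (pd2 f q) (g q)"
    unfolding q pd2_def[of "\<lambda>q. B (f q) (g q)"] prod.case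
    by (rule vector_derivative_at, rule bounded_bilinear.has_vector_derivative[OF B])
       (use h in \<open>auto simp: has_partials_def q\<close>)
qed

lemma pd_linear:
  assumes B: "bounded_linear B" and "smooth_on2 U f" "q \<in> U"
  shows "pd1 (\<lambda>q. B (f q)) q = B (pd1 f q)" "pd2 (\<lambda>q. B (f q)) q = B (pd2 f q)"
proof -
  obtain t \<tau> where q: "q = (t, \<tau>)" by (cases q)
  note h = smooth_on2_imp_partials(1)[OF assms(2)] \<open>q \<in> U\<close>
  show "pd1 (\<lambda>q. B (f q)) q = B (pd1 f q)"
    unfolding q pd1_def[of "\<lambda>q. B (f q)"] prod.case
    by (rule vector_derivative_at, rule bounded_linear.has_vector_derivative[OF B])
       (use h in \<open>auto simp: has_partials_def q\<close>)
  show "pd2 (\<lambda>q. B (f q)) q = B (pd2 f q)"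
    unfolding q pd2_def[of "\<lambda>q. B (f q)"] prod.case
    by (rule vector_derivative_at, rule bounded_linear.has_vector_derivative[OF B])
       (use h in \<open>auto simp: has_partials_def q\<close>)
qed

lemma pd_add:
  assumes "smooth_on2 U f" "smooth_on2 U g" "q \<in> U"
  shows "pd1 (\<lambda>q. f q + g q) q = pd1 f q + pd1 g q" "pd2 (\<lambda>q. f q + g q) q = pd2 f q + pd2 g q"
proof -
  obtain t \<tau> where q: "q = (t, \<tau>)" by (cases q)
  note h = smooth_on2_imp_partials(1)[OF assms(1)] smooth_on2_imp_partials(1)[OF assms(2)] \<open>q \<in> U\<close>
  show "pd1 (\<lambda>q. f q + g q) q = pd1 f q + pd1 g q"
    unfolding q pd1_def[of "\<lambda>q. f q + g q"] prod.case
    by (rule vector_derivative_at, rule has_vector_derivative_add)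
       (use h in \<open>auto simp: has_partials_def q\<close>)
  show "pd2 (\<lambda>q. f q + g q) q = pd2 f q + pd2 g q"
    unfolding q pd2_def[of "\<lambda>q. f q + g q"] prod.case
    by (rule vector_derivative_at, rule has_vector_derivative_add)
       (use h in \<open>auto simp: has_partials_def q\<close>)
qed

lemma pd_const [simp]: "pd1 (\<lambda>q. c) q = 0" "pd2 (\<lambda>q. c) q = 0"
  by (simp_all add: pd1_def pd2_def split: prod.splits)

section \<open>The pseudo-Hermitian form and normalized lifts\<close>

lemma cvec_eq_iff: "(z::cvec) = w \<longleftrightarrow> z$1 = w$1 \<and> z$2 = w$2 \<and> z$3 = w$3"
  by (auto simp: vec_eq_iff forall_3)

lemma cvec_scaleR_nth: "(r *\<^sub>R (z::cvec)) $ i = complex_of_real r * z $ i"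
  by (simp only: vector_scaleR_component, rule scaleR_conv_of_real)

lemma cnj_hform: "cnj (hform z w) = hform w z"
  by (simp add: hform_def algebra_simps)

lemma hform_self_real: "complex_of_real (Re (hform z z)) = hform z z"
  by (metis cnj_hform Reals_cnj_iff complex_is_Real_iff of_real_Re)

lemma hform_add_right: "hform z (v + w) = hform z v + hform z w"
  and hform_add_left: "hform (v + w) z = hform v z + hform w z"
  and hform_diff_right: "hform z (v - w) = hform z v - hform z w"
  and hform_diff_left: "hform (v - w) z = hform v z - hform w z"
  and hform_smult_right: "hform z (c *s w) = c * hform z w"
  and hform_smult_left: "hform (c *s z) w = cnj c * hform z w"
  by (simp_all add: hform_def algebra_simps)

lemmas hform_simps = hform_add_right hform_add_left hform_diff_right hform_diff_left hform_smult_right hform_smult_left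

lemma bounded_bilinear_hform: "bounded_bilinear hform"
  unfolding bilinear_conv_bounded_bilinear[symmetric] bilinear_def
  by (auto intro!: linearI simp: hform_def algebra_simps cvec_scaleR_nth scaleR_complex.ctr complex_eq_iff)

lemma bounded_bilinear_smult: "bounded_bilinear (\<lambda>c (z::cvec). c *s z)"
  unfolding bilinear_conv_bounded_bilinear[symmetric] bilinear_def
  by (auto intro!: linearI simp: vec_eq_iff algebra_simps complex_eq_iff cvec_scaleR_nth)

text \<open>The Gram matrix of two triples is the conjugate transpose of the first times the form
  times the second; the form has determinant -1, whence the sign on the left.\<close>

lemma gram_det3:
  "- (cnj (det3 a b c) * det3 u v w) =
     hform a u * hform b v * hform c w + hform a v * hform b w * hform c u + hform a w * hform b u * hform c v
   - hform a u * hform b w * hform c v - hform a v * hform b u * hform c w - hform a w * hform b v * hform c u"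
  unfolding det3_expand hform_def by (simp add: algebra_simps)

text \<open>The Gram matrix of \<open>a, b, c\<close> against \<open>u, v, w\<close> has a zero
  column, so \<open>u\<close> has determinant 0 with every pair \<open>v, w\<close>.\<close>

lemma hform_nondegenerate:
  assumes "det3 a b c \<noteq> 0" "hform a u = 0" "hform b u = 0" "hform c u = 0"
  shows "u = 0"
proof -
  have d: "det3 u v w = 0" for v w
    using gram_det3[of a b c u v w] assms by auto
  show ?thesis
    using d[of "axis 2 1" "axis 3 1"] d[of "axis 1 1" "axis 3 1"] d[of "axis 1 1" "axis 2 1"]
    by (simp add: det3_expand cvec_eq_iff axis_def)
qed

section \<open>Global representatives of points of the null cone\<close>

definition ell :: "cvec \<Rightarrow> complex" where
  "ell z = z$1 - \<i> * z$3"

lemma ell_smult: "ell (c *s z) = c * ell z"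
  by (simp add: ell_def algebra_simps)

lemma hform_self: "hform z z = complex_of_real ((cmod (z$2))\<^sup>2 - 2 * Im (cnj (z$1) * z$3))"
  by (simp add: hform_def complex_eq_iff cmod_power2 algebra_simps) (simp add: power2_eq_square)

text \<open>On the hyperplane \<open>ell z = 0\<close> the form becomes |z_2|^2 + 2 |z_3|^2, which
  is positive definite.\<close>

lemma ell_nonzero:
  assumes "hform z z = 0" "z \<noteq> 0"
  shows "ell z \<noteq> 0"
proof
  assume "ell z = 0"
  then have z1: "z$1 = \<i> * z$3" by (simp add: ell_def)
  have "(cmod (z$2))\<^sup>2 - 2 * Im (cnj (z$1) * z$3) = 0"
    using assms(1) unfolding hform_self by (simp only: of_real_eq_0_iff)
  moreover have "Im (cnj (z$1) * z$3) = - (cmod (z$3))\<^sup>2"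
    by (simp add: z1 cmod_power2) (simp add: power2_eq_square)
  ultimately have "(cmod (z$2))\<^sup>2 + 2 * (cmod (z$3))\<^sup>2 = 0" by simp
  then have "z$2 = 0" "z$3 = 0"
    by (smt (verit) norm_eq_zero zero_eq_power2 zero_le_power2)+
  with z1 assms(2) show False by (simp add: cvec_eq_iff)
qed

text \<open>In signature (2,1) an isotropic subspace is at most one-dimensional. Applied to a lift
  and its derivative \<open>v\<close>, this turns the immersion condition into
  \<open>hform v v \<noteq> 0\<close>.\<close>

lemma null_perp_null:
  assumes "z \<noteq> 0" "hform z z = 0" "hform z v = 0" "hform v v = 0"
  shows "\<exists>c. v = c *s z"
proof (cases "z$1 = 0")
  case True
  then have "z$2 = 0" using assms(2) unfolding hform_self by simp
  with True assms(1) have z3: "z$3 \<noteq> 0" by (simp add: cvec_eq_iff)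
  have "v$1 = 0" using assms(3) True \<open>z$2 = 0\<close> z3 by (simp add: hform_def)
  moreover have "v$2 = 0" using assms(4) \<open>v$1 = 0\<close> unfolding hform_self by simp
  ultimately have "v = (v$3 / z$3) *s z" using True \<open>z$2 = 0\<close> z3 by (simp add: cvec_eq_iff)
  then show ?thesis by blast
next
  case False
  define u where "u = v - (v$1 / z$1) *s z"
  have vz: "hform v z = 0" using cnj_hform[of z v] assms(3) by simp
  have "u$1 = 0" using False by (simp add: u_def)
  have "hform u u = 0"
    using assms vz by (simp add: u_def hform_simps)
  then have u2: "u$2 = 0" using \<open>u$1 = 0\<close> unfolding hform_self by simp
  have "hform z u = 0" using assms unfolding u_def by (simp add: hform_simps)
  then have "u$3 = 0" using u2 \<open>u$1 = 0\<close> False by (simp add: hform_def)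
  then have "u = 0" using u2 \<open>u$1 = 0\<close> by (simp add: cvec_eq_iff)
  then have "v = (v$1 / z$1) *s z" by (simp add: u_def)
  then show ?thesis by blast
qed

lemma zeta_zero_imp:
  assumes "z \<noteq> 0" "zeta z v = 0" shows "hform z v = 0"
proof -
  have "(\<Sum>i\<in>UNIV. cnj (z$i) * z$i) = complex_of_real (\<Sum>i\<in>UNIV. (cmod (z$i))\<^sup>2)"
    unfolding of_real_sum complex_norm_square by (simp add: mult.commute)
  moreover have "(\<Sum>i\<in>UNIV. (cmod (z$i))\<^sup>2) > 0"
  proof -
    obtain i where "z$i \<noteq> 0" using assms(1) by (auto simp: vec_eq_iff)
    then show ?thesis by (intro sum_pos2[of _ i]) auto
  qed
  ultimately have "(\<Sum>i\<in>UNIV. cnj (z$i) * z$i) \<noteq> 0" by (metis less_irrefl of_real_eq_0_iff)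
  then show ?thesis using assms(2) by (auto simp: zeta_def)
qed

lemma zeta_zeroI: "hform z v = 0 \<Longrightarrow> zeta z v = 0"
  by (simp add: zeta_def)

lemma proj_smult: "c \<noteq> 0 \<Longrightarrow> proj (c *s z) = proj z"
  unfolding proj_def
proof (intro set_eqI iffI)
  fix x assume c: "c \<noteq> 0" and "x \<in> range (\<lambda>d. d *s z)"
  then obtain d where "x = d *s z" by blast
  then have "x = (d / c) *s (c *s z)" using c by (simp add: vector_smult_assoc)
  then show "x \<in> range (\<lambda>d. d *s (c *s z))" by blast
qed (auto simp: vector_smult_assoc)

lemma mem_proj: "z \<in> proj z"
  unfolding proj_def by (rule range_eqI[of _ _ 1]) simp

lemma proj_eqD:
  assumes "proj z = proj w" "z \<noteq> 0"
  obtains c where "c \<noteq> 0" "z = c *s w"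
proof -
  have "z \<in> proj w" using mem_proj[of z] assms by simp
  then obtain c where "z = c *s w" by (auto simp: proj_def)
  then show ?thesis using assms that[of c] by auto
qed

lemma heisS_hform:
  assumes "proj z \<in> heisS" "z \<noteq> 0" shows "hform z z = 0"
proof -
  obtain w where w: "proj z = proj w" "hform w w = 0" using assms by (auto simp: heisS_def)
  obtain c where "z = c *s w" using proj_eqD[OF w(1) assms(2)] by blast
  then show ?thesis using w by (simp add: hform_simps)
qed

text \<open>Depends on the point alone, so all local lifts lead to the same representative and no
  gluing is required.\<close>

definition canon :: "cpt \<Rightarrow> cvec" where
  "canon p = (SOME z. z \<in> p \<and> ell z = 1)"

lemma canon_proj:
  assumes "ell z \<noteq> 0"
  shows "canon (proj z) = inverse (ell z) *s z"
proof -
  have *: "inverse (ell z) *s z \<in> proj z" by (auto simp: proj_def)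
  have "canon (proj z) \<in> proj z \<and> ell (canon (proj z)) = 1"
    unfolding canon_def by (rule someI[of _ "inverse (ell z) *s z"]) (use * assms in \<open>simp add: ell_smult\<close>)
  moreover then obtain c where "canon (proj z) = c *s z" unfolding proj_def by blast
  ultimately have "canon (proj z) = c *s z" "c * ell z = 1" by (auto simp: ell_smult)
  then show ?thesis using assms by (metis inverse_unique mult.commute)
qed

lemma canon_heisS:
  assumes "p \<in> heisS"
  shows "ell (canon p) = 1" "canon p \<noteq> 0" "p = proj (canon p)" "hform (canon p) (canon p) = 0"
proof -
  obtain z where z: "p = proj z" "z \<noteq> 0" "hform z z = 0" using assms by (auto simp: heisS_def)
  have l: "ell z \<noteq> 0" by (rule ell_nonzero) fact+
  have c: "canon p = inverse (ell z) *s z" using canon_proj[OF l] z by simp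
  show "ell (canon p) = 1" using l by (simp add: c ell_smult)
  show "canon p \<noteq> 0" unfolding c using l z(2) by (simp add: vec_eq_iff)
  show "p = proj (canon p)" unfolding c using l z(1) by (simp add: proj_smult)
  show "hform (canon p) (canon p) = 0" unfolding c using z(3) by (simp add: hform_simps)
qed

lemma open_vdom: "open I \<Longrightarrow> open (vdom I \<epsilon>)"
  by (simp add: vdom_def open_Times)

lemma smooth_canon:
  assumes "open U" "smooth_on2 U G" "\<And>q. q \<in> U \<Longrightarrow> G q \<noteq> 0 \<and> g q = proj (G q) \<and> g q \<in> heisS"
  shows "smooth_on2 U (\<lambda>q. canon (g q))"
proof (rule smooth_on2_cong[OF assms(1)])
  have l: "ell (G q) \<noteq> 0" if "q \<in> U" for q
    using assms(3)[OF that] heisS_hform ell_nonzero by metis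
  show "inverse (ell (G q)) *s G q = canon (g q)" if "q \<in> U" for q
    using canon_proj[OF l[OF that]] assms(3)[OF that] by simp
  have "smooth_on2 U (\<lambda>q. ell (G q))"
    unfolding ell_def by (intro smooth_intros assms)
  then show "smooth_on2 U (\<lambda>q. inverse (ell (G q)) *s G q)"
    by (intro smooth_intros assms l)
qed

lemma smooth_variation_canon:
  assumes "smooth_variation_map I \<epsilon> g"
  shows "smooth_on2 (vdom I \<epsilon>) (\<lambda>q. canon (g q))"
proof (rule smooth_on2_local)
  fix p assume "p \<in> vdom I \<epsilon>"
  then obtain U G where "p \<in> U" "U \<subseteq> vdom I \<epsilon>" "local_lift2 U g G"
    using assms unfolding smooth_variation_map_def by blast
  then show "\<exists>U. p \<in> U \<and> open U \<and> smooth_on2 U (\<lambda>q. canon (g q))"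
    using smooth_canon[of U G g] assms unfolding smooth_variation_map_def local_lift2_def by blast
qed

text \<open>Rescaling a local lift also adds a multiple of the lift to its derivative. This affects
  neither tangency, the lift being null, nor immersion.\<close>

lemma legendrian_canon:
  assumes "legendrian I \<gamma>" "t \<in> I" and C': "((\<lambda>t. canon (\<gamma> t)) has_vector_derivative C') (at t)"
  shows "hform (canon (\<gamma> t)) C' = 0" "\<nexists>c. C' = c *s canon (\<gamma> t)"
proof -
  obtain U \<Gamma> where U: "t \<in> U" "U \<subseteq> I" "local_lift U \<gamma> \<Gamma>"
    and z: "\<nexists>c. vd \<Gamma> t = c *s \<Gamma> t" "zeta (\<Gamma> t) (vd \<Gamma> t) = 0"
    using assms(1,2) unfolding legendrian_def by metis
  have oU: "open U" and G: "smooth_on1 U \<Gamma>" and G0: "\<And>t. t \<in> U \<Longrightarrow> \<Gamma> t \<noteq> 0" "\<And>t. t \<in> U \<Longrightarrow> \<gamma> t = proj (\<Gamma> t)"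
    using U(3) by (auto simp: local_lift_def)
  have hs: "\<gamma> t \<in> heisS" if "t \<in> U" for t using that U assms(1) by (auto simp: legendrian_def)
  have h0: "hform (\<Gamma> t) (\<Gamma> t) = 0" if "t \<in> U" for t using hs[OF that] G0[OF that] heisS_hform by metis
  have l: "ell (\<Gamma> t) \<noteq> 0" if "t \<in> U" for t using ell_nonzero h0 G0 that by blast
  have h1: "hform (\<Gamma> t) (vd \<Gamma> t) = 0" by (rule zeta_zero_imp[OF G0(1)[OF U(1)] z(2)])
  have can: "canon (\<gamma> t) = inverse (ell (\<Gamma> t)) *s \<Gamma> t" if "t \<in> U" for t
    using canon_proj[OF l[OF that]] G0[OF that] by simp
  have dG: "(\<Gamma> has_vector_derivative vd \<Gamma> t) (at t)" by (rule smooth_on1_has_vd[OF G U(1)])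
  have "bounded_linear ell" unfolding linear_conv_bounded_linear[symmetric] ell_def
    by (rule linearI) (auto simp: algebra_simps complex_eq_iff cvec_scaleR_nth)
  from bounded_linear.has_vector_derivative[OF this dG]
  have "((\<lambda>t. ell (\<Gamma> t)) has_vector_derivative ell (vd \<Gamma> t)) (at t)" .
  from field_vector_diff_chain_at[OF this DERIV_inverse[OF l[OF U(1)]]]
  obtain k' where k': "((\<lambda>t. inverse (ell (\<Gamma> t))) has_vector_derivative k') (at t)" by (auto simp: o_def)
  define k where "k = inverse (ell (\<Gamma> t))"
  have k0: "k \<noteq> 0" using l[OF U(1)] by (simp add: k_def)
  have "((\<lambda>t. inverse (ell (\<Gamma> t)) *s \<Gamma> t) has_vector_derivative (k *s vd \<Gamma> t + k' *s \<Gamma> t)) (at t)"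
    using bounded_bilinear.has_vector_derivative[OF bounded_bilinear_smult k' dG] by (simp add: k_def)
  then have "((\<lambda>t. canon (\<gamma> t)) has_vector_derivative (k *s vd \<Gamma> t + k' *s \<Gamma> t)) (at t)"
    by (rule has_vector_derivative_transform_within_open[OF _ oU U(1)]) (simp add: can)
  then have C: "C' = k *s vd \<Gamma> t + k' *s \<Gamma> t" using C' vector_derivative_unique_at by blast
  show "hform (canon (\<gamma> t)) C' = 0" using h0[OF U(1)] h1 by (simp add: C can U(1) hform_simps)
  show "\<nexists>c. C' = c *s canon (\<gamma> t)"
  proof
    assume "\<exists>c. C' = c *s canon (\<gamma> t)"
    then obtain c where "k *s vd \<Gamma> t + k' *s \<Gamma> t = c *s (k *s \<Gamma> t)" by (auto simp: C can U(1) k_def)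
    then have "vd \<Gamma> t = ((c * k - k') / k) *s \<Gamma> t" using k0
      by (simp add: cvec_eq_iff field_simps)
    with z(1) show False by blast
  qed
qed

text \<open>Near \<open>x\<close> the imaginary part of a continuous logarithm moves by less than
  \<open>pi\<close>, so there it is \<open>l x\<close> plus the principal logarithm of
  \<open>d r / d x\<close>, which is differentiable.\<close>

lemma continuous_log_has_vector_derivative:
  fixes l d :: "real \<Rightarrow> complex"
  assumes "isCont l x" "open S" "x \<in> S" "\<And>r. r \<in> S \<Longrightarrow> d r = exp (l r)"
    and d': "(d has_vector_derivative d') (at x)"
  shows "(l has_vector_derivative d' / d x) (at x)"
proof -
  have "((\<lambda>r. Im (l r - l x)) \<longlongrightarrow> Im (l x - l x)) (at x)"
    using assms(1) unfolding isCont_def by (intro tendsto_intros)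
  then have "\<forall>\<^sub>F r in at x. \<bar>Im (l r - l x)\<bar> < pi"
    using order_tendstoD[of "\<lambda>r. \<bar>Im (l r - l x)\<bar>" 0 "at x" pi] tendsto_rabs_zero by fastforce
  then obtain T where T: "open T" "x \<in> T" "\<And>r. r \<in> T \<Longrightarrow> r \<noteq> x \<Longrightarrow> \<bar>Im (l r - l x)\<bar> < pi"
    unfolding eventually_at_topological by blast
  have eq: "l x + Ln (d r / d x) = l r" if "r \<in> S \<inter> T" for r
  proof (cases "r = x")
    case False
    have "d r / d x = exp (l r - l x)" using assms(3,4) that by (simp add: exp_diff)
    moreover have "Ln (exp (l r - l x)) = l r - l x"
      using T(3)[of r] that False by (intro Ln_exp) auto
    ultimately show ?thesis by simp
  qed (use assms(3,4) in simp)
  have dx: "d x \<noteq> 0" using assms(3,4) by simp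
  have "((\<lambda>r. d r / d x) has_vector_derivative d' / d x) (at x)"
    using d' by (rule has_vector_derivative_divide)
  moreover have "(Ln has_field_derivative 1) (at (d x / d x))"
    using has_field_derivative_Ln[of "1::complex"] dx by simp
  ultimately have "((Ln \<circ> (\<lambda>r. d r / d x)) has_vector_derivative d' / d x * 1) (at x)"
    by (rule field_vector_diff_chain_at)
  then have "((\<lambda>r. l x + Ln (d r / d x)) has_vector_derivative 0 + d' / d x) (at x)"
    by (intro has_vector_derivative_add has_vector_derivative_const) (simp add: o_def)
  then have "((\<lambda>r. l x + Ln (d r / d x)) has_vector_derivative d' / d x) (at x)" by simp
  then show ?thesis
    by (rule has_vector_derivative_transform_within_open[of _ _ _ "S \<inter> T"])
       (use T assms eq in auto)
qed

lemma smooth_on2_log: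
  fixes L D :: "real \<times> real \<Rightarrow> complex"
  assumes "open U" "smooth_on2 U D" "continuous_on U L" and e: "\<And>q. q \<in> U \<Longrightarrow> D q = exp (L q)"
  shows "smooth_on2 U L"
proof -
  have D0: "D q \<noteq> 0" if "q \<in> U" for q using e[OF that] by simp
  have "has_partials U L (\<lambda>q. pd1 D q / D q) (\<lambda>q. pd2 D q / D q)"
    unfolding has_partials_def
  proof (intro allI impI conjI)
    fix s \<sigma> assume q: "(s, \<sigma>) \<in> U"
    have ic: "isCont L (s, \<sigma>)" using assms(1,3) q continuous_on_eq_continuous_at by blast
    show "((\<lambda>r. L (r, \<sigma>)) has_vector_derivative pd1 D (s, \<sigma>) / D (s, \<sigma>)) (at s)"
    proof (rule continuous_log_has_vector_derivative[where d = "\<lambda>r. D (r, \<sigma>)"])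
      show "isCont (\<lambda>r. L (r, \<sigma>)) s"
        by (rule isCont_o2[where f = "\<lambda>r. (r, \<sigma>)" and g = L]) (use ic in \<open>auto intro: continuous_intros\<close>)
    qed (use open_slice1[OF assms(1) q] e smooth_on2_has_pd1[OF assms(2) q] in auto)
    show "((\<lambda>r. L (s, r)) has_vector_derivative pd2 D (s, \<sigma>) / D (s, \<sigma>)) (at \<sigma>)"
    proof (rule continuous_log_has_vector_derivative[where d = "\<lambda>r. D (s, r)"])
      show "isCont (\<lambda>r. L (s, r)) \<sigma>"
        by (rule isCont_o2[where f = "\<lambda>r. (s, r)" and g = L]) (use ic in \<open>auto intro: continuous_intros\<close>)
    qed (use open_slice2[OF assms(1) q] e smooth_on2_has_pd2[OF assms(2) q] in auto)
  qed
  moreover have "smooth_on2 U (\<lambda>q. pd1 D q / D q)" "smooth_on2 U (\<lambda>q. pd2 D q / D q)"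
    by (intro smooth_intros assms D0; assumption)+
  ultimately have "Ck n U L" for n
    using assms(1,3) by (cases n) (auto simp: smooth_on2_iff_Ck)
  then show ?thesis using assms(1) by (simp add: smooth_on2_iff_Ck)
qed

text \<open>If \<open>v\<close> and \<open>w\<close> are the derivatives of \<open>u\<close>, the
  arguments are \<open>f *s u\<close> and its first two derivatives by Leibniz' rule. Column
  operations leave \<open>f ^ 3\<close>, hence the cube root in the normalization.\<close>

lemma det3_frame_smult:
  "det3 (f *s u) (f *s v + f1 *s u) (f *s w + 2 * f1 *s v + f2 *s u) = f ^ 3 * det3 u v w"
  unfolding det3_expand by (simp add: algebra_simps power3_eq_cube)

text \<open>A normalized lift of a whole family of Legendrian curves, smooth in the parameter of the
  family as well.\<close>

locale framed_lift =
  fixes U :: "(real \<times> real) set" and N :: "real \<times> real \<Rightarrow> cvec"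
  assumes open_U: "open U" and smooth_N: "smooth_on2 U N"
    and null: "q \<in> U \<Longrightarrow> hform (N q) (N q) = 0"
    and leg: "q \<in> U \<Longrightarrow> hform (N q) (pd1 N q) = 0"
    and det: "q \<in> U \<Longrightarrow> det3 (N q) (pd1 N q) (pd1 (pd1 N) q) = \<i>"

lemma pd_smult:
  fixes F :: "real \<times> real \<Rightarrow> cvec"
  assumes "smooth_on2 U f" "smooth_on2 U F" "q \<in> U"
  shows "pd1 (\<lambda>q. f q *s F q) q = f q *s pd1 F q + pd1 f q *s F q"
  using pd_bilinear(1)[OF bounded_bilinear_smult assms] .

lemma
  assumes "smooth_on2 U F" "smooth_on2 U G" "q \<in> U"
  shows pd1_hform: "pd1 (\<lambda>q. hform (F q) (G q)) q = hform (F q) (pd1 G q) + hform (pd1 F q) (G q)"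
    and pd2_hform: "pd2 (\<lambda>q. hform (F q) (G q)) q = hform (F q) (pd2 G q) + hform (pd2 F q) (G q)"
  using pd_bilinear[OF bounded_bilinear_hform assms] by blast+

lemma pd_eq_constD:
  assumes "open U" "\<And>q. q \<in> U \<Longrightarrow> f q = c" "q \<in> U"
  shows "pd1 f q = 0" "pd2 f q = 0"
  using smooth_on2_pd_cong[OF assms(1) smooth_on2_const[OF assms(1), of c] _ assms(3), of f] assms(2)
  by simp_all

text \<open>The Gram matrix is triangular about the antidiagonal, and its determinant is minus the
  cube of \<open>hform v v\<close>. The third hypothesis is the derivative of
  \<open>hform z v = 0\<close> along a Legendrian curve; such an immersion thus has nonzero
  \<open>det3\<close>.\<close>

lemma gram_legendrian:
  assumes "hform z z = 0" "hform z v = 0" "hform z w = - hform v v"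
  shows "cnj (det3 z v w) * det3 z v w = hform v v ^ 3"
proof -
  have 1: "hform v z = 0" using cnj_hform[of z v] assms by simp
  have "hform w z = cnj (- hform v v)" using cnj_hform[of z w] assms by metis
  then have 2: "hform w z = - hform v v" by (simp add: cnj_hform)
  show ?thesis using gram_det3[of z v w z v w] 1 2 assms by (simp add: power3_eq_cube)
qed

lemma convex_vdom: "is_interval I \<Longrightarrow> convex (vdom I \<epsilon>)"
  unfolding vdom_def by (intro convex_Times is_interval_convex) auto

lemma framed_lift_exists:
  assumes I: "open I" "is_interval I" and svm: "smooth_variation_map I \<epsilon> g"
    and L: "\<And>\<tau>. \<tau> \<in> {-\<epsilon><..<\<epsilon>} \<Longrightarrow> legendrian I (\<lambda>t. g (t, \<tau>))"
  obtains N where "framed_lift (vdom I \<epsilon>) N" "\<And>q. q \<in> vdom I \<epsilon> \<Longrightarrow> N q \<noteq> 0 \<and> g q = proj (N q)"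
proof -
  define U where "U = vdom I \<epsilon>"
  have oU: "open U" using open_vdom[OF I(1)] by (simp add: U_def)
  define C where "C = (\<lambda>q. canon (g q))"
  have sC: "smooth_on2 U C" unfolding C_def U_def by (rule smooth_variation_canon[OF svm])
  have hs: "g q \<in> heisS" if "q \<in> U" for q using svm that by (auto simp: smooth_variation_map_def U_def)
  have C0: "C q \<noteq> 0" "g q = proj (C q)" "hform (C q) (C q) = 0" if "q \<in> U" for q
    using canon_heisS[OF hs[OF that]] by (simp_all add: C_def)
  have Cl: "hform (C q) (pd1 C q) = 0 \<and> (\<nexists>c. pd1 C q = c *s C q)" if "q \<in> U" for q
  proof -
    obtain t \<tau> where q: "q = (t, \<tau>)" by (cases q)
    with that have t: "t \<in> I" "\<tau> \<in> {-\<epsilon><..<\<epsilon>}" by (auto simp: U_def vdom_def)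
    have "((\<lambda>t. canon (g (t, \<tau>))) has_vector_derivative pd1 C (t, \<tau>)) (at t)"
      using smooth_on2_has_pd1[OF sC that[unfolded q]] by (simp add: C_def)
    from legendrian_canon[OF L[OF t(2)] t(1) this] show ?thesis by (simp add: q C_def)
  qed
  have p0: "hform (pd1 C q) (pd1 C q) \<noteq> 0" if "q \<in> U" for q
    using null_perp_null[OF C0(1)[OF that] C0(3)[OF that]] Cl[OF that] by blast
  have C2: "hform (C q) (pd1 (pd1 C) q) = - hform (pd1 C q) (pd1 C q)" if q: "q \<in> U" for q
  proof -
    have "pd1 (\<lambda>q. hform (C q) (pd1 C q)) q = 0"
      by (rule pd_eq_constD(1)[OF oU _ q, of _ 0]) (use Cl in blast)
    then show ?thesis
      unfolding pd1_hform[OF sC smooth_on2_pd1[OF sC] q] by (simp add: eq_neg_iff_add_eq_0)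
  qed
  define D where "D = (\<lambda>q. det3 (C q) (pd1 C q) (pd1 (pd1 C) q))"
  have sD: "smooth_on2 U D" unfolding D_def by (intro smooth_intros oU sC)
  have D0: "D q \<noteq> 0" if "q \<in> U" for q
  proof -
    have "cnj (D q) * D q = hform (pd1 C q) (pd1 C q) ^ 3"
      unfolding D_def by (rule gram_legendrian) (use C0 Cl C2 that in auto)
    then show ?thesis using p0[OF that] by auto
  qed
  \<comment> \<open>A cube root of \<open>\<i> / D\<close> is wanted on the whole domain. It comes
    from a continuous logarithm of \<open>D\<close>, which exists because the domain is
    convex.\<close>
  obtain L where L: "continuous_on U L" "\<And>q. q \<in> U \<Longrightarrow> D q = exp (L q)"
    using continuous_logarithm_on_contractible[OF smooth_on2_continuous[OF sD]
      convex_imp_contractible[OF convex_vdom[OF I(2), of \<epsilon>, folded U_def]] D0] by blast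
  have sL: "smooth_on2 U L" using oU sD L by (rule smooth_on2_log)
  define f where "f = (\<lambda>q. exp ((\<i> * of_real pi / 2 - L q) / 3))"
  have sf: "smooth_on2 U f" unfolding f_def
    by (intro smooth_intros oU sL) auto
  have f3: "f q ^ 3 * D q = \<i>" if "q \<in> U" for q
  proof -
    have "f q ^ 3 = exp (of_nat 3 * ((\<i> * of_real pi / 2 - L q) / 3))"
      unfolding f_def exp_of_nat_mult ..
    also have "of_nat 3 * ((\<i> * of_real pi / 2 - L q) / 3) = \<i> * of_real pi / 2 - L q" by simp
    finally have "f q ^ 3 * D q = exp (\<i> * of_real pi / 2 - L q + L q)"
      unfolding L(2)[OF that] exp_add by simp
    also have "\<dots> = exp (\<i> * of_real (pi / 2))" by simp
    also have "\<dots> = \<i>" by (simp only: exp_Euler cos_of_real sin_of_real cos_pi_half sin_pi_half) simp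
    finally show ?thesis .
  qed
  define N where "N = (\<lambda>q. f q *s C q)"
  have sN: "smooth_on2 U N" unfolding N_def by (intro smooth_intros oU sf sC)
  have N1: "pd1 N q = f q *s pd1 C q + pd1 f q *s C q" if "q \<in> U" for q
    unfolding N_def by (rule pd_smult[OF sf sC that])
  have N2: "pd1 (pd1 N) q = f q *s pd1 (pd1 C) q + 2 * pd1 f q *s pd1 C q + pd1 (pd1 f) q *s C q" if q: "q \<in> U" for q
  proof -
    have s: "smooth_on2 U (\<lambda>q. f q *s pd1 C q)" "smooth_on2 U (\<lambda>q. pd1 f q *s C q)"
      by (intro smooth_intros oU sf sC)+
    have "pd1 (pd1 N) q = pd1 (\<lambda>q. f q *s pd1 C q + pd1 f q *s C q) q"
      by (rule smooth_on2_pd_cong[OF oU smooth_on2_add[OF oU s] _ q]) (simp add: N1)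
    also have "\<dots> = f q *s pd1 (pd1 C) q + 2 * pd1 f q *s pd1 C q + pd1 (pd1 f) q *s C q"
      unfolding pd_add[OF s q] pd_smult[OF sf smooth_on2_pd1[OF sC] q] pd_smult[OF smooth_on2_pd1[OF sf] sC q]
      by (simp add: vec_eq_iff algebra_simps)
    finally show ?thesis .
  qed
  have f0: "f q \<noteq> 0" for q by (simp add: f_def)
  have Nq: "N q = f q *s C q" for q by (simp add: N_def)
  show ?thesis
  proof (rule that)
    show "framed_lift (vdom I \<epsilon>) N"
      unfolding U_def[symmetric]
    proof
      fix q assume q: "q \<in> U"
      show "hform (N q) (N q) = 0" using C0(3)[OF q] by (simp add: N_def hform_simps)
      show "hform (N q) (pd1 N q) = 0" unfolding N1[OF q] Nq using Cl[OF q] C0(3)[OF q] by (simp add: hform_simps)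
      show "det3 (N q) (pd1 N q) (pd1 (pd1 N) q) = \<i>"
        unfolding N1[OF q] N2[OF q] Nq det3_frame_smult using f3[OF q] by (simp add: D_def)
    qed (fact oU sN)+
    show "N q \<noteq> 0 \<and> g q = proj (N q)" if "q \<in> vdom I \<epsilon>" for q
      using C0[of q] f0[of q] that unfolding N_def U_def[symmetric] by (simp add: proj_smult)
  qed
qed

lemma funpow2: "(f ^^ 2) x = f (f x)" and funpow3: "(f ^^ 3) x = f (f (f x))"
  by (simp_all add: numeral_2_eq_2 numeral_3_eq_3)

lemma framed_lift_normalized:
  assumes "framed_lift (vdom I \<epsilon>) N" "\<And>q. q \<in> vdom I \<epsilon> \<Longrightarrow> N q \<noteq> 0 \<and> g q = proj (N q)" "\<tau> \<in> {-\<epsilon><..<\<epsilon>}"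
  shows "normalized_lift I (\<lambda>t. g (t, \<tau>)) (\<lambda>t. N (t, \<tau>))"
proof -
  interpret framed_lift "vdom I \<epsilon>" N by fact
  show ?thesis unfolding normalized_lift_def
  proof (intro conjI ballI)
    show "smooth_on1 I (\<lambda>t. N (t, \<tau>))"
      by (rule smooth_on1_slice[OF smooth_N[unfolded vdom_def] assms(3)])
    fix t assume "t \<in> I"
    then have q: "(t, \<tau>) \<in> vdom I \<epsilon>" using assms(3) by (simp add: vdom_def)
    show "N (t, \<tau>) \<noteq> 0" "g (t, \<tau>) = proj (N (t, \<tau>))" using assms(2)[OF q] by auto
    show "det3 (N (t, \<tau>)) (vd (\<lambda>t. N (t, \<tau>)) t) ((vd ^^ 2) (\<lambda>t. N (t, \<tau>)) t) = \<i>"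
      using det[OF q] by (simp add: vd_funpow_slice vd_slice funpow2)
  qed
qed

text \<open>Lets a single curve enter the theory of families.\<close>

lemma constant_variation:
  assumes "open I" "legendrian I \<gamma>"
  shows "smooth_variation_map I \<epsilon> (\<lambda>q. \<gamma> (fst q))"
  unfolding smooth_variation_map_def
proof (intro conjI ballI)
  fix q assume q: "q \<in> vdom I \<epsilon>"
  then have t: "fst q \<in> I" by (auto simp: vdom_def)
  then show "\<gamma> (fst q) \<in> heisS" using assms(2) by (simp add: legendrian_def)
  obtain U \<Gamma> where "fst q \<in> U" "U \<subseteq> I" "local_lift U \<gamma> \<Gamma>"
    using assms(2) t unfolding legendrian_def by blast
  then have "q \<in> U \<times> {-\<epsilon><..<\<epsilon>}" "U \<times> {-\<epsilon><..<\<epsilon>} \<subseteq> vdom I \<epsilon>"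
    "local_lift2 (U \<times> {-\<epsilon><..<\<epsilon>}) (\<lambda>q. \<gamma> (fst q)) (\<lambda>q. \<Gamma> (fst q))"
    using q smooth_on2_fst[of U "{-\<epsilon><..<\<epsilon>}" \<Gamma>]
    by (auto simp: vdom_def local_lift_def local_lift2_def open_Times)
  then show "\<exists>U G. q \<in> U \<and> U \<subseteq> vdom I \<epsilon> \<and> local_lift2 U (\<lambda>q. \<gamma> (fst q)) G"
    by (intro exI conjI)
qed

lemma legendrian_framed_lift:
  assumes I: "open I" "is_interval I" and L: "legendrian I \<gamma>"
  obtains N where "framed_lift (vdom I 1) N" "\<And>q. q \<in> vdom I 1 \<Longrightarrow> N q \<noteq> 0 \<and> \<gamma> (fst q) = proj (N q)"
    "normalized_lift I \<gamma> (\<lambda>t. N (t, 0))"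
proof -
  obtain N where N: "framed_lift (vdom I 1) N" "\<And>q. q \<in> vdom I 1 \<Longrightarrow> N q \<noteq> 0 \<and> \<gamma> (fst q) = proj (N q)"
    by (rule framed_lift_exists[OF I constant_variation[OF I(1) L]]) (use L in auto)
  have "normalized_lift I \<gamma> (\<lambda>t. N (t, 0))"
    using framed_lift_normalized[OF N, of 0] by simp
  with N that show ?thesis by blast
qed

lemma normalized_lift_nlift:
  assumes "open I" "is_interval I" "legendrian I \<gamma>"
  shows "normalized_lift I \<gamma> (nlift I \<gamma>)"
proof -
  obtain N where "normalized_lift I \<gamma> (\<lambda>t. N (t, 0 :: real))"
    by (rule legendrian_framed_lift[OF assms])
  then show ?thesis unfolding nlift_def by (rule someI[of "normalized_lift I \<gamma>"])
qed

text \<open>The quotient \<open>k\<close> of the two lifts is smooth with \<open>k ^ 3 = 1\<close>;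
  differentiating gives \<open>3 * k\<^sup>2 * k' = 0\<close>, so \<open>k\<close> is constant on
  the interval.\<close>

lemma normalized_lift_unique:
  assumes I: "open I" "is_interval I" and hs: "\<And>t. t \<in> I \<Longrightarrow> \<gamma> t \<in> heisS"
    and A: "normalized_lift I \<gamma> A" and B: "normalized_lift I \<gamma> B"
  obtains c where "cmod c = 1" "\<And>t. t \<in> I \<Longrightarrow> B t = c *s A t"
proof (cases "I = {}")
  case True then show ?thesis using that[of 1] by auto
next
  case False
  define V where "V = I \<times> (UNIV :: real set)"
  have oV: "open V" using I by (simp add: V_def open_Times)
  have sA: "smooth_on1 I A" and sB: "smooth_on1 I B" using A B by (auto simp: normalized_lift_def)
  have sA2: "smooth_on2 V (\<lambda>q. A (fst q))" and sB2: "smooth_on2 V (\<lambda>q. B (fst q))"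
    using smooth_on2_fst[OF I(1) open_UNIV sA] smooth_on2_fst[OF I(1) open_UNIV sB] by (simp_all add: V_def)
  have lA: "ell (A t) \<noteq> 0" if "t \<in> I" for t
    using A hs[OF that] that ell_nonzero heisS_hform unfolding normalized_lift_def by metis
  define k where "k = (\<lambda>q::real \<times> real. ell (B (fst q)) / ell (A (fst q)))"
  have sk: "smooth_on2 V k" unfolding k_def ell_def
    by (intro smooth_intros oV sA2 sB2) (use lA in \<open>auto simp: V_def ell_def\<close>)
  have BA: "B (fst q) = k q *s A (fst q)" if "q \<in> V" for q
  proof -
    have t: "fst q \<in> I" using that by (auto simp: V_def)
    then have "proj (B (fst q)) = proj (A (fst q))" "B (fst q) \<noteq> 0" using A B by (auto simp: normalized_lift_def)
    then obtain c where c: "B (fst q) = c *s A (fst q)" using proj_eqD by metis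
    then have "ell (B (fst q)) = c * ell (A (fst q))" by (simp add: ell_smult)
    then show ?thesis using c lA[OF t] by (simp add: k_def)
  qed
  have B1: "vd B (fst q) = k q *s vd A (fst q) + pd1 k q *s A (fst q)" if q: "q \<in> V" for q
  proof -
    have "pd1 (\<lambda>q. B (fst q)) q = pd1 (\<lambda>q. k q *s A (fst q)) q"
      by (rule smooth_on2_pd_cong[OF oV smooth_on2_smult[OF oV sk sA2] _ q]) (simp add: BA)
    then show ?thesis using pd_smult[OF sk sA2 q] by (simp add: pd1_fst)
  qed
  have sA3: "smooth_on2 V (\<lambda>q. vd A (fst q))" using smooth_on2_pd1[OF sA2] by (simp add: pd1_fst)
  have B2: "vd (vd B) (fst q) = k q *s vd (vd A) (fst q) + 2 * pd1 k q *s vd A (fst q) + pd1 (pd1 k) q *s A (fst q)"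
    if q: "q \<in> V" for q
  proof -
    have s: "smooth_on2 V (\<lambda>q. k q *s vd A (fst q))" "smooth_on2 V (\<lambda>q. pd1 k q *s A (fst q))"
      by (intro smooth_intros oV sk sA2 sA3)+
    have "pd1 (\<lambda>q. vd B (fst q)) q = pd1 (\<lambda>q. k q *s vd A (fst q) + pd1 k q *s A (fst q)) q"
      by (rule smooth_on2_pd_cong[OF oV smooth_on2_add[OF oV s] _ q]) (simp add: B1)
    also have "\<dots> = k q *s vd (vd A) (fst q) + 2 * pd1 k q *s vd A (fst q) + pd1 (pd1 k) q *s A (fst q)"
      unfolding pd_add[OF s q] pd_smult[OF sk sA3 q] pd_smult[OF smooth_on2_pd1[OF sk] sA2 q]
      by (simp add: vec_eq_iff algebra_simps pd1_fst)
    finally show ?thesis by (simp add: pd1_fst)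
  qed
  have k3: "k q ^ 3 = 1" if q: "q \<in> V" for q
  proof -
    have t: "fst q \<in> I" using that by (auto simp: V_def)
    have "\<i> = det3 (B (fst q)) (vd B (fst q)) (vd (vd B) (fst q))"
      using B t by (simp add: normalized_lift_def funpow2)
    also have "\<dots> = k q ^ 3 * \<i>"
      unfolding BA[OF q] B1[OF q] B2[OF q] det3_frame_smult using A t by (simp add: normalized_lift_def funpow2)
    finally show ?thesis by simp
  qed
  have kd: "pd1 k q = 0" if q: "q \<in> V" for q
  proof -
    have "pd1 (\<lambda>q. k q * (k q * k q)) q = 0"
      by (rule pd_eq_constD(1)[OF oV _ q, of _ 1]) (use k3 in \<open>simp add: power3_eq_cube mult.assoc\<close>)
    moreover have "pd1 (\<lambda>q. k q * (k q * k q)) q = 3 * k q ^ 2 * pd1 k q"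
      unfolding pd_bilinear(1)[OF bounded_bilinear_mult sk smooth_on2_mult[OF oV sk sk] q]
        pd_bilinear(1)[OF bounded_bilinear_mult sk sk q] by (simp add: algebra_simps power2_eq_square)
    moreover have "k q \<noteq> 0" using k3[OF q] by auto
    ultimately show ?thesis by simp
  qed
  obtain t0 where t0: "t0 \<in> I" using False by blast
  have "k (t, 0) = k (t0, 0)" if "t \<in> I" for t
  proof -
    have "((\<lambda>t. k (t, 0)) has_derivative (\<lambda>h. 0)) (at t within I)" if "t \<in> I" for t
    proof -
      have "((\<lambda>t. k (t, 0)) has_vector_derivative 0) (at t)"
        using smooth_on2_has_pd1[OF sk, of t 0] kd[of "(t, 0)"] that by (simp add: V_def)
      then show ?thesis by (simp add: has_vector_derivative_def has_derivative_at_withinI)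
    qed
    then obtain c where "\<And>t. t \<in> I \<Longrightarrow> k (t, 0) = c"
      using has_derivative_zero_constant[OF is_interval_convex[OF I(2)]] by blast
    with that t0 show ?thesis by metis
  qed
  then have 1: "B t = k (t0, 0) *s A t" if "t \<in> I" for t
    using BA[of "(t, 0)"] that by (simp add: V_def)
  have "cmod (k (t0, 0)) = 1" using power_eq_1_iff[OF k3[of "(t0, 0)"]] t0 by (simp add: V_def)
  with 1 that show ?thesis by blast
qed

lemma vd_funpow_smult:
  fixes A B :: "real \<Rightarrow> cvec"
  assumes "open I" "smooth_on1 I A" "\<And>t. t \<in> I \<Longrightarrow> B t = c *s A t" "t \<in> I"
  shows "(vd ^^ n) B t = c *s (vd ^^ n) A t"
  using assms(4)
proof (induction n arbitrary: t)
  case 0 then show ?case using assms(3) by simp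
next
  case (Suc n)
  have "((vd ^^ n) A has_vector_derivative (vd ^^ Suc n) A t) (at t)"
    using assms(2) Suc.prems unfolding smooth_on1_def by (simp add: vd_def vector_derivative_works[symmetric])
  then have "((\<lambda>t. c *s (vd ^^ n) A t) has_vector_derivative c *s (vd ^^ Suc n) A t) (at t)"
    by (rule bounded_linear.has_vector_derivative[OF bounded_bilinear.bounded_linear_right[OF bounded_bilinear_smult]])
  then have "((vd ^^ n) B has_vector_derivative c *s (vd ^^ Suc n) A t) (at t)"
    by (rule has_vector_derivative_transform_within_open[OF _ assms(1) Suc.prems]) (simp add: Suc.IH)
  then have "vd ((vd ^^ n) B) t = c *s (vd ^^ Suc n) A t" unfolding vd_def[of "(vd ^^ n) B"] by (rule vector_derivative_at)
  then show ?case by simp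
qed

text \<open>\<open>nlift\<close> is an arbitrary choice, but it differs from \<open>A\<close> by a
  unimodular constant, which the form does not see.\<close>

lemma fubini_eq:
  assumes I: "open I" "is_interval I" and L: "legendrian I \<gamma>"
    and A: "normalized_lift I \<gamma> A" and t: "t \<in> I"
  shows "fub_a I \<gamma> t = Im (hform ((vd ^^ 3) A t) ((vd ^^ 2) A t))"
    "fub_b I \<gamma> t = Re (hform ((vd ^^ 2) A t) ((vd ^^ 2) A t)) / 2"
proof -
  have hs: "\<gamma> t \<in> heisS" if "t \<in> I" for t using L that by (simp add: legendrian_def)
  obtain c where c: "cmod c = 1" "\<And>t. t \<in> I \<Longrightarrow> nlift I \<gamma> t = c *s A t"
    using normalized_lift_unique[OF I hs A normalized_lift_nlift[OF I L]] by blast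
  have sA: "smooth_on1 I A" using A by (simp add: normalized_lift_def)
  have "cnj c * c = 1" using c(1) complex_norm_square[of c] by (simp add: mult.commute)
  then have [simp]: "hform (c *s x) (c *s y) = hform x y" for x y
    by (simp add: hform_simps) (metis mult.commute)
  show "fub_a I \<gamma> t = Im (hform ((vd ^^ 3) A t) ((vd ^^ 2) A t))"
    "fub_b I \<gamma> t = Re (hform ((vd ^^ 2) A t) ((vd ^^ 2) A t)) / 2"
    using vd_funpow_smult[OF I(1) sA c(2) t] unfolding fub_a_def fub_b_def by simp_all
qed

section \<open>Variation of the Fubini densities\<close>

lemma pd1_eqI:
  assumes "open U" "smooth_on2 U G" "\<And>q. q \<in> U \<Longrightarrow> G q = E q" "(t, \<tau>) \<in> U"
    "((\<lambda>r. E (r, \<tau>)) has_real_derivative e) (at t)"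
  shows "pd1 G (t, \<tau>) = e"
proof -
  have "((\<lambda>r. G (r, \<tau>)) has_vector_derivative pd1 G (t, \<tau>)) (at t)"
    by (rule smooth_on2_has_pd1[OF assms(2,4)])
  then have "((\<lambda>r. E (r, \<tau>)) has_vector_derivative pd1 G (t, \<tau>)) (at t)"
    by (rule has_vector_derivative_transform_within_open[OF _ open_slice1[OF assms(1,4)]]) (simp add: assms(3))
  then show ?thesis using assms(5)
    by (simp add: has_real_derivative_iff_has_vector_derivative) (metis vector_derivative_unique_at)
qed

lemma smooth_on2_DERIV:
  fixes F :: "real \<times> real \<Rightarrow> real"
  assumes "smooth_on2 U F" "(t, \<tau>) \<in> U"
  shows "((\<lambda>r. F (r, \<tau>)) has_real_derivative pd1 F (t, \<tau>)) (at t)"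
  using smooth_on2_has_pd1[OF assms] by (simp add: has_real_derivative_iff_has_vector_derivative)

lemma pd1_Im: "smooth_on2 U f \<Longrightarrow> q \<in> U \<Longrightarrow> pd1 (\<lambda>q. Im (f q)) q = Im (pd1 f q)"
  and pd2_Im: "smooth_on2 U f \<Longrightarrow> q \<in> U \<Longrightarrow> pd2 (\<lambda>q. Im (f q)) q = Im (pd2 f q)"
  and pd1_Re: "smooth_on2 U f \<Longrightarrow> q \<in> U \<Longrightarrow> pd1 (\<lambda>q. Re (f q)) q = Re (pd1 f q)"
  by (rule pd_linear[OF bounded_linear_Im] pd_linear[OF bounded_linear_Re]; assumption)+

section \<open>Moving frame, structure equation and variation of the density a\<close>

context framed_lift
begin

definition fA :: "real \<times> real \<Rightarrow> real" where
  "fA q = Im (hform (pd1 (pd1 (pd1 N)) q) (pd1 (pd1 N) q))"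

definition fB :: "real \<times> real \<Rightarrow> real" where
  "fB q = Re (hform (pd1 (pd1 N) q) (pd1 (pd1 N) q)) / 2"

lemmas sN0 = smooth_N
lemmas sN1 = smooth_on2_pd1[OF sN0]
lemmas sN2 = smooth_on2_pd1[OF sN1]
lemmas sN3 = smooth_on2_pd1[OF sN2]
lemmas sV = smooth_on2_pd2[OF sN0]
lemmas sV1 = smooth_on2_pd1[OF sV]
lemmas sV2 = smooth_on2_pd1[OF sV1]

lemma smooth_fA: "smooth_on2 U fA"
  unfolding fA_def[abs_def] by (intro smooth_intros open_U sN2 sN3)

lemma smooth_fB: "smooth_on2 U fB"
  unfolding fB_def[abs_def] by (intro smooth_intros open_U sN2) auto

lemma leg': "q \<in> U \<Longrightarrow> hform (pd1 N q) (N q) = 0"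
  using cnj_hform[of "N q" "pd1 N q"] leg by simp

lemma h02_aux: "q \<in> U \<Longrightarrow> hform (N q) (pd1 (pd1 N) q) = - hform (pd1 N q) (pd1 N q)"
  using pd_eq_constD(1)[OF open_U leg] pd1_hform[OF sN0 sN1] by (simp add: eq_neg_iff_add_eq_0)

text \<open>The Gram determinant makes it a cube root of 1, and it is real because the form is
  Hermitian.\<close>

lemma h11: assumes "q \<in> U" shows "hform (pd1 N q) (pd1 N q) = 1"
proof -
  have "hform (pd1 N q) (pd1 N q) ^ 3 = 1"
    using gram_legendrian[OF null leg h02_aux] det assms by simp
  moreover obtain r where r: "hform (pd1 N q) (pd1 N q) = complex_of_real r"
    by (metis hform_self_real)
  ultimately have "complex_of_real (r ^ 3) = complex_of_real 1" by simp
  then have "r ^ 3 = 1" by (simp only: of_real_eq_iff)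
  moreover from power_eq_1_iff[OF this] have "r = 1 \<or> r = -1" by auto
  ultimately have "r = 1" by auto
  then show ?thesis by (simp add: r)
qed

lemma h02: "q \<in> U \<Longrightarrow> hform (N q) (pd1 (pd1 N) q) = -1"
  using h02_aux h11 by simp

lemma h20: "q \<in> U \<Longrightarrow> hform (pd1 (pd1 N) q) (N q) = -1"
  using cnj_hform[of "N q" "pd1 (pd1 N) q"] h02 by simp

text \<open>In the derivative of the normalization \<open>det\<close>, the terms with a repeated
  column vanish.\<close>

lemma det3_pd1:
  assumes q: "q \<in> U"
  shows "det3 (N q) (pd1 N q) (pd1 (pd1 (pd1 N)) q) = 0"
proof -
  obtain t \<tau> where qt: "q = (t, \<tau>)" by (cases q)
  have c: "((\<lambda>r. F (r, \<tau>) $ i) has_vector_derivative pd1 F (t, \<tau>) $ i) (at t)"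
    if "smooth_on2 U F" for F :: "real \<times> real \<Rightarrow> cvec" and i
    by (rule bounded_linear.has_vector_derivative[OF bounded_linear_vec_nth smooth_on2_has_pd1[OF that q[unfolded qt]]])
  note d = c[OF sN0] c[OF sN1] c[OF sN2]
  have "((\<lambda>r. det3 (N (r, \<tau>)) (pd1 N (r, \<tau>)) (pd1 (pd1 N) (r, \<tau>))) has_vector_derivative
      det3 (N q) (pd1 N q) (pd1 (pd1 (pd1 N)) q)) (at t)"
    unfolding det3_expand
    by (rule has_vector_derivative_eq_rhs,
        (rule has_vector_derivative_add has_vector_derivative_diff has_vector_derivative_mult d)+)
       (simp add: qt algebra_simps)
  moreover have "((\<lambda>r. det3 (N (r, \<tau>)) (pd1 N (r, \<tau>)) (pd1 (pd1 N) (r, \<tau>))) has_vector_derivative 0) (at t)"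
    by (rule has_vector_derivative_transform_within_open[OF has_vector_derivative_const[of \<i>] open_slice1[OF open_U q[unfolded qt]]])
       (simp add: det)
  ultimately show ?thesis using vector_derivative_unique_at by blast
qed

text \<open>In the Gram identity for \<open>N, N', N''\<close> against \<open>N, N', N'''\<close>
  the determinant side is 0, and the only surviving product on the other side is
  \<open>hform N N'''\<close> times a nonzero constant.\<close>

lemma h03: assumes "q \<in> U" shows "hform (N q) (pd1 (pd1 (pd1 N)) q) = 0"
  using gram_det3[of "N q" "pd1 N q" "pd1 (pd1 N) q" "N q" "pd1 N q" "pd1 (pd1 (pd1 N)) q"]
    det3_pd1[OF assms] null[OF assms] leg[OF assms] leg'[OF assms] h11[OF assms] h20[OF assms]
  by simp

lemma h12: assumes "q \<in> U" shows "hform (pd1 N q) (pd1 (pd1 N) q) = 0"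
  using pd_eq_constD(1)[OF open_U h02 assms] pd1_hform[OF sN0 sN2 assms] h03[OF assms] by simp

lemma h22: "hform (pd1 (pd1 N) q) (pd1 (pd1 N) q) = complex_of_real (2 * fB q)"
  by (simp add: fB_def hform_self_real)

lemma h13: assumes "q \<in> U" shows "hform (pd1 N q) (pd1 (pd1 (pd1 N)) q) = - complex_of_real (2 * fB q)"
  using pd_eq_constD(1)[OF open_U h12 assms] pd1_hform[OF sN1 sN2 assms] h22[of q]
  by (simp add: eq_neg_iff_add_eq_0)

lemma h23: assumes q: "q \<in> U"
  shows "hform (pd1 (pd1 N) q) (pd1 (pd1 (pd1 N)) q) = Complex (pd1 fB q) (- fA q)"
proof -
  let ?h = "hform (pd1 (pd1 N) q) (pd1 (pd1 (pd1 N)) q)"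
  have s: "smooth_on2 U (\<lambda>q. Re (hform (pd1 (pd1 N) q) (pd1 (pd1 N) q)))"
    by (intro smooth_intros open_U sN2)
  have "pd1 fB q = pd1 (\<lambda>q. Re (hform (pd1 (pd1 N) q) (pd1 (pd1 N) q))) q / 2"
    unfolding fB_def[abs_def] using pd_linear(1)[OF bounded_linear_divide s q] .
  also have "pd1 (\<lambda>q. Re (hform (pd1 (pd1 N) q) (pd1 (pd1 N) q))) q = Re (?h + cnj ?h)"
    using pd1_Re[OF smooth_on2_hform[OF open_U sN2 sN2] q] pd1_hform[OF sN2 sN2 q] by (simp add: cnj_hform)
  finally have 1: "Re ?h = pd1 fB q" by simp
  have "Im ?h = - fA q" unfolding fA_def using cnj_hform[of "pd1 (pd1 N) q" "pd1 (pd1 (pd1 N)) q"]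
    by (metis complex_cnj minus_minus cnj.sel(2))
  with 1 show ?thesis by (simp add: complex_eq_iff)
qed

text \<open>Both sides have the same pairings with the frame \<open>N, N', N''\<close>, and the form
  is nondegenerate.\<close>

lemma structure_equation:
  assumes q: "q \<in> U"
  shows "pd1 (pd1 (pd1 N)) q = Complex (- pd1 fB q) (fA q) *s N q + complex_of_real (- 2 * fB q) *s pd1 N q"
proof -
  let ?u = "pd1 (pd1 (pd1 N)) q - (Complex (- pd1 fB q) (fA q) *s N q + complex_of_real (- 2 * fB q) *s pd1 N q)"
  have "?u = 0"
  proof (rule hform_nondegenerate)
    show "det3 (N q) (pd1 N q) (pd1 (pd1 N) q) \<noteq> 0" using det[OF q] by simp
    show "hform (N q) ?u = 0" using h03[OF q] null[OF q] leg[OF q] by (simp add: hform_simps)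
    show "hform (pd1 N q) ?u = 0" using h13[OF q] leg'[OF q] h11[OF q] by (simp add: hform_simps)
    have "hform (pd1 (pd1 N) q) (pd1 N q) = 0" using h12[OF q] cnj_hform[of "pd1 N q" "pd1 (pd1 N) q"] by simp
    then show "hform (pd1 (pd1 N) q) ?u = 0" using h23[OF q] h20[OF q] by (simp add: hform_simps complex_eq_iff)
  qed
  then show ?thesis by simp
qed

lemma V_commute:
  assumes q: "q \<in> U"
  shows "pd2 (pd1 N) q = pd1 (pd2 N) q" "pd2 (pd1 (pd1 N)) q = pd1 (pd1 (pd2 N)) q"
    "pd2 (pd1 (pd1 (pd1 N))) q = pd1 (pd1 (pd1 (pd2 N))) q"
proof -
  have 1: "pd2 (pd1 N) q = pd1 (pd2 N) q" if "q \<in> U" for q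
    using partials_commute[OF open_U sN0 that] by simp
  have 2: "pd2 (pd1 (pd1 N)) q = pd1 (pd1 (pd2 N)) q" if q: "q \<in> U" for q
  proof -
    have "pd2 (pd1 (pd1 N)) q = pd1 (pd2 (pd1 N)) q" using partials_commute[OF open_U sN1 q] by simp
    also have "\<dots> = pd1 (pd1 (pd2 N)) q" by (rule smooth_on2_pd_cong(1)[OF open_U sV1 _ q]) (simp add: 1)
    finally show ?thesis .
  qed
  show "pd2 (pd1 N) q = pd1 (pd2 N) q" "pd2 (pd1 (pd1 N)) q = pd1 (pd1 (pd2 N)) q" using 1 2 q by auto
  have "pd2 (pd1 (pd1 (pd1 N))) q = pd1 (pd2 (pd1 (pd1 N))) q" using partials_commute[OF open_U sN2 q] by simp
  also have "\<dots> = pd1 (pd1 (pd1 (pd2 N))) q" by (rule smooth_on2_pd_cong(1)[OF open_U sV2 _ q]) (simp add: 2)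
  finally show "pd2 (pd1 (pd1 (pd1 N))) q = pd1 (pd1 (pd1 (pd2 N))) q" .
qed

text \<open>Since the lifts stay null, their pairing with the variation field is purely imaginary;
  up to sign it is the contact Hamiltonian.\<close>

definition vw :: "real \<times> real \<Rightarrow> real" where
  "vw q = - Im (hform (N q) (pd2 N q))"

text \<open>The tangential component of the variation field, because \<open>N'\<close> has length
  1.\<close>

definition vv :: "real \<times> real \<Rightarrow> real" where
  "vv q = Re (hform (pd1 N q) (pd2 N q))"

text \<open>An auxiliary component: its derivative is determined by \<open>vw\<close>, and
  undifferentiated it cancels from the variation of \<open>fA\<close>.\<close>

definition vx :: "real \<times> real \<Rightarrow> real" where
  "vx q = Im (hform (pd1 (pd1 N) q) (pd2 N q))"

lemma smooth_vw: "smooth_on2 U vw"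
  unfolding vw_def[abs_def] by (intro smooth_intros open_U sN0)
lemma smooth_vv: "smooth_on2 U vv"
  unfolding vv_def[abs_def] by (intro smooth_intros open_U sN0)
lemma smooth_vx: "smooth_on2 U vx"
  unfolding vx_def[abs_def] by (intro smooth_intros open_U sN0)

lemma pair_deriv:
  assumes "smooth_on2 U F" "smooth_on2 U G" "q \<in> U"
  shows "Re (hform (F q) (pd1 G q)) = pd1 (\<lambda>q. Re (hform (F q) (G q))) q - Re (hform (pd1 F q) (G q))"
    "Im (hform (F q) (pd1 G q)) = pd1 (\<lambda>q. Im (hform (F q) (G q))) q - Im (hform (pd1 F q) (G q))"
  using pd1_Re[OF smooth_on2_hform[OF open_U assms(1,2)] assms(3)] pd1_Im[OF smooth_on2_hform[OF open_U assms(1,2)] assms(3)]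
    pd1_hform[OF assms] by simp_all

text \<open>Differentiating the constant products of the frame in \<open>\<tau>\<close> and
  commuting derivatives gives linear relations between the pairings of \<open>N, N', N''\<close>
  with \<open>V, V', V''\<close>, where \<open>V = pd2 N\<close>. They express whatever occurs in
  the variation of \<open>fA\<close> through \<open>vw\<close>, \<open>vv\<close> and
  \<open>vx\<close>.\<close>

lemma first_variation_fA:
  assumes q: "q \<in> U"
  shows "pd2 fA q = vv q * pd1 fA q + 3 * pd1 vv q * fA q
     + (8/3 * fB q * pd1 fB q + 1/3 * pd1 (pd1 (pd1 fB)) q) * vw q
     + (8/3 * fB q ^ 2 + 3/2 * pd1 (pd1 fB) q) * pd1 vw q
     + 5/2 * pd1 fB q * pd1 (pd1 vw) q + 5/3 * fB q * pd1 (pd1 (pd1 vw)) q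
     + 1/6 * pd1 (pd1 (pd1 (pd1 (pd1 vw)))) q"
proof -
  define w1 w2 w3 w4 w5 v1 v2 b1 b2 b3 where defs: "w1 = pd1 vw" "w2 = pd1 w1" "w3 = pd1 w2" "w4 = pd1 w3" "w5 = pd1 w4"
    "v1 = pd1 vv" "v2 = pd1 v1" "b1 = pd1 fB" "b2 = pd1 b1" "b3 = pd1 b2"
  have s: "smooth_on2 U w1" "smooth_on2 U w2" "smooth_on2 U w3" "smooth_on2 U w4" "smooth_on2 U v1"
    "smooth_on2 U b1" "smooth_on2 U b2"
    unfolding defs by (intro smooth_intros smooth_vw smooth_vv smooth_fB)+
  have d: "((\<lambda>r. vw (r, \<tau>)) has_real_derivative w1 (t, \<tau>)) (at t)"
    "((\<lambda>r. w1 (r, \<tau>)) has_real_derivative w2 (t, \<tau>)) (at t)"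
    "((\<lambda>r. w2 (r, \<tau>)) has_real_derivative w3 (t, \<tau>)) (at t)"
    "((\<lambda>r. w3 (r, \<tau>)) has_real_derivative w4 (t, \<tau>)) (at t)"
    "((\<lambda>r. w4 (r, \<tau>)) has_real_derivative w5 (t, \<tau>)) (at t)"
    "((\<lambda>r. vv (r, \<tau>)) has_real_derivative v1 (t, \<tau>)) (at t)"
    "((\<lambda>r. v1 (r, \<tau>)) has_real_derivative v2 (t, \<tau>)) (at t)"
    "((\<lambda>r. fB (r, \<tau>)) has_real_derivative b1 (t, \<tau>)) (at t)"
    "((\<lambda>r. b1 (r, \<tau>)) has_real_derivative b2 (t, \<tau>)) (at t)"
    "((\<lambda>r. b2 (r, \<tau>)) has_real_derivative b3 (t, \<tau>)) (at t)"
    "((\<lambda>r. fA (r, \<tau>)) has_real_derivative pd1 fA (t, \<tau>)) (at t)"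
    "((\<lambda>r. vx (r, \<tau>)) has_real_derivative pd1 vx (t, \<tau>)) (at t)"
    if "(t, \<tau>) \<in> U" for t \<tau>
    using smooth_on2_DERIV[OF _ that] s smooth_vw smooth_vv smooth_fB smooth_fA smooth_vx by (auto simp: defs)
  have Z: "hform (N q) (pd2 N q) = Complex 0 (- vw q)" if q: "q \<in> U" for q
  proof -
    have "hform (N q) (pd2 N q) + cnj (hform (N q) (pd2 N q)) = 0"
      using pd_eq_constD(2)[OF open_U null q] pd2_hform[OF sN0 sN0 q] by (simp add: cnj_hform)
    then show ?thesis by (simp add: complex_eq_iff vw_def)
  qed
  have ReZ: "pd1 (\<lambda>q. Re (hform (N q) (pd2 N q))) q = 0" "pd1 (\<lambda>q. Im (hform (N q) (pd2 N q))) q = - w1 q" if "q \<in> U" for q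
  proof -
    show "pd1 (\<lambda>q. Re (hform (N q) (pd2 N q))) q = 0"
      by (rule pd_eq_constD(1)[OF open_U _ that]) (simp add: Z)
    have "pd1 (\<lambda>q. - vw q) q = - w1 q"
      using pd_linear(1)[OF bounded_linear_minus[OF bounded_linear_ident] smooth_vw that] by (simp add: defs)
    then show "pd1 (\<lambda>q. Im (hform (N q) (pd2 N q))) q = - w1 q" by (simp add: vw_def[abs_def])
  qed
  have ImY: "Im (hform (pd1 N q) (pd2 N q)) = - w1 q / 2" and NV1: "hform (N q) (pd1 (pd2 N) q) = Complex (- vv q) (- w1 q / 2)"
    if q: "q \<in> U" for q
  proof -
    have 1: "hform (N q) (pd1 (pd2 N) q) + cnj (hform (pd1 N q) (pd2 N q)) = 0"
      using pd_eq_constD(2)[OF open_U leg q] pd2_hform[OF sN0 sN1 q] V_commute[OF q] by (simp add: cnj_hform)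
    have 2: "Im (hform (N q) (pd1 (pd2 N) q)) = - w1 q - Im (hform (pd1 N q) (pd2 N q))"
      using pair_deriv(2)[OF sN0 sV q] ReZ[OF q] by simp
    from 1 have 3: "Im (hform (N q) (pd1 (pd2 N) q)) = Im (hform (pd1 N q) (pd2 N q))"
      "Re (hform (N q) (pd1 (pd2 N) q)) = - Re (hform (pd1 N q) (pd2 N q))"
      by (simp_all add: complex_eq_iff)
    then show "Im (hform (pd1 N q) (pd2 N q)) = - w1 q / 2" using 2 by simp
    then show "hform (N q) (pd1 (pd2 N) q) = Complex (- vv q) (- w1 q / 2)" using 3 by (simp add: complex_eq_iff vv_def)
  qed
  have pY: "pd1 (\<lambda>q. Im (hform (pd1 N q) (pd2 N q))) q = - w2 q / 2" if q: "q \<in> U" for q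
  proof -
    obtain t \<tau> where qt: "q = (t, \<tau>)" by (cases q)
    show ?thesis unfolding qt
      by (rule pd1_eqI[OF open_U _ ImY]) (use q qt in \<open>auto intro!: derivative_eq_intros d smooth_intros open_U sN0\<close>)
  qed
  have N1V1: "hform (pd1 N q) (pd1 (pd2 N) q) = Complex 0 (- w2 q / 2 - vx q)"
    if q: "q \<in> U" for q
  proof -
    have "hform (pd1 N q) (pd1 (pd2 N) q) + cnj (hform (pd1 N q) (pd1 (pd2 N) q)) = 0"
      using pd_eq_constD(2)[OF open_U h11 q] pd2_hform[OF sN1 sN1 q] V_commute[OF q] by (simp add: cnj_hform)
    then have r: "Re (hform (pd1 N q) (pd1 (pd2 N) q)) = 0" by (simp add: complex_eq_iff)
    moreover have "Im (hform (pd1 N q) (pd1 (pd2 N) q)) = - w2 q / 2 - vx q"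
      using pair_deriv(2)[OF sN1 sV q] pY[OF q] by (simp add: vx_def)
    ultimately show "hform (pd1 N q) (pd1 (pd2 N) q) = Complex 0 (- w2 q / 2 - vx q)" by (simp add: complex_eq_iff)
  qed
  \<comment> \<open>The structure equation in the conjugate-linear slot, hence the conjugated
    coefficient.\<close>
  have N3: "hform (pd1 (pd1 (pd1 N)) q) z = Complex (- b1 q) (- fA q) * hform (N q) z - 2 * fB q * hform (pd1 N q) z"
    if "q \<in> U" for q z
    unfolding structure_equation[OF that] by (simp add: hform_simps defs complex_eq_iff)
  have N2V1: "Im (hform (pd1 (pd1 N) q) (pd1 (pd2 N) q)) = pd1 vx q - b1 q * vw q - fB q * w1 q" if q: "q \<in> U" for q
    using pair_deriv(2)[OF sN2 sV q] ImY[OF q] by (simp add: N3[OF q] Z[OF q] vx_def[abs_def])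
  have N1V2: "Im (hform (pd1 N q) (pd1 (pd1 (pd2 N)) q)) = Im (hform (pd1 (pd1 N) q) (pd1 (pd2 N) q))" if q: "q \<in> U" for q
  proof -
    have "hform (pd1 N q) (pd1 (pd1 (pd2 N)) q) + cnj (hform (pd1 (pd1 N) q) (pd1 (pd2 N) q)) = 0"
      using pd_eq_constD(2)[OF open_U h12 q] pd2_hform[OF sN1 sN2 q] V_commute[OF q] by (simp add: cnj_hform)
    then show ?thesis by (simp add: complex_eq_iff)
  qed
  \<comment> \<open>The imaginary part of \<open>hform N' V''\<close> is computed twice, from the
    derivative of \<open>N1V1\<close> and from \<open>N1V2\<close>. The comparison is a linear
    equation for \<open>3 * pd1 vx\<close>.\<close>
  have x1: "pd1 vx q = 2/3 * (b1 q * vw q + fB q * w1 q) - 1/6 * w3 q" if q: "q \<in> U" for q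
  proof -
    obtain t \<tau> where qt: "q = (t, \<tau>)" by (cases q)
    have "pd1 (\<lambda>q. Im (hform (pd1 N q) (pd1 (pd2 N) q))) q = - w3 q / 2 - pd1 vx q"
      unfolding qt
    proof (rule pd1_eqI[OF open_U])
      show "Im (hform (pd1 N q) (pd1 (pd2 N) q)) = - w2 q / 2 - vx q" if "q \<in> U" for q
        using N1V1[OF that] by simp
    qed (use q qt in \<open>auto intro!: derivative_eq_intros d smooth_intros open_U sN0\<close>)
    then have "Im (hform (pd1 N q) (pd1 (pd1 (pd2 N)) q)) = - w3 q / 2 - pd1 vx q - Im (hform (pd1 (pd1 N) q) (pd1 (pd2 N) q))"
      using pair_deriv(2)[OF sN1 sV1 q] by simp
    then have "3 * pd1 vx q = 2 * (b1 q * vw q + fB q * w1 q) - w3 q / 2" using N1V2[OF q] N2V1[OF q] by simp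
    then have "pd1 vx q = (2 * (b1 q * vw q + fB q * w1 q) - w3 q / 2) / 3" by simp
    then show ?thesis by (simp add: diff_divide_distrib)
  qed
  have NV2: "hform (N q) (pd1 (pd1 (pd2 N)) q) = Complex (- v1 q) (vx q)" if q: "q \<in> U" for q
  proof -
    obtain t \<tau> where qt: "q = (t, \<tau>)" by (cases q)
    have 1: "pd1 (\<lambda>q. Re (hform (N q) (pd1 (pd2 N) q))) q = - v1 q" unfolding qt
      by (rule pd1_eqI[OF open_U, where E = "\<lambda>q. - vv q"])
         (use q qt NV1 in \<open>auto intro!: derivative_eq_intros d smooth_intros open_U sN0\<close>)
    have 2: "pd1 (\<lambda>q. Im (hform (N q) (pd1 (pd2 N) q))) q = - w2 q / 2" unfolding qt
      by (rule pd1_eqI[OF open_U, where E = "\<lambda>q. - w1 q / 2"])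
         (use q qt NV1 in \<open>auto intro!: derivative_eq_intros d smooth_intros open_U sN0\<close>)
    show ?thesis using pair_deriv[OF sN0 sV1 q] 1 2 N1V1[OF q] by (simp add: complex_eq_iff)
  qed
  have N2V2: "Im (hform (pd1 (pd1 N) q) (pd1 (pd1 (pd2 N)) q)) =
      2/3 * (b2 q * vw q + 2 * b1 q * w1 q + fB q * w2 q) - 1/6 * w4 q
      - (b2 q * vw q + 2 * b1 q * w1 q + fB q * w2 q) - b1 q * w1 q / 2 - fA q * vv q - fB q * w2 q - 2 * fB q * vx q"
    if q: "q \<in> U" for q
  proof -
    obtain t \<tau> where qt: "q = (t, \<tau>)" by (cases q)
    have "pd1 (\<lambda>q. Im (hform (pd1 (pd1 N) q) (pd1 (pd2 N) q))) q =
       2/3 * (b2 q * vw q + 2 * b1 q * w1 q + fB q * w2 q) - 1/6 * w4 q - (b2 q * vw q + 2 * b1 q * w1 q + fB q * w2 q)"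
      unfolding qt
    proof (rule pd1_eqI[OF open_U])
      show "Im (hform (pd1 (pd1 N) q) (pd1 (pd2 N) q)) = 2/3 * (b1 q * vw q + fB q * w1 q) - 1/6 * w3 q - b1 q * vw q - fB q * w1 q"
        if "q \<in> U" for q using N2V1[OF that] x1[OF that] by simp
    qed (use q qt in \<open>auto intro!: derivative_eq_intros d smooth_intros open_U sN0 simp: field_simps\<close>)
    then show ?thesis using pair_deriv(2)[OF sN2 sV1 q] by (simp add: N3[OF q] NV1[OF q] N1V1[OF q] algebra_simps)
  qed
  have pN2V2: "pd1 (\<lambda>q. Im (hform (pd1 (pd1 N) q) (pd1 (pd1 (pd2 N)) q))) q =
      2/3 * (b3 q * vw q + 3 * b2 q * w1 q + 3 * b1 q * w2 q + fB q * w3 q) - 1/6 * w5 q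
      - (b3 q * vw q + 3 * b2 q * w1 q + 3 * b1 q * w2 q + fB q * w3 q) - (b2 q * w1 q + b1 q * w2 q) / 2
      - (pd1 fA q * vv q + fA q * v1 q) - (b1 q * w2 q + fB q * w3 q) - 2 * (b1 q * vx q + fB q * pd1 vx q)"
  proof -
    obtain t \<tau> where qt: "q = (t, \<tau>)" by (cases q)
    show ?thesis unfolding qt
      by (rule pd1_eqI[OF open_U _ N2V2])
         (use q qt in \<open>auto intro!: derivative_eq_intros d smooth_intros open_U sN0 simp: field_simps\<close>)
  qed
  have "pd2 fA q = Im (hform (pd1 (pd1 (pd1 N)) q) (pd1 (pd1 (pd2 N)) q)) - Im (hform (pd1 (pd1 N) q) (pd1 (pd1 (pd1 (pd2 N))) q))"
  proof -
    have "pd2 fA q = Im (hform (pd1 (pd1 (pd1 N)) q) (pd1 (pd1 (pd2 N)) q) + cnj (hform (pd1 (pd1 N) q) (pd1 (pd1 (pd1 (pd2 N))) q)))"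
      unfolding fA_def[abs_def] pd2_Im[OF smooth_on2_hform[OF open_U sN3 sN2] q] pd2_hform[OF sN3 sN2 q] V_commute[OF q]
      by (simp add: cnj_hform)
    then show ?thesis by simp
  qed
  \<comment> \<open>Leibniz' rule removes the third derivative of \<open>V\<close>, at the price of
    doubling the first term.\<close>
  also have "\<dots> = 2 * Im (hform (pd1 (pd1 (pd1 N)) q) (pd1 (pd1 (pd2 N)) q)) - pd1 (\<lambda>q. Im (hform (pd1 (pd1 N) q) (pd1 (pd1 (pd2 N)) q))) q"
    using pair_deriv(2)[OF sN2 sV2 q] by simp
  also have "Im (hform (pd1 (pd1 (pd1 N)) q) (pd1 (pd1 (pd2 N)) q)) = - b1 q * vx q + fA q * v1 q - 2 * fB q * (pd1 vx q - b1 q * vw q - fB q * w1 q)"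
    unfolding N3[OF q] NV2[OF q] using N1V2[OF q] N2V1[OF q] by simp
  finally have "pd2 fA q = vv q * pd1 fA q + 3 * v1 q * fA q
     + (8/3 * fB q * b1 q + 1/3 * b3 q) * vw q
     + (8/3 * fB q ^ 2 + 3/2 * b2 q) * w1 q
     + 5/2 * b1 q * w2 q + 5/3 * fB q * w3 q
     + 1/6 * w5 q"
    unfolding pN2V2 x1[OF q] by (simp add: field_simps power2_eq_square)
  then show ?thesis unfolding defs .
qed

end

section \<open>The stress equation\<close>

text \<open>The stress as a polynomial in two formal jets, to which a sign change of
  \<open>a\<close> and a reversal of the parameter can be applied.\<close>

definition stress_poly :: "(nat \<Rightarrow> real) \<Rightarrow> (nat \<Rightarrow> real) \<Rightarrow> real" where
  "stress_poly a b =
       4400/81 * a 0 * a 1 ^ 3 * a 2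
     + a 0 ^ 2 * (- 400/27 * b 0 * a 1 ^ 3 - 200/9 * a 1 * a 2 ^ 2 - 400/27 * a 1 ^ 2 * a 3)
     + a 0 ^ 3 * (25/3 * a 1 ^ 2 * b 1 + 50/3 * b 0 * a 1 * a 2 + 50/9 * a 2 * a 3 + 25/9 * a 1 * a 4)
     + a 0 ^ 4 * (- 16/3 * b 0 ^ 2 * a 1 - 5 * b 1 * a 2 - 3 * a 1 * b 2 - 10/3 * b 0 * a 3 - 1/3 * a 5)
     + a 0 ^ 5 * (8 * b 0 * b 1 + b 3)
     - 6160/243 * a 1 ^ 5"

text \<open>The leading coefficient is positive, so an upper bound on the cubic bounds its argument
  from above, though not from below.\<close>

lemma curvature_bounded_above:
  fixes \<kappa> C E :: real
  assumes "4/3 * \<kappa>^3 - C * \<kappa> \<le> E"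
  shows "\<kappa> \<le> 1 + \<bar>C\<bar> + \<bar>E\<bar>"
proof (rule ccontr)
  assume "\<not> ?thesis"
  then have k: "\<kappa> > 1 + \<bar>C\<bar> + \<bar>E\<bar>" by simp
  then have "\<kappa> * \<kappa> \<ge> 1 * \<kappa>" by (intro mult_right_mono) auto
  then have "4/3 * \<kappa>^2 - C \<ge> 1" using k by (simp add: power2_eq_square)
  then have "\<kappa> * (4/3 * \<kappa>^2 - C) \<ge> \<kappa> * 1" using k by (intro mult_left_mono) auto
  moreover have "\<kappa> * (4/3 * \<kappa>^2 - C) = 4/3 * \<kappa>^3 - C * \<kappa>" by (simp add: power2_eq_square power3_eq_cube algebra_simps)
  ultimately show False using assms k by linarith
qed

lemma DERIV_zero_const_on_interval:
  fixes f :: "real \<Rightarrow> real"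
  assumes "\<And>x. x \<in> {\<alpha><..<\<beta>} \<Longrightarrow> (f has_real_derivative 0) (at x)"
  obtains c where "\<And>x. x \<in> {\<alpha><..<\<beta>} \<Longrightarrow> f x = c"
proof -
  have "(f has_derivative (\<lambda>h. 0)) (at x within {\<alpha><..<\<beta>})" if "x \<in> {\<alpha><..<\<beta>}" for x
    using assms[OF that] by (auto simp: has_field_derivative_def lambda_zero intro: has_derivative_at_withinI)
  then show ?thesis using has_derivative_zero_constant[of "{\<alpha><..<\<beta>}" f] that by auto
qed

text \<open>Two facts about \<open>Y = \<sigma> * y\<close> collide, where \<open>\<sigma>\<close>
  is the sixth root of \<open>a\<close> and \<open>y\<close> vanishes at \<open>t1\<close>. It tends
  to 0 at \<open>\<beta>\<close>, yet Sturm comparison with a cosine of the arc parameter makes the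
  quotient of \<open>Y\<close> by that cosine nondecreasing, on a stretch short enough for the
  cosine to stay positive.\<close>

lemma no_zero_at_right_end:
  fixes a b :: "nat \<Rightarrow> real \<Rightarrow> real"
  assumes da: "\<And>k t. t \<in> {\<alpha>..\<beta>} \<Longrightarrow> (a k has_real_derivative a (Suc k) t) (at t)"
    and db: "\<And>k t. t \<in> {\<alpha>..\<beta>} \<Longrightarrow> (b k has_real_derivative b (Suc k) t) (at t)"
    and st: "\<And>t. t \<in> {\<alpha>..\<beta>} \<Longrightarrow> stress_poly (\<lambda>k. a k t) (\<lambda>k. b k t) = 0"
    and ab: "\<alpha> < \<beta>" and pos: "\<And>t. t \<in> {\<alpha>..<\<beta>} \<Longrightarrow> a 0 t > 0" and z: "a 0 \<beta> = 0"
  shows False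
proof -
  let ?J = "{\<alpha><..<\<beta>}"
  \<comment> \<open>\<open>s\<close> is the arc element; its square root \<open>\<sigma>\<close> is
    the factor acquired by solutions of \<open>y'' + b y / 2 = 0\<close> on passing to the arc
    parameter.\<close>
  define \<sigma> where "\<sigma> t = root 6 (a 0 t)" for t
  define s where "s t = (\<sigma> t)^2" for t
  have a0: "a 0 t > 0" if "t \<in> ?J" for t using pos that by auto
  have \<sigma>0: "\<sigma> t > 0" if "t \<in> ?J" for t using a0[OF that] by (simp add: \<sigma>_def)
  have s0: "s t > 0" if "t \<in> ?J" for t using \<sigma>0[OF that] by (simp add: s_def)
  have \<sigma>6: "\<sigma> t ^ 6 = a 0 t" if "t \<in> ?J" for t using a0[OF that] by (simp add: \<sigma>_def real_root_pow_pos)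
  have s3: "s t ^ 3 = a 0 t" if "t \<in> ?J" for t using \<sigma>6[OF that] by (simp add: s_def power_mult[symmetric])
  have da': "(a k has_real_derivative a (Suc k) t) (at t)" if "t \<in> ?J" for k t using da that by auto
  have db': "(b k has_real_derivative b (Suc k) t) (at t)" if "t \<in> ?J" for k t using db that by auto
  have d\<sigma>: "(\<sigma> has_real_derivative \<sigma> t * a 1 t / (6 * a 0 t)) (at t)" if t: "t \<in> ?J" for t
  proof -
    have "((\<lambda>t. root 6 (a 0 t)) has_real_derivative inverse (real 6 * root 6 (a 0 t) ^ (6 - Suc 0)) * a (Suc 0) t) (at t)"
      by (rule DERIV_chain2[OF DERIV_real_root da'[OF t]]) (use a0[OF t] in auto)
    then have "(\<sigma> has_real_derivative inverse (6 * \<sigma> t ^ 5) * a 1 t) (at t)" by (simp add: \<sigma>_def[abs_def])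
    moreover have "inverse (6 * \<sigma> t ^ 5) * a 1 t = \<sigma> t * a 1 t / (6 * \<sigma> t ^ 6)"
      using \<sigma>0[OF t] by (simp add: field_simps eval_nat_numeral)
    ultimately show ?thesis unfolding \<sigma>6[OF t] by metis
  qed
  have ds: "(s has_real_derivative s t * a 1 t / (3 * a 0 t)) (at t)" if t: "t \<in> ?J" for t
    unfolding s_def[abs_def] using a0[OF t]
    by (auto intro!: derivative_eq_intros d\<sigma>[OF t] simp: field_simps power2_eq_square)
  \<comment> \<open>\<open>P / a\<^sup>2\<close> is \<open>b\<close> minus the Schwarzian derivative
    of the arc parameter. \<open>Q\<close> and \<open>R\<close> are the numerators of the first two
    derivatives of the curvature along the arc. With denominators cleared, the stress equation is a
    polynomial identity in the jets.\<close>
  define P where "P t = b 0 t * a 0 t^2 - a 0 t * a 2 t / 3 + 7/18 * a 1 t^2" for t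
  define P1 where "P1 t = b 1 t * a 0 t^2 + 2 * b 0 t * a 0 t * a 1 t - a 0 t * a 3 t / 3 + 4/9 * a 1 t * a 2 t" for t
  define P2 where "P2 t = b 2 t * a 0 t^2 + 4 * b 1 t * a 0 t * a 1 t + 2 * b 0 t * a 1 t^2 + 2 * b 0 t * a 0 t * a 2 t
     - a 0 t * a 4 t / 3 + 1/9 * a 1 t * a 3 t + 4/9 * a 2 t^2" for t
  define P3 where "P3 t = b 3 t * a 0 t^2 + 6 * b 2 t * a 0 t * a 1 t + 6 * b 1 t * a 1 t^2 + 6 * b 1 t * a 0 t * a 2 t
     + 6 * b 0 t * a 1 t * a 2 t + 2 * b 0 t * a 0 t * a 3 t
            - a 0 t * a 5 t / 3 - 2/9 * a 1 t * a 4 t + a 2 t * a 3 t" for t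
  define Q where "Q t = a 0 t * P1 t - 8/3 * a 1 t * P t" for t
  define Q1 where "Q1 t = a 0 t * P2 t - 5/3 * a 1 t * P1 t - 8/3 * a 2 t * P t" for t
  define Q2 where "Q2 t = a 0 t * P3 t - 2/3 * a 1 t * P2 t - 13/3 * a 2 t * P1 t - 8/3 * a 3 t * P t" for t
  define R where "R t = a 0 t * Q1 t - 4 * a 1 t * Q t" for t
  define R1 where "R1 t = a 0 t * Q2 t - 3 * a 1 t * Q1 t - 4 * a 2 t * Q t" for t
  have da_num: "(a 0 has_real_derivative a 1 t) (at t)" "(a 1 has_real_derivative a 2 t) (at t)"
    "(a 2 has_real_derivative a 3 t) (at t)" "(a 3 has_real_derivative a 4 t) (at t)" "(a 4 has_real_derivative a 5 t) (at t)"
    "(b 0 has_real_derivative b 1 t) (at t)" "(b 1 has_real_derivative b 2 t) (at t)" "(b 2 has_real_derivative b 3 t) (at t)"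
    if "t \<in> ?J" for t
    using da'[OF that, of 0] da'[OF that, of 1] da'[OF that, of 2] da'[OF that, of 3] da'[OF that, of 4]
      db'[OF that, of 0] db'[OF that, of 1] db'[OF that, of 2]
    by (simp_all add: eval_nat_numeral)
  have dP: "(P has_real_derivative P1 t) (at t)" "(P1 has_real_derivative P2 t) (at t)" "(P2 has_real_derivative P3 t) (at t)"
    if t: "t \<in> ?J" for t
    unfolding P_def[abs_def] P1_def[abs_def] P2_def[abs_def] P3_def
    by (auto intro!: derivative_eq_intros da_num[OF t] simp: field_simps power2_eq_square simp del: One_nat_def)
  have dQ: "(Q has_real_derivative Q1 t) (at t)" "(Q1 has_real_derivative Q2 t) (at t)" if t: "t \<in> ?J" for t
    unfolding Q_def[abs_def] Q1_def[abs_def] Q2_def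
    by (auto intro!: derivative_eq_intros da_num[OF t] dP[OF t] simp: field_simps simp del: One_nat_def)
  have dR: "(R has_real_derivative R1 t) (at t)" if t: "t \<in> ?J" for t
    unfolding R_def[abs_def] R1_def
    by (auto intro!: derivative_eq_intros da_num[OF t] dQ[OF t] simp: field_simps simp del: One_nat_def)
  \<comment> \<open>Divided by \<open>a ^ 6 * s\<close>, the left side is the
    \<open>t\<close>-derivative of \<open>\<kappa>_uu + 4 * \<kappa>\<^sup>2\<close>, with
    \<open>u\<close> the arc parameter; this quantity is \<open>e1\<close> below.\<close>
  have key: "a 0 t * (R1 t + 8 * P t * P1 t) - 16/3 * a 1 t * (R t + 4 * P t^2) = 0" if "t \<in> ?J" for t
  proof -
    have "a 0 t * (R1 t + 8 * P t * P1 t) - 16/3 * a 1 t * (R t + 4 * P t^2) = stress_poly (\<lambda>k. a k t) (\<lambda>k. b k t)"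
      unfolding stress_poly_def R1_def R_def Q2_def Q1_def Q_def P3_def P2_def P1_def P_def
      by (simp add: field_simps eval_nat_numeral)
    then show ?thesis using st[of t] that by simp
  qed
  \<comment> \<open>The curvature with respect to the arc element \<open>s dt\<close>, its derivative and second derivative.\<close>
  define \<kappa> where "\<kappa> t = P t / (a 0 t ^ 2 * s t ^ 2)" for t
  define K1 where "K1 t = Q t / a 0 t ^ 4" for t
  define e1 where "e1 t = (R t + 4 * P t ^ 2) / (a 0 t ^ 5 * s t)" for t
  have d\<kappa>: "(\<kappa> has_real_derivative s t * K1 t) (at t)" if t: "t \<in> ?J" for t
  proof -
    have "(\<kappa> has_real_derivative (a 0 t * P1 t - 8/3 * a 1 t * P t) / (a 0 t ^ 3 * s t ^ 2)) (at t)"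
      unfolding \<kappa>_def[abs_def] using a0[OF t] s0[OF t]
      by (auto intro!: derivative_eq_intros da_num[OF t] dP[OF t] ds[OF t] simp: field_simps power2_eq_square power3_eq_cube)
    moreover have "s t * K1 t = Q t / (a 0 t ^ 3 * s t ^ 2)"
      unfolding K1_def power_Suc2[of "a 0 t" 3, simplified] using a0[OF t] s0[OF t] s3[OF t]
      by (simp add: field_simps power2_eq_square power3_eq_cube eval_nat_numeral)
    ultimately show ?thesis by (simp add: Q_def)
  qed
  have de1: "(e1 has_real_derivative 0) (at t)" if t: "t \<in> ?J" for t
  proof -
    have "(e1 has_real_derivative (a 0 t * (R1 t + 8 * P t * P1 t) - 16/3 * a 1 t * (R t + 4 * P t^2)) / (a 0 t ^ 6 * s t)) (at t)"
      unfolding e1_def[abs_def] using a0[OF t] s0[OF t]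
      by (auto intro!: derivative_eq_intros da_num[OF t] dP[OF t] dR[OF t] ds[OF t] simp: field_simps power2_eq_square eval_nat_numeral)
    then show ?thesis unfolding key[OF t] by simp
  qed
  obtain C where C: "\<And>t. t \<in> ?J \<Longrightarrow> e1 t = C" using DERIV_zero_const_on_interval[of \<alpha> \<beta> e1] de1 by blast
  have dK1: "(K1 has_real_derivative s t * (C - 4 * \<kappa> t ^ 2)) (at t)" if t: "t \<in> ?J" for t
  proof -
    have "(K1 has_real_derivative R t / a 0 t ^ 5) (at t)"
      unfolding K1_def[abs_def] using a0[OF t]
      by (auto intro!: derivative_eq_intros da_num[OF t] dQ[OF t] simp: R_def field_simps eval_nat_numeral)
    moreover have "s t * (C - 4 * \<kappa> t ^ 2) = R t / a 0 t ^ 5"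
    proof -
      have "s t * 4 * \<kappa> t ^ 2 = 4 * P t ^ 2 / (a 0 t ^ 4 * s t ^ 3)"
        using a0[OF t] s0[OF t] by (simp add: \<kappa>_def field_simps eval_nat_numeral)
      also have "\<dots> = 4 * P t ^ 2 / a 0 t ^ 5" unfolding s3[OF t] by (simp add: eval_nat_numeral)
      finally have "s t * 4 * \<kappa> t ^ 2 = 4 * P t ^ 2 / a 0 t ^ 5" .
      moreover have "s t * C = (R t + 4 * P t ^ 2) / a 0 t ^ 5"
        using C[OF t] s0[OF t] a0[OF t] by (simp add: e1_def[symmetric] e1_def field_simps)
      ultimately show ?thesis by (simp add: algebra_simps add_divide_distrib)
    qed
    ultimately show ?thesis by simp
  qed
  \<comment> \<open>The energy of the motion \<open>\<kappa>_uu = C - 4 * \<kappa>\<^sup>2\<close>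
    along the arc.\<close>
  define e2 where "e2 t = K1 t ^ 2 / 2 + 4/3 * \<kappa> t ^ 3 - C * \<kappa> t" for t
  have "(e2 has_real_derivative 0) (at t)" if t: "t \<in> ?J" for t
    unfolding e2_def[abs_def]
    by (auto intro!: derivative_eq_intros dK1[OF t] d\<kappa>[OF t] simp: field_simps power2_eq_square)
  then obtain E where E: "\<And>t. t \<in> ?J \<Longrightarrow> e2 t = E" using DERIV_zero_const_on_interval[of \<alpha> \<beta> e2] by blast
  define M where "M = 1 + \<bar>C\<bar> + \<bar>E\<bar>"
  have \<kappa>M: "\<kappa> t \<le> M" if "t \<in> ?J" for t
    unfolding M_def by (rule curvature_bounded_above) (use E[OF that] zero_le_power2[of "K1 t"] in \<open>unfold e2_def, linarith\<close>)
  have M0: "M > 0" by (simp add: M_def)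
  define \<omega> where "\<omega> = sqrt M"
  have \<omega>: "\<omega> > 0" "\<omega>^2 = M" using M0 by (auto simp: \<omega>_def)
  have cb: "continuous_on {\<alpha>..\<beta>} (b 0)" and ca: "continuous_on {\<alpha>..\<beta>} (a 0)"
    using da db DERIV_isCont continuous_at_imp_continuous_on by metis+
  \<comment> \<open>\<open>b\<close> is bounded on the closed interval; with this \<open>m\<close>,
    solutions \<open>y \<ge> 0\<close> of \<open>y'' = m\<^sup>2 * y\<close> satisfy
    \<open>y'' + b y / 2 \<ge> 0\<close>.\<close>
  obtain m where m: "m > 0" "\<And>t. t \<in> {\<alpha>..\<beta>} \<Longrightarrow> m^2 + b 0 t / 2 \<ge> 0"
  proof -
    have "bounded (b 0 ` {\<alpha>..\<beta>})" by (intro compact_imp_bounded compact_continuous_image cb) auto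
    then obtain L where L: "\<And>t. t \<in> {\<alpha>..\<beta>} \<Longrightarrow> \<bar>b 0 t\<bar> \<le> L" "L > 0" unfolding bounded_pos by (metis imageI real_norm_def)
    have "(1 + L)^2 + b 0 t / 2 \<ge> 0" if "t \<in> {\<alpha>..\<beta>}" for t
      using L(1)[OF that] L(2) by (simp add: power2_eq_square algebra_simps)
    then show ?thesis using L(2) that[of "1 + L"] by simp
  qed
  have cs: "continuous_on {\<alpha>..\<beta>} s" unfolding s_def[abs_def] \<sigma>_def by (intro continuous_intros ca)
  define u where "u t = integral {\<alpha>..t} s" for t
  have du: "(u has_real_derivative s t) (at t)" if t: "t \<in> ?J" for t
  proof -
    have "(u has_vector_derivative s t) (at t within {\<alpha>..\<beta>})"
      unfolding u_def[abs_def] by (rule integral_has_vector_derivative[OF cs]) (use t in auto)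
    then show ?thesis using t at_within_interior[of t "{\<alpha>..\<beta>}"]
      by (simp add: has_real_derivative_iff_has_vector_derivative)
  qed
  have cu: "continuous_on {\<alpha>..\<beta>} u"
    unfolding u_def[abs_def] by (intro indefinite_integral_continuous_1 integrable_continuous_interval cs)
  \<comment> \<open>The arc element is continuous up to \<open>\<beta>\<close>, so the zero lies at
    finite arc length. After \<open>t1\<close> less than \<open>1 / \<omega>\<close> of it remains,
    and 1 is below half of \<open>pi\<close>, which keeps the cosine away from 0.\<close>
  obtain t1 where t1: "t1 \<in> ?J" "\<And>t. t \<in> {t1..\<beta>} \<Longrightarrow> \<omega> * \<bar>u t - u t1\<bar> < 1"
  proof -
    have "((\<lambda>t. u t) \<longlongrightarrow> u \<beta>) (at \<beta> within {\<alpha>..\<beta>})" using cu ab by (auto simp: continuous_on_def)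
    then obtain d where d: "d > 0" "\<And>t. t \<in> {\<alpha>..\<beta>} \<Longrightarrow> \<bar>t - \<beta>\<bar> < d \<Longrightarrow> \<bar>u t - u \<beta>\<bar> < 1 / (2 * \<omega>)"
      using \<omega>(1) unfolding tendsto_iff eventually_at dist_real_def
      by (metis abs_zero diff_self divide_pos_pos mult_pos_pos zero_less_numeral zero_less_one abs_of_pos)
    define t1 where "t1 = max ((\<alpha> + \<beta>) / 2) (\<beta> - d / 2)"
    have t1J: "t1 \<in> ?J" using ab d(1) by (auto simp: t1_def max_def)
    have *: "\<bar>u t - u \<beta>\<bar> < 1 / (2 * \<omega>)" if "t \<in> {t1..\<beta>}" for t
      by (rule d(2)) (use that t1J d(1) in \<open>auto simp: t1_def\<close>)
    have "\<omega> * \<bar>u t - u t1\<bar> < 1" if t: "t \<in> {t1..\<beta>}" for t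
    proof -
      have "\<bar>u t - u t1\<bar> < 1 / (2 * \<omega>) + 1 / (2 * \<omega>)" using *[OF t] *[of t1] t1J by auto
      then show ?thesis using \<omega>(1) by (simp add: field_simps)
    qed
    with t1J that show ?thesis by blast
  qed
  let ?T = "{t1..<\<beta>}"
  have TJ: "t \<in> ?J" if "t \<in> ?T" for t using that t1(1) by auto
  define \<theta> where "\<theta> t = \<omega> * (u t - u t1)" for t
  have \<theta>1: "\<bar>\<theta> t\<bar> < 1" if "t \<in> ?T" for t using t1(2)[of t] that \<omega>(1) by (auto simp: \<theta>_def abs_mult)
  have cos1: "cos (\<theta> t) \<ge> cos 1" "cos (1::real) > 0" if "t \<in> ?T" for t
  proof -
    have "cos \<bar>\<theta> t\<bar> \<ge> cos 1" using \<theta>1[OF that] by (intro cos_monotone_0_pi_le) (use pi_gt3 in auto)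
    then show "cos (\<theta> t) \<ge> cos 1" by simp
    show "cos (1::real) > 0" by (rule cos_gt_zero) (use pi_gt3 in auto)
  qed
  have d\<theta>: "(\<theta> has_real_derivative \<omega> * s t) (at t)" if "t \<in> ?T" for t
    unfolding \<theta>_def[abs_def] using TJ[OF that] by (auto intro!: derivative_eq_intros du)
  \<comment> \<open>\<open>sinh\<close> replaces an exact solution of the linear equation \<open>y'' + b y / 2 = 0\<close>:
    only the sign of \<open>y'' + b y / 2\<close> matters for the Sturm comparison.\<close>
  define y where "y t = sinh (m * (t - t1))" for t
  define y' where "y' t = m * cosh (m * (t - t1))" for t
  have dy: "(y has_real_derivative y' t) (at t)" "(y' has_real_derivative m^2 * y t) (at t)" for t
    unfolding y_def[abs_def] y'_def[abs_def]
    by (auto intro!: derivative_eq_intros simp: power2_eq_square)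
  \<comment> \<open>\<open>Yu\<close> is the derivative of \<open>Y = \<sigma> * y\<close> along the
    arc, and \<open>W\<close> is the Wronskian of \<open>Y\<close> with
    \<open>cos \<theta>\<close>.\<close>
  define Yu where "Yu t = (a 1 t / (6 * a 0 t) * y t + y' t) / \<sigma> t" for t
  define W where "W t = cos (\<theta> t) * Yu t + \<omega> * (\<sigma> t * y t) * sin (\<theta> t)" for t
  have dYu: "(Yu has_real_derivative (m^2 + b 0 t / 2 - \<kappa> t * s t ^ 2 / 2) * y t / \<sigma> t) (at t)" if "t \<in> ?T" for t
  proof -
    have t: "t \<in> ?J" using TJ that by blast
    have "(Yu has_real_derivative (m^2 * y t + y t * (a 2 t / (6 * a 0 t) - 7 * a 1 t ^ 2 / (36 * a 0 t ^ 2))) / \<sigma> t) (at t)"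
      unfolding Yu_def[abs_def] using a0[OF t] \<sigma>0[OF t]
      by (auto intro!: derivative_eq_intros da_num[OF t] dy d\<sigma>[OF t] simp: field_simps power2_eq_square simp del: One_nat_def)
    moreover have h: "\<kappa> t * s t ^ 2 = b 0 t - a 2 t / (3 * a 0 t) + 7/18 * a 1 t ^ 2 / a 0 t ^ 2"
      using a0[OF t] s0[OF t] by (simp add: \<kappa>_def P_def field_simps power2_eq_square)
    have "m^2 * y t + y t * (a 2 t / (6 * a 0 t) - 7 * a 1 t ^ 2 / (36 * a 0 t ^ 2)) = (m^2 + b 0 t / 2 - \<kappa> t * s t ^ 2 / 2) * y t"
      unfolding h by (simp add: field_simps)
    ultimately show ?thesis by simp
  qed
  have y0: "y t \<ge> 0" if "t \<in> ?T" for t using that m by (simp add: y_def)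
  have dW: "(W has_real_derivative cos (\<theta> t) * ((m^2 + b 0 t / 2 + s t ^ 2 * (\<omega>^2 - \<kappa> t / 2)) * y t / \<sigma> t)) (at t)" if "t \<in> ?T" for t
  proof -
    have t: "t \<in> ?J" using TJ that by blast
    have "(W has_real_derivative cos (\<theta> t) * ((m^2 + b 0 t / 2 - \<kappa> t * s t ^ 2 / 2) * y t / \<sigma> t)
       - sin (\<theta> t) * (\<omega> * s t) * Yu t + \<omega> * (\<sigma> t * a 1 t / (6 * a 0 t) * y t + \<sigma> t * y' t) * sin (\<theta> t)
       + \<omega> * (\<sigma> t * y t) * (cos (\<theta> t) * (\<omega> * s t))) (at t)"
      unfolding W_def[abs_def]
      by (rule derivative_eq_intros refl dYu[OF that] d\<theta>[OF that] d\<sigma>[OF t] dy)+ (simp add: algebra_simps)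
    moreover have h1: "\<sigma> t * a 1 t / (6 * a 0 t) * y t + \<sigma> t * y' t = s t * Yu t"
      using \<sigma>0[OF t] a0[OF t] by (simp add: s_def Yu_def field_simps power2_eq_square)
    have h2: "\<sigma> t * y t * s t = s t ^ 2 * y t / \<sigma> t"
      using \<sigma>0[OF t] by (simp add: s_def field_simps power2_eq_square)
    have "cos (\<theta> t) * ((m^2 + b 0 t / 2 - \<kappa> t * s t ^ 2 / 2) * y t / \<sigma> t)
       - sin (\<theta> t) * (\<omega> * s t) * Yu t + \<omega> * (\<sigma> t * a 1 t / (6 * a 0 t) * y t + \<sigma> t * y' t) * sin (\<theta> t)
       + \<omega> * (\<sigma> t * y t) * (cos (\<theta> t) * (\<omega> * s t))
       = cos (\<theta> t) * ((m^2 + b 0 t / 2 - \<kappa> t * s t ^ 2 / 2) * y t / \<sigma> t) + cos (\<theta> t) * \<omega>^2 * (\<sigma> t * y t * s t)"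
      unfolding h1 by (simp add: algebra_simps power2_eq_square)
    also have "\<dots> = cos (\<theta> t) * ((m^2 + b 0 t / 2 + s t ^ 2 * (\<omega>^2 - \<kappa> t / 2)) * y t / \<sigma> t)"
      unfolding h2 using \<sigma>0[OF t] by (simp add: field_simps)
    ultimately show ?thesis by metis
  qed
  have W_mono: "W t1 \<le> W t" if "t \<in> ?T" for t
  proof (rule DERIV_nonneg_imp_nondecreasing[of t1 t W])
    show "t1 \<le> t" using that by auto
    fix x assume "t1 \<le> x" "x \<le> t"
    then have x: "x \<in> ?T" using that by auto
    then have xJ: "x \<in> ?J" using TJ by blast
    \<comment> \<open>Here the upper bound \<open>\<kappa> \<le> M = \<omega>\<^sup>2\<close>
      enters.\<close>
    have "m^2 + b 0 x / 2 + s x ^ 2 * (\<omega>^2 - \<kappa> x / 2) \<ge> 0"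
    proof -
      have "s x ^ 2 * (\<omega>^2 - \<kappa> x / 2) \<ge> 0"
        using \<kappa>M[OF xJ] M0 by (intro mult_nonneg_nonneg) (auto simp: \<omega>)
      then show ?thesis using m(2)[of x] xJ by auto
    qed
    then have "0 \<le> cos (\<theta> x) * ((m^2 + b 0 x / 2 + s x ^ 2 * (\<omega>^2 - \<kappa> x / 2)) * y x / \<sigma> x)"
      using y0[OF x] \<sigma>0[OF xJ] cos1[OF x] by (intro mult_nonneg_nonneg divide_nonneg_nonneg) auto
    with dW[OF x] show "\<exists>y. (W has_real_derivative y) (at x) \<and> 0 \<le> y" by blast
  qed
  have "W t1 > 0" using \<sigma>0[OF t1(1)] m(1) by (simp add: W_def \<theta>_def Yu_def y_def y'_def)
  then have Wpos: "W t > 0" if "t \<in> ?T" for t using W_mono[OF that] by simp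
  \<comment> \<open>The quotient of \<open>Y\<close> by the cosine. Its derivative along the arc is
    the Wronskian over \<open>cos (\<theta> t) ^ 2\<close>, and its value at \<open>t1\<close> is
    0.\<close>
  define v where "v t = \<sigma> t * y t / cos (\<theta> t)" for t
  have dv: "(v has_real_derivative s t * W t / cos (\<theta> t) ^ 2) (at t)" if "t \<in> ?T" for t
  proof -
    have t: "t \<in> ?J" using TJ that by blast
    have c0: "cos (\<theta> t) > 0" using cos1[OF that] by simp
    have "(v has_real_derivative ((\<sigma> t * a 1 t / (6 * a 0 t) * y t + \<sigma> t * y' t) * cos (\<theta> t)
        + \<sigma> t * y t * (sin (\<theta> t) * (\<omega> * s t))) / cos (\<theta> t) ^ 2) (at t)"
      unfolding v_def[abs_def] using c0
      by (auto intro!: derivative_eq_intros d\<theta>[OF that] d\<sigma>[OF t] dy simp: power2_eq_square field_simps)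
    moreover have h1: "\<sigma> t * a 1 t / (6 * a 0 t) * y t + \<sigma> t * y' t = s t * Yu t"
      using \<sigma>0[OF t] a0[OF t] by (simp add: s_def Yu_def field_simps power2_eq_square)
    ultimately show ?thesis unfolding h1 by (simp add: W_def algebra_simps)
  qed
  define t2 where "t2 = (t1 + \<beta>) / 2"
  have t2: "t2 \<in> ?T" "t1 < t2" using t1(1) by (auto simp: t2_def)
  have v_mono: "v t2 \<le> v t" if "t \<in> {t2..<\<beta>}" for t
  proof (rule DERIV_nonneg_imp_nondecreasing[of t2 t v])
    show "t2 \<le> t" using that by auto
    fix x assume "t2 \<le> x" "x \<le> t"
    then have x: "x \<in> ?T" using that t2 by auto
    then have "0 \<le> s x * W x / cos (\<theta> x) ^ 2" using Wpos[OF x] s0[OF TJ[OF x]] by simp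
    with dv[OF x] show "\<exists>y. (v has_real_derivative y) (at x) \<and> 0 \<le> y" by blast
  qed
  have v2: "v t2 > 0"
    using \<sigma>0[OF TJ[OF t2(1)]] cos1[OF t2(1)] m(1) t2(2) by (simp add: v_def y_def)
  \<comment> \<open>The right side tends to 0 at \<open>\<beta>\<close>, where
    \<open>\<sigma>\<close> vanishes.\<close>
  have "v t2 \<le> \<sigma> t * y \<beta> / cos 1" if t: "t \<in> {t2..<\<beta>}" for t
  proof -
    have tT: "t \<in> ?T" using t t2 by auto
    have "y t \<le> y \<beta>" using m(1) t unfolding y_def by simp
    then have "\<sigma> t * y t / cos (\<theta> t) \<le> \<sigma> t * y \<beta> / cos 1"
      using \<sigma>0[OF TJ[OF tT]] cos1[OF tT] y0[OF tT] by (intro frac_le mult_left_mono) auto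
    then show ?thesis using v_mono[OF t] by (simp add: v_def)
  qed
  moreover have "((\<lambda>t. \<sigma> t * y \<beta> / cos 1) \<longlongrightarrow> \<sigma> \<beta> * y \<beta> / cos 1) (at \<beta> within {\<alpha>..\<beta>})"
  proof -
    have "continuous_on {\<alpha>..\<beta>} \<sigma>" unfolding \<sigma>_def[abs_def] by (intro continuous_intros ca)
    then have "(\<sigma> \<longlongrightarrow> \<sigma> \<beta>) (at \<beta> within {\<alpha>..\<beta>})" using ab by (auto simp: continuous_on_def)
    moreover have "cos (1::real) \<noteq> 0" using cos1(2)[OF t2(1)] by (metis less_irrefl)
    ultimately show ?thesis by (intro tendsto_intros)
  qed
  then have "((\<lambda>t. \<sigma> t * y \<beta> / cos 1) \<longlongrightarrow> 0) (at_left \<beta>)"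
    using z ab by (simp add: \<sigma>_def at_within_Icc_at_left)
  moreover have "\<forall>\<^sub>F t in at_left \<beta>. t \<in> {t2..<\<beta>}"
    using eventually_at_left_real[of t2 \<beta>] t2(1) by (auto elim: eventually_mono)
  ultimately have "v t2 \<le> 0"
    by (intro tendsto_lowerbound[of _ 0 "at_left \<beta>" "v t2"]) (auto elim: eventually_mono)
  with v2 show False by simp
qed

text \<open>Every monomial has degree 5 in \<open>a\<close>.\<close>

lemma stress_poly_uminus: "stress_poly (\<lambda>k. - a k) b = - stress_poly a b"
  by (simp add: stress_poly_def algebra_simps)

text \<open>Every monomial carries an odd number of derivatives in total.\<close>

lemma stress_poly_reflect: "stress_poly (\<lambda>k. (-1) ^ k * a k) (\<lambda>k. (-1) ^ k * b k) = - stress_poly a b"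
  by (simp add: stress_poly_def algebra_simps eval_nat_numeral)

text \<open>Otherwise there is a first zero, and before it \<open>a\<close> has constant sign; a
  negative sign is reduced to the positive one by \<open>stress_poly_uminus\<close>.\<close>

lemma nonzero_propagates_right:
  fixes a b :: "nat \<Rightarrow> real \<Rightarrow> real"
  assumes da: "\<And>k t. t \<in> {\<alpha>..\<beta>} \<Longrightarrow> (a k has_real_derivative a (Suc k) t) (at t)"
    and db: "\<And>k t. t \<in> {\<alpha>..\<beta>} \<Longrightarrow> (b k has_real_derivative b (Suc k) t) (at t)"
    and st: "\<And>t. t \<in> {\<alpha>..\<beta>} \<Longrightarrow> stress_poly (\<lambda>k. a k t) (\<lambda>k. b k t) = 0"
    and ab: "\<alpha> \<le> \<beta>" and nz: "a 0 \<alpha> \<noteq> 0"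
  shows "a 0 \<beta> \<noteq> 0"
proof
  assume z: "a 0 \<beta> = 0"
  have ca: "continuous_on {\<alpha>..\<beta>} (a 0)"
    using da DERIV_isCont continuous_at_imp_continuous_on by metis
  define Z where "Z = {t \<in> {\<alpha>..\<beta>}. a 0 t = 0}"
  have "closed Z" unfolding Z_def using continuous_closed_preimage_constant[OF ca, of 0] by simp
  moreover have "Z \<noteq> {}" "bdd_below Z" using z ab by (auto simp: Z_def)
  ultimately have "Inf Z \<in> Z" using closed_contains_Inf by blast
  define \<beta>' where "\<beta>' = Inf Z"
  have b': "\<alpha> < \<beta>'" "\<beta>' \<le> \<beta>" "a 0 \<beta>' = 0"
    using \<open>Inf Z \<in> Z\<close> nz by (auto simp: Z_def \<beta>'_def less_le)
  have nzt: "a 0 t \<noteq> 0" if "t \<in> {\<alpha>..<\<beta>'}" for t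
    using cInf_lower[of t Z] \<open>bdd_below Z\<close> that b' by (auto simp: Z_def \<beta>'_def)
  have sub: "t \<in> {\<alpha>..\<beta>'} \<Longrightarrow> t \<in> {\<alpha>..\<beta>}" for t using b' by auto
  show False
  proof (cases "a 0 \<alpha> > 0")
    case True
    have "a 0 t > 0" if t: "t \<in> {\<alpha>..<\<beta>'}" for t
    proof (rule ccontr)
      assume "\<not> a 0 t > 0"
      then obtain x where "\<alpha> \<le> x" "x \<le> t" "a 0 x = 0"
        using IVT2'[of "a 0" t 0 \<alpha>] True t continuous_on_subset[OF ca, of "{\<alpha>..t}"] b' by auto
      then show False using nzt[of x] t by auto
    qed
    then show False using no_zero_at_right_end[of \<alpha> \<beta>' a b] da[OF sub] db[OF sub] st[OF sub] b' by blast
  next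
    case False
    have "- a 0 t > 0" if t: "t \<in> {\<alpha>..<\<beta>'}" for t
    proof (rule ccontr)
      assume "\<not> - a 0 t > 0"
      then obtain x where "\<alpha> \<le> x" "x \<le> t" "a 0 x = 0"
        using IVT'[of "a 0" \<alpha> 0 t] False t continuous_on_subset[OF ca, of "{\<alpha>..t}"] b' by auto
      then show False using nzt[of x] t by auto
    qed
    moreover have "((\<lambda>t. - a k t) has_real_derivative - a (Suc k) t) (at t)" if "t \<in> {\<alpha>..\<beta>'}" for k t
      by (rule DERIV_minus[OF da[OF sub[OF that]]])
    moreover have "stress_poly (\<lambda>k. - a k t) (\<lambda>k. b k t) = 0" if "t \<in> {\<alpha>..\<beta>'}" for t
      unfolding stress_poly_uminus st[OF sub[OF that]] by simp
    ultimately show False using no_zero_at_right_end[of \<alpha> \<beta>' "\<lambda>k t. - a k t" b] db[OF sub] b' by simp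
  qed
qed

text \<open>To the left of \<open>t0\<close> the parameter is reversed, which puts the signs of
  \<open>stress_poly_reflect\<close> on the jets.\<close>

lemma cycle_or_generic:
  fixes a b :: "nat \<Rightarrow> real \<Rightarrow> real"
  assumes I: "is_interval I"
    and da: "\<And>k t. t \<in> I \<Longrightarrow> (a k has_real_derivative a (Suc k) t) (at t)"
    and db: "\<And>k t. t \<in> I \<Longrightarrow> (b k has_real_derivative b (Suc k) t) (at t)"
    and st: "\<And>t. t \<in> I \<Longrightarrow> stress_poly (\<lambda>k. a k t) (\<lambda>k. b k t) = 0"
    and t0: "t0 \<in> I" "a 0 t0 \<noteq> 0" and t: "t \<in> I"
  shows "a 0 t \<noteq> 0"
proof (cases "t0 \<le> t")
  case True
  have sub: "x \<in> {t0..t} \<Longrightarrow> x \<in> I" for x using mem_is_interval_1_I[OF I t0(1) t] by auto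
  show ?thesis
    by (rule nonzero_propagates_right[of t0 t a b])
       (fact da[OF sub] db[OF sub] st[OF sub] True t0(2))+
next
  case False
  have sub: "x \<in> {-t0..-t} \<Longrightarrow> -x \<in> I" for x using mem_is_interval_1_I[OF I t t0(1), of "-x"] by auto
  have refl: "((\<lambda>x. (-1) ^ k * f k (-x)) has_real_derivative (-1) ^ Suc k * f (Suc k) (-x)) (at x)"
    if "(f k has_real_derivative f (Suc k) (-x)) (at (-x))" for f :: "nat \<Rightarrow> real \<Rightarrow> real" and k x
    using DERIV_cmult[OF DERIV_chain2[OF that DERIV_minus[OF DERIV_ident]], of "(-1) ^ k"] by simp
  define a' b' where "a' k x = (-1) ^ k * a k (-x)" and "b' k x = (-1) ^ k * b k (-x)" for k x
  have "a' 0 (-t) \<noteq> 0"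
  proof (rule nonzero_propagates_right[of "-t0" "-t" a' b'])
    show "(a' k has_real_derivative a' (Suc k) x) (at x)" if "x \<in> {-t0..-t}" for k x
      unfolding a'_def[abs_def] by (rule refl[of a, OF da[OF sub[OF that]]])
    show "(b' k has_real_derivative b' (Suc k) x) (at x)" if "x \<in> {-t0..-t}" for k x
      unfolding b'_def[abs_def] by (rule refl[of b, OF db[OF sub[OF that]]])
    show "stress_poly (\<lambda>k. a' k x) (\<lambda>k. b' k x) = 0" if "x \<in> {-t0..-t}" for x
      unfolding a'_def b'_def stress_poly_reflect st[OF sub[OF that]] by simp
    show "-t0 \<le> -t" using False by simp
    show "a' 0 (-t0) \<noteq> 0" using t0(2) by (simp add: a'_def)
  qed
  then show ?thesis by (simp add: a'_def)
qed

section \<open>First variation of the total strain\<close>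

text \<open>\<open>B\<close> collects the boundary terms of repeated integration by parts against
  \<open>S / (3 a)\<close>, the derivative of the strain with respect to \<open>a\<close>. Moving
  all derivatives from \<open>w\<close> to this factor leaves the stress term.\<close>

lemma variation_boundary_term:
  fixes a b v w :: "nat \<Rightarrow> real \<Rightarrow> real" and S :: "real \<Rightarrow> real"
  assumes da: "\<And>k t. t \<in> J \<Longrightarrow> (a k has_real_derivative a (Suc k) t) (at t)"
    and db: "\<And>k t. t \<in> J \<Longrightarrow> (b k has_real_derivative b (Suc k) t) (at t)"
    and dv: "\<And>k t. t \<in> J \<Longrightarrow> (v k has_real_derivative v (Suc k) t) (at t)"
    and dw: "\<And>k t. t \<in> J \<Longrightarrow> (w k has_real_derivative w (Suc k) t) (at t)"
    and a0: "\<And>t. t \<in> J \<Longrightarrow> a 0 t \<noteq> 0"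
    and dS: "\<And>t. t \<in> J \<Longrightarrow> (S has_real_derivative S t * a 1 t / (3 * a 0 t)) (at t)"
  obtains B where "\<And>t. t \<in> J \<Longrightarrow> (B has_real_derivative
       S t / (3 * a 0 t) * (v 0 t * a 1 t + 3 * v 1 t * a 0 t
         + (8/3 * b 0 t * b 1 t + 1/3 * b 3 t) * w 0 t + (8/3 * b 0 t ^ 2 + 3/2 * b 2 t) * w 1 t
         + 5/2 * b 1 t * w 2 t + 5/3 * b 0 t * w 3 t + 1/6 * w 5 t)
       + S t * stress_poly (\<lambda>k. a k t) (\<lambda>k. b k t) / (9 * a 0 t ^ 6) * w 0 t) (at t)"
    "\<And>t. t \<in> J \<Longrightarrow> (\<And>k. w k t = 0) \<Longrightarrow> v 0 t = 0 \<Longrightarrow> B t = 0"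
proof -
  have d: "(a 0 has_real_derivative a 1 t) (at t)" "(a 1 has_real_derivative a 2 t) (at t)"
    "(a 2 has_real_derivative a 3 t) (at t)" "(a 3 has_real_derivative a 4 t) (at t)" "(a 4 has_real_derivative a 5 t) (at t)"
    "(b 0 has_real_derivative b 1 t) (at t)" "(b 1 has_real_derivative b 2 t) (at t)" "(b 2 has_real_derivative b 3 t) (at t)"
    "(v 0 has_real_derivative v 1 t) (at t)"
    "(w 0 has_real_derivative w 1 t) (at t)" "(w 1 has_real_derivative w 2 t) (at t)"
    "(w 2 has_real_derivative w 3 t) (at t)" "(w 3 has_real_derivative w 4 t) (at t)" "(w 4 has_real_derivative w 5 t) (at t)"
    if "t \<in> J" for t
    using da[OF that, of 0] da[OF that, of 1] da[OF that, of 2] da[OF that, of 3] da[OF that, of 4]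
      db[OF that, of 0] db[OF that, of 1] db[OF that, of 2] dv[OF that, of 0]
      dw[OF that, of 0] dw[OF that, of 1] dw[OF that, of 2] dw[OF that, of 3] dw[OF that, of 4]
    by (simp_all add: eval_nat_numeral)
  define f0 where "f0 t = S t / (3 * a 0 t)" for t
  \<comment> \<open>Numerators: the n-th derivative of \<open>f0\<close> is
    \<open>f0 * pn / a ^ n\<close>. The recursion is \<open>dgen\<close>, whose 2/3 comes from the
    logarithmic derivative \<open>- 2/3 * a' / a\<close> of \<open>f0\<close>.\<close>
  define p1 where "p1 t = - 2/3 * a 1 t" for t
  define p2 where "p2 t = - 2/3 * a 0 t * a 2 t + 10/9 * a 1 t ^ 2" for t
  define p3 where "p3 t = 10/3 * a 0 t * a 1 t * a 2 t - 2/3 * a 0 t ^ 2 * a 3 t - 80/27 * a 1 t ^ 3" for t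
  define p4 where "p4 t = - 160/9 * a 0 t * a 1 t ^ 2 * a 2 t + 40/9 * a 0 t ^ 2 * a 1 t * a 3 t
    + 10/3 * a 0 t ^ 2 * a 2 t ^ 2 - 2/3 * a 0 t ^ 3 * a 4 t + 880/81 * a 1 t ^ 4" for t
  define p5 where "p5 t = 8800/81 * a 0 t * a 1 t ^ 3 * a 2 t - 400/9 * a 0 t ^ 2 * a 1 t * a 2 t ^ 2
    - 800/27 * a 0 t ^ 2 * a 1 t ^ 2 * a 3 t + 50/9 * a 0 t ^ 3 * a 1 t * a 4 t + 100/9 * a 0 t ^ 3 * a 2 t * a 3 t
    - 2/3 * a 0 t ^ 4 * a 5 t - 12320/243 * a 1 t ^ 5" for t
  define f1 where "f1 t = f0 t * p1 t / a 0 t" for t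
  define f2 where "f2 t = f0 t * p2 t / a 0 t ^ 2" for t
  define f3 where "f3 t = f0 t * p3 t / a 0 t ^ 3" for t
  define f4 where "f4 t = f0 t * p4 t / a 0 t ^ 4" for t
  define f5 where "f5 t = f0 t * p5 t / a 0 t ^ 5" for t
  have df0: "(f0 has_real_derivative f1 t) (at t)" if t: "t \<in> J" for t
    unfolding f0_def[abs_def] f1_def p1_def f0_def using a0[OF t]
    by (auto intro!: derivative_eq_intros d[OF t] dS[OF t] simp: field_simps simp del: One_nat_def)
  have dp: "(p1 has_real_derivative - 2/3 * a 2 t) (at t)"
    "(p2 has_real_derivative 14/9 * a 1 t * a 2 t - 2/3 * a 0 t * a 3 t) (at t)"
    "(p3 has_real_derivative 10/3 * a 0 t * a 2 t ^ 2 + 2 * a 0 t * a 1 t * a 3 t - 2/3 * a 0 t ^ 2 * a 4 t - 50/9 * a 1 t ^ 2 * a 2 t) (at t)"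
    "(p4 has_real_derivative 2080/81 * a 1 t ^ 3 * a 2 t - 80/9 * a 0 t * a 1 t ^ 2 * a 3 t - 260/9 * a 0 t * a 1 t * a 2 t ^ 2
       + 100/9 * a 0 t ^ 2 * a 2 t * a 3 t + 22/9 * a 0 t ^ 2 * a 1 t * a 4 t - 2/3 * a 0 t ^ 3 * a 5 t) (at t)"
    if t: "t \<in> J" for t
    unfolding p1_def[abs_def] p2_def[abs_def] p3_def[abs_def] p4_def[abs_def]
    by (auto intro!: derivative_eq_intros d[OF t] simp: field_simps power2_eq_square power3_eq_cube simp del: One_nat_def)
  have df1: "(f1 has_real_derivative f2 t) (at t)" if t: "t \<in> J" for t
  proof -
    have "(f1 has_real_derivative (f1 t * p1 t + f0 t * (- 2/3 * a 2 t)) / a 0 t - f0 t * p1 t * a 1 t / a 0 t ^ 2) (at t)"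
      unfolding f1_def[abs_def] using a0[OF t] df0[OF t, unfolded f1_def[abs_def]]
      by (auto intro!: derivative_eq_intros dp[OF t] d[OF t] simp: field_simps power2_eq_square simp del: One_nat_def)
    moreover have "(f1 t * p1 t + f0 t * (- 2/3 * a 2 t)) / a 0 t - f0 t * p1 t * a 1 t / a 0 t ^ 2 = f2 t"
      unfolding f1_def f2_def p2_def p1_def using a0[OF t] by (simp add: field_simps power2_eq_square)
    ultimately show ?thesis by simp
  qed
  have dgen: "((\<lambda>t. f0 t * p t / a 0 t ^ n) has_real_derivative
      f0 t * (a 0 t * p' - (real n + 2/3) * a 1 t * p t) / a 0 t ^ Suc n) (at t)"
    if t: "t \<in> J" and p: "(p has_real_derivative p') (at t)" and n: "n > 0" for p p' n t
  proof -
    have "((\<lambda>t. f0 t * p t / a 0 t ^ n) has_real_derivative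
       ((f0 t * p' + f1 t * p t) * a 0 t ^ n - f0 t * p t * (real n * (a 1 t * a 0 t ^ (n - 1)))) / (a 0 t ^ n * a 0 t ^ n)) (at t)"
      using DERIV_divide[OF DERIV_mult[OF df0[OF t] p] DERIV_power[OF d(1)[OF t], of n]] a0[OF t]
      by (simp add: algebra_simps)
    moreover obtain m where m: "n = Suc m" using n by (cases n) auto
    have "((f0 t * p' + f1 t * p t) * a 0 t ^ n - f0 t * p t * (real n * (a 1 t * a 0 t ^ (n - 1)))) / (a 0 t ^ n * a 0 t ^ n)
      = f0 t * (a 0 t * p' - (real n + 2/3) * a 1 t * p t) / a 0 t ^ Suc n"
      unfolding m f1_def p1_def using a0[OF t] by (simp add: field_simps)
    ultimately show ?thesis by simp
  qed
  have df2: "(f2 has_real_derivative f3 t) (at t)" if t: "t \<in> J" for t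
  proof -
    have "a 0 t * (14/9 * a 1 t * a 2 t - 2/3 * a 0 t * a 3 t) - (real 2 + 2/3) * a 1 t * p2 t = p3 t"
      unfolding p2_def p3_def by (simp add: field_simps power2_eq_square power3_eq_cube)
    with dgen[OF t dp(2)[OF t], of 2] show ?thesis unfolding f2_def[abs_def] f3_def by (simp add: eval_nat_numeral)
  qed
  have df3: "(f3 has_real_derivative f4 t) (at t)" if t: "t \<in> J" for t
  proof -
    have "a 0 t * (10/3 * a 0 t * a 2 t ^ 2 + 2 * a 0 t * a 1 t * a 3 t - 2/3 * a 0 t ^ 2 * a 4 t - 50/9 * a 1 t ^ 2 * a 2 t)
       - (real 3 + 2/3) * a 1 t * p3 t = p4 t"
      unfolding p3_def p4_def by (simp add: field_simps eval_nat_numeral)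
    with dgen[OF t dp(3)[OF t], of 3] show ?thesis unfolding f3_def[abs_def] f4_def by (simp add: eval_nat_numeral)
  qed
  have df4: "(f4 has_real_derivative f5 t) (at t)" if t: "t \<in> J" for t
  proof -
    have "a 0 t * (2080/81 * a 1 t ^ 3 * a 2 t - 80/9 * a 0 t * a 1 t ^ 2 * a 3 t - 260/9 * a 0 t * a 1 t * a 2 t ^ 2
       + 100/9 * a 0 t ^ 2 * a 2 t * a 3 t + 22/9 * a 0 t ^ 2 * a 1 t * a 4 t - 2/3 * a 0 t ^ 3 * a 5 t)
       - (real 4 + 2/3) * a 1 t * p4 t = p5 t"
      unfolding p4_def p5_def by (simp add: field_simps eval_nat_numeral)
    with dgen[OF t dp(4)[OF t], of 4] show ?thesis unfolding f4_def[abs_def] f5_def by (simp add: eval_nat_numeral)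
  qed
  note df = df0 df1 df2 df3 df4
  \<comment> \<open>Line by line the boundary terms of the tangential part and of the terms of order
    5, 3, 2 and 1 in \<open>w\<close>.\<close>
  define B where "B t = S t * v 0 t
    + 1/6 * (f0 t * w 4 t - f1 t * w 3 t + f2 t * w 2 t - f3 t * w 1 t + f4 t * w 0 t)
    + 5/3 * (b 0 t * f0 t * w 2 t - (b 1 t * f0 t + b 0 t * f1 t) * w 1 t
             + (b 2 t * f0 t + 2 * b 1 t * f1 t + b 0 t * f2 t) * w 0 t)
    + 5/2 * (b 1 t * f0 t * w 1 t - (b 2 t * f0 t + b 1 t * f1 t) * w 0 t)
    + (8/3 * b 0 t ^ 2 + 3/2 * b 2 t) * f0 t * w 0 t" for t
  \<comment> \<open>the operator acting on \<open>w\<close> is skew-adjoint; applied to \<open>f0\<close> it gives the stress density\<close>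
  have M: "1/6 * f5 t + 5/3 * (b 3 t * f0 t + 3 * b 2 t * f1 t + 3 * b 1 t * f2 t + b 0 t * f3 t)
     - 5/2 * (b 3 t * f0 t + 2 * b 2 t * f1 t + b 1 t * f2 t) + (16/3 * b 0 t * b 1 t + 3/2 * b 3 t) * f0 t
     + (8/3 * b 0 t ^ 2 + 3/2 * b 2 t) * f1 t - (8/3 * b 0 t * b 1 t + 1/3 * b 3 t) * f0 t
     = S t * stress_poly (\<lambda>k. a k t) (\<lambda>k. b k t) / (9 * a 0 t ^ 6)" if t: "t \<in> J" for t
    unfolding f5_def f3_def f2_def f1_def p5_def p3_def p2_def p1_def f0_def stress_poly_def using a0[OF t]
    by (simp add: field_simps eval_nat_numeral)
  show ?thesis
  proof (rule that[of B])
    fix t assume t: "t \<in> J"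
    have 1: "S t * a 1 t / (3 * a 0 t) * v 0 t + S t * v 1 t = f0 t * (v 0 t * a 1 t + 3 * v 1 t * a 0 t)"
      unfolding f0_def using a0[OF t] by (simp add: field_simps)
    have "(B has_real_derivative S t * a 1 t / (3 * a 0 t) * v 0 t + S t * v 1 t
        + f0 t * ((8/3 * b 0 t * b 1 t + 1/3 * b 3 t) * w 0 t + (8/3 * b 0 t ^ 2 + 3/2 * b 2 t) * w 1 t
         + 5/2 * b 1 t * w 2 t + 5/3 * b 0 t * w 3 t + 1/6 * w 5 t)
        + (1/6 * f5 t + 5/3 * (b 3 t * f0 t + 3 * b 2 t * f1 t + 3 * b 1 t * f2 t + b 0 t * f3 t)
     - 5/2 * (b 3 t * f0 t + 2 * b 2 t * f1 t + b 1 t * f2 t) + (16/3 * b 0 t * b 1 t + 3/2 * b 3 t) * f0 t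
     + (8/3 * b 0 t ^ 2 + 3/2 * b 2 t) * f1 t - (8/3 * b 0 t * b 1 t + 1/3 * b 3 t) * f0 t) * w 0 t) (at t)"
      unfolding B_def[abs_def]
      by (rule derivative_eq_intros refl dS[OF t] d[OF t] df[OF t])+ (simp add: field_simps power2_eq_square)
    then show "(B has_real_derivative
       S t / (3 * a 0 t) * (v 0 t * a 1 t + 3 * v 1 t * a 0 t
         + (8/3 * b 0 t * b 1 t + 1/3 * b 3 t) * w 0 t + (8/3 * b 0 t ^ 2 + 3/2 * b 2 t) * w 1 t
         + 5/2 * b 1 t * w 2 t + 5/3 * b 0 t * w 3 t + 1/6 * w 5 t)
       + S t * stress_poly (\<lambda>k. a k t) (\<lambda>k. b k t) / (9 * a 0 t ^ 6) * w 0 t) (at t)"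
      unfolding M[OF t] 1 by (simp add: f0_def algebra_simps)
  next
    fix t assume "\<And>k. w k t = 0" "v 0 t = 0"
    then show "B t = 0" by (simp add: B_def)
  qed
qed

section \<open>Integrals over compact sets and derivatives of the strain\<close>

lemma integrable_on_compact_continuous:
  fixes f :: "real \<Rightarrow> real"
  assumes "compact K" "continuous_on K f"
  shows "f integrable_on K"
  using borel_integrable_compact[OF assms] set_borel_integral_eq_integral(1)[of K f]
  by (simp add: set_integrable_def)

text \<open>The support of a variation may be any compact set, not only an interval. By the mean
  value theorem and the uniform continuity of \<open>f'\<close>, the difference quotients converge
  uniformly on \<open>K\<close>.\<close>

lemma DERIV_integral_compact:
  fixes f f' :: "real \<times> real \<Rightarrow> real"
  assumes K: "compact K" and \<delta>: "\<delta> > 0"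
    and der: "\<And>t \<tau>. t \<in> K \<Longrightarrow> \<bar>\<tau>\<bar> \<le> \<delta> \<Longrightarrow> ((\<lambda>r. f (t, r)) has_real_derivative f' (t, \<tau>)) (at \<tau>)"
    and cf: "continuous_on (K \<times> {-\<delta>..\<delta>}) f" and cf': "continuous_on (K \<times> {-\<delta>..\<delta>}) f'"
  shows "((\<lambda>\<tau>. integral K (\<lambda>t. f (t, \<tau>))) has_real_derivative integral K (\<lambda>t. f' (t, 0))) (at 0)"
proof -
  have ci: "(\<lambda>t. h (t, \<tau>)) integrable_on K" if "continuous_on (K \<times> {-\<delta>..\<delta>}) h" "\<bar>\<tau>\<bar> \<le> \<delta>" for h :: "real \<times> real \<Rightarrow> real" and \<tau>
    by (intro integrable_on_compact_continuous K continuous_on_compose2[OF that(1)] continuous_intros) (use that(2) in auto)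
  define c where "c = integral K (\<lambda>t. 1 :: real)"
  have c1: "(\<lambda>t. 1 :: real) integrable_on K" by (intro integrable_on_compact_continuous K continuous_intros)
  have c0: "c \<ge> 0" unfolding c_def by (rule integral_nonneg[OF c1]) simp
  have uc: "uniformly_continuous_on (K \<times> {-\<delta>..\<delta>}) f'"
    by (intro compact_uniformly_continuous cf' compact_Times K compact_Icc)
  show ?thesis unfolding DERIV_def
  proof (rule LIM_I)
    fix e :: real assume e: "e > 0"
    \<comment> \<open>The summand 1 covers sets \<open>K\<close> of measure 0.\<close>
    define e' where "e' = e / (c + 1)"
    have e': "e' > 0" "e' * c < e" using e c0 by (auto simp: e'_def field_simps)
    obtain d where d: "d > 0" "\<And>x y. x \<in> K \<times> {-\<delta>..\<delta>} \<Longrightarrow> y \<in> K \<times> {-\<delta>..\<delta>} \<Longrightarrow> dist y x < d \<Longrightarrow> dist (f' y) (f' x) < e'"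
      using uc e'(1) unfolding uniformly_continuous_on_def by metis
    show "\<exists>s>0. \<forall>x. x \<noteq> 0 \<and> norm (x - 0) < s \<longrightarrow>
      norm ((integral K (\<lambda>t. f (t, 0 + x)) - integral K (\<lambda>t. f (t, 0))) / x - integral K (\<lambda>t. f' (t, 0))) < e"
    proof (intro exI[of _ "min d \<delta>"] conjI allI impI)
      show "min d \<delta> > 0" using d \<delta> by simp
      fix h :: real assume h: "h \<noteq> 0 \<and> norm (h - 0) < min d \<delta>"
      then have h': "h \<noteq> 0" "\<bar>h\<bar> < d" "\<bar>h\<bar> < \<delta>" by auto
      have bd: "\<bar>(f (t, h) - f (t, 0)) / h - f' (t, 0)\<bar> \<le> e'" if t: "t \<in> K" for t
      proof -
        obtain \<xi> where \<xi>: "\<bar>\<xi>\<bar> \<le> \<bar>h\<bar>" "f (t, h) - f (t, 0) = h * f' (t, \<xi>)"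
        proof (cases "h > 0")
          case True
          then obtain z where "z > 0" "z < h" "f (t, h) - f (t, 0) = (h - 0) * f' (t, z)"
            using MVT2[of 0 h "\<lambda>r. f (t, r)" "\<lambda>r. f' (t, r)"] der[OF t] h' by auto
          then show ?thesis using that[of z] by auto
        next
          case False
          then obtain z where "z > h" "z < 0" "f (t, 0) - f (t, h) = (0 - h) * f' (t, z)"
            using MVT2[of h 0 "\<lambda>r. f (t, r)" "\<lambda>r. f' (t, r)"] der[OF t] h' by auto
          then show ?thesis using that[of z] by auto
        qed
        have "dist (f' (t, \<xi>)) (f' (t, 0)) < e'"
          by (rule d(2)) (use t \<xi>(1) h' \<delta> in \<open>auto simp: dist_Pair_Pair dist_real_def\<close>)
        then show ?thesis using \<xi>(2) h'(1) by (simp add: dist_real_def)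
      qed
      have i0: "(\<lambda>t. f (t, h)) integrable_on K" "(\<lambda>t. f (t, 0)) integrable_on K" "(\<lambda>t. f' (t, 0)) integrable_on K"
        using ci[OF cf] ci[OF cf'] h' \<delta> by auto
      have int: "(\<lambda>t. (f (t, h) - f (t, 0)) / h - f' (t, 0)) integrable_on K"
        using i0 by (intro integrable_diff integrable_on_divide)
      have "(integral K (\<lambda>t. f (t, 0 + h)) - integral K (\<lambda>t. f (t, 0))) / h - integral K (\<lambda>t. f' (t, 0))
          = integral K (\<lambda>t. (f (t, h) - f (t, 0)) / h - f' (t, 0))"
        using i0 by (simp add: integral_diff integrable_diff integrable_on_divide)
      also have "norm \<dots> \<le> integral K (\<lambda>t. e' * 1)"
        by (rule integral_norm_bound_integral[OF int integrable_on_mult_right[OF c1]]) (use bd in auto)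
      also have "\<dots> = e' * c" unfolding c_def by (rule integral_mult_right)
      also have "\<dots> < e" by (rule e'(2))
      finally show "norm ((integral K (\<lambda>t. f (t, 0 + h)) - integral K (\<lambda>t. f (t, 0))) / h - integral K (\<lambda>t. f' (t, 0))) < e" .
    qed
  qed
qed

lemma DERIV_abs_nonzero:
  assumes "(x::real) \<noteq> 0"
  shows "(abs has_real_derivative sgn x) (at x)"
proof (cases "x > 0")
  case True
  show ?thesis
    by (rule has_field_derivative_transform_within_open[of "\<lambda>x. x" _ _ "{0<..}"])
       (use True in \<open>auto intro!: derivative_eq_intros\<close>)
next
  case False
  show ?thesis
    by (rule has_field_derivative_transform_within_open[of "\<lambda>x. - x" _ _ "{..<0}"])
       (use False assms in \<open>auto intro!: derivative_eq_intros\<close>)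
qed

text \<open>The denominator contains \<open>f x\<close> and not its absolute value: it absorbs the
  sign, and one formula serves both signs.\<close>

lemma DERIV_root3_abs:
  assumes "(f has_real_derivative f') (at x)" "f x \<noteq> 0"
  shows "((\<lambda>x. root 3 \<bar>f x\<bar>) has_real_derivative root 3 \<bar>f x\<bar> * f' / (3 * f x)) (at x)"
proof -
  let ?r = "root 3 \<bar>f x\<bar>"
  have r: "?r > 0" "?r ^ 3 = \<bar>f x\<bar>" using assms(2) by (auto simp: real_root_pow_pos2)
  have "(root 3 has_real_derivative inverse (real 3 * ?r ^ (3 - Suc 0))) (at \<bar>f x\<bar>)"
    by (rule DERIV_real_root) (use assms(2) in auto)
  from DERIV_chain2[OF this DERIV_chain2[OF DERIV_abs_nonzero[OF assms(2)] assms(1)]]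
  have "((\<lambda>x. root 3 \<bar>f x\<bar>) has_real_derivative inverse (3 * ?r ^ 2) * (sgn (f x) * f')) (at x)"
    by (simp add: numeral_2_eq_2)
  moreover have "inverse (3 * y ^ 2) = y / (3 * y ^ 3)" if "y > 0" for y :: real
    using that by (simp add: field_simps power2_eq_square power3_eq_cube)
  from this[OF r(1)] have "inverse (3 * ?r ^ 2) = ?r / (3 * \<bar>f x\<bar>)" unfolding r(2) .
  moreover have "?r / (3 * \<bar>f x\<bar>) * (sgn (f x) * f') = ?r * f' / (3 * f x)"
    using assms(2) by (cases "f x > 0") (auto simp: sgn_if)
  ultimately show ?thesis by metis
qed

lemma pd1_funpow_DERIV:
  fixes F :: "real \<times> real \<Rightarrow> real"
  assumes "smooth_on2 U F" "(t, \<tau>) \<in> U"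
  shows "((\<lambda>r. (pd1 ^^ k) F (r, \<tau>)) has_real_derivative (pd1 ^^ Suc k) F (t, \<tau>)) (at t)"
  using smooth_on2_DERIV[OF smooth_on2_pd1_funpow[OF assms(1)] assms(2)] by simp

lemma pd1_funpow_zero:
  fixes F :: "real \<times> real \<Rightarrow> real"
  assumes "open T" "\<And>t. t \<in> T \<Longrightarrow> F (t, \<tau>) = 0" "t \<in> T"
  shows "(pd1 ^^ k) F (t, \<tau>) = 0"
  using assms(3)
proof (induction k arbitrary: t)
  case (Suc k)
  have "((\<lambda>r. (pd1 ^^ k) F (r, \<tau>)) has_vector_derivative 0) (at t)"
    by (rule has_vector_derivative_transform_within_open[OF has_vector_derivative_const assms(1) Suc.prems])
       (simp add: Suc.IH)
  then show ?case by (simp add: pd1_def[of "(pd1 ^^ k) F"] vector_derivative_at)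
qed (use assms(2) in simp)

lemma deriv_funpow_slice:
  fixes F :: "real \<times> real \<Rightarrow> real"
  assumes "open I" "smooth_on2 U F" "\<And>t. t \<in> I \<Longrightarrow> (t, \<tau>) \<in> U" "\<And>t. t \<in> I \<Longrightarrow> f t = F (t, \<tau>)" "t \<in> I"
  shows "(deriv ^^ k) f t = (pd1 ^^ k) F (t, \<tau>)"
  using assms(5)
proof (induction k arbitrary: t)
  case (Suc k)
  have "((deriv ^^ k) f has_real_derivative (pd1 ^^ Suc k) F (t, \<tau>)) (at t)"
    by (rule has_field_derivative_transform_within_open[OF pd1_funpow_DERIV[OF assms(2) assms(3)[OF Suc.prems]] assms(1) Suc.prems])
       (simp add: Suc.IH)
  then show ?case by (simp add: DERIV_imp_deriv)
qed (use assms(4) in simp)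

lemma stress_eq_stress_poly:
  "stress I \<gamma> t = stress_poly (\<lambda>k. (deriv ^^ k) (fub_a I \<gamma>) t) (\<lambda>k. (deriv ^^ k) (fub_b I \<gamma>) t)"
  by (simp add: stress_def stress_poly_def Let_def)

text \<open>Also instantiated with the family constant in \<open>\<tau>\<close>, which makes
  \<open>fub_base\<close> and \<open>stress_base\<close> available for a single curve.\<close>

locale legendrian_variation =
  fixes I :: "real set" and \<gamma> :: "real \<Rightarrow> cpt" and \<epsilon> :: real and g :: "real \<times> real \<Rightarrow> cpt" and N :: "real \<times> real \<Rightarrow> cvec"
  assumes I: "open I" "is_interval I" and L0: "legendrian I \<gamma>" and \<epsilon>: "\<epsilon> > 0"
    and svm: "smooth_variation_map I \<epsilon> g"
    and L: "\<And>\<tau>. \<tau> \<in> {-\<epsilon><..<\<epsilon>} \<Longrightarrow> legendrian I (\<lambda>t. g (t, \<tau>))"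
    and g0: "\<And>t. t \<in> I \<Longrightarrow> g (t, 0) = \<gamma> t"
    and F: "framed_lift (vdom I \<epsilon>) N"
    and lift: "\<And>q. q \<in> vdom I \<epsilon> \<Longrightarrow> N q \<noteq> 0 \<and> g q = proj (N q)"
begin

sublocale framed_lift "vdom I \<epsilon>" N by (rule F)

lemma in_vdom0: "t \<in> I \<Longrightarrow> (t, 0) \<in> vdom I \<epsilon>"
  using \<epsilon> by (auto simp: vdom_def)

lemma fub_variation:
  assumes "t \<in> I" "\<bar>\<tau>\<bar> < \<epsilon>"
  shows "fub_a I (\<lambda>s. g (s, \<tau>)) t = fA (t, \<tau>)" "fub_b I (\<lambda>s. g (s, \<tau>)) t = fB (t, \<tau>)"
proof -
  have \<tau>: "\<tau> \<in> {-\<epsilon><..<\<epsilon>}" using assms(2) by auto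
  have n: "normalized_lift I (\<lambda>t. g (t, \<tau>)) (\<lambda>t. N (t, \<tau>))" by (rule framed_lift_normalized[OF F lift \<tau>])
  show "fub_a I (\<lambda>s. g (s, \<tau>)) t = fA (t, \<tau>)" "fub_b I (\<lambda>s. g (s, \<tau>)) t = fB (t, \<tau>)"
    using fubini_eq[OF I L[OF \<tau>] n assms(1)]
    by (simp_all only: vd_funpow_slice[of _ N \<tau>] funpow2 funpow3 fA_def fB_def)
qed

lemma normalized_lift_base: "normalized_lift I \<gamma> (\<lambda>t. N (t, 0))"
  using framed_lift_normalized[OF F lift, of 0] \<epsilon> g0 by (simp add: normalized_lift_def)

lemma fub_base:
  assumes "t \<in> I" shows "fub_a I \<gamma> t = fA (t, 0)" "fub_b I \<gamma> t = fB (t, 0)"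
  unfolding fubini_eq[OF I L0 normalized_lift_base assms]
  by (simp_all only: vd_funpow_slice funpow2 funpow3 fA_def fB_def)

lemma stress_base:
  assumes "t \<in> I"
  shows "stress I \<gamma> t = stress_poly (\<lambda>k. (pd1 ^^ k) fA (t, 0)) (\<lambda>k. (pd1 ^^ k) fB (t, 0))"
  using deriv_funpow_slice[OF I(1) smooth_fA in_vdom0 fub_base(1) assms]
    deriv_funpow_slice[OF I(1) smooth_fB in_vdom0 fub_base(2) assms]
  by (simp add: stress_eq_stress_poly)

text \<open>Vanishing of the variation field is defined through some local lift \<open>G\<close>.
  Passing to the normalized lift rescales the field and adds a multiple of the lift, to which
  \<open>vw\<close> and \<open>vv\<close> are blind.\<close>

lemma lift_change:
  assumes "local_lift2 U' g G" "U' \<subseteq> vdom I \<epsilon>" "q \<in> U'"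
  obtains k where "k \<noteq> 0" "N q = k *s G q" "\<exists>k'. pd2 N q = k *s pd2 G q + k' *s G q"
proof -
  have oU: "open U'" and sG: "smooth_on2 U' G" and G: "\<And>q. q \<in> U' \<Longrightarrow> G q \<noteq> 0 \<and> g q = proj (G q)"
    using assms(1) by (auto simp: local_lift2_def)
  have sN: "smooth_on2 U' N" using smooth_on2_subset[OF smooth_N assms(2)] .
  have lG: "ell (G q) \<noteq> 0" if "q \<in> U'" for q
    using ell_nonzero heisS_hform svm G[OF that] that assms(2) unfolding smooth_variation_map_def by (metis subsetD)
  have lN: "ell (N q) \<noteq> 0" if "q \<in> U'" for q
    using ell_nonzero[OF null] lift that assms(2) by blast
  define k where "k = (\<lambda>q. ell (N q) / ell (G q))"
  have sk: "smooth_on2 U' k" unfolding k_def ell_def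
    by (intro smooth_intros oU sN sG) (use lG in \<open>simp add: ell_def\<close>)
  have kN: "k q *s G q = N q" if "q \<in> U'" for q
  proof -
    have "proj (N q) = proj (G q)" "N q \<noteq> 0" using lift[OF subsetD[OF assms(2) that]] G[OF that] by auto
    then obtain c where c: "N q = c *s G q" using proj_eqD by metis
    then have "ell (N q) = c * ell (G q)" by (simp add: ell_smult)
    then show ?thesis using c lG[OF that] by (simp add: k_def)
  qed
  have "pd2 N q = pd2 (\<lambda>q. k q *s G q) q"
    by (rule smooth_on2_pd_cong(2)[OF oU smooth_on2_smult[OF oU sk sG] kN assms(3)])
  also have "\<dots> = k q *s pd2 G q + pd2 k q *s G q"
    by (rule pd_bilinear(2)[OF bounded_bilinear_smult sk sG assms(3)])
  finally have 1: "\<exists>k'. pd2 N q = k q *s pd2 G q + k' *s G q" by blast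
  have "k q \<noteq> 0" using lG[OF assms(3)] lN[OF assms(3)] by (simp add: k_def)
  from that[OF this kN[OF assms(3), symmetric] 1] show ?thesis .
qed

lemma varfield_vanishes_imp:
  assumes "varfield_vanishes I \<epsilon> g t"
  shows "vw (t, 0) = 0" "vv (t, 0) = 0"
proof -
  obtain U' G c where U': "(t, 0) \<in> U'" "U' \<subseteq> vdom I \<epsilon>" "local_lift2 U' g G" and c: "pd2 G (t, 0) = c *s G (t, 0)"
    using assms unfolding varfield_vanishes_def by blast
  obtain k k' where k: "k \<noteq> 0" "N (t, 0) = k *s G (t, 0)" "pd2 N (t, 0) = k *s pd2 G (t, 0) + k' *s G (t, 0)"
    using lift_change[OF U'(3,2,1)] by blast
  have q: "(t, 0) \<in> vdom I \<epsilon>" using U' by blast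
  have "pd2 N (t, 0) = ((k * c + k') / k) *s N (t, 0)"
    unfolding k(3) unfolding k(2) c using k(1) by (simp add: vec_eq_iff field_simps)
  then show "vw (t, 0) = 0" "vv (t, 0) = 0"
    using null[OF q] leg'[OF q] by (simp_all add: vw_def vv_def hform_simps)
qed

lemma strain_variation:
  assumes "t \<in> I" "\<bar>\<tau>\<bar> < \<epsilon>"
  shows "strain I (\<lambda>s. g (s, \<tau>)) t = root 3 \<bar>fA (t, \<tau>)\<bar>"
  using fub_variation[OF assms] by (simp add: strain_def)

text \<open>For small \<open>\<tau>\<close> the density \<open>a\<close> stays nonzero over the
  compact support, so the strain may be differentiated under the integral. The integral is then
  extended from the support to \<open>{c..d}\<close>, where integration by parts leaves no boundary
  terms.\<close>

theorem total_strain_first_variation: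
  assumes K: "compact (var_support I \<epsilon> g)" "var_support I \<epsilon> g \<subseteq> {c<..<d}"
    and cd: "{c..d} \<subseteq> I" "c \<le> d" and nz: "\<And>t. t \<in> {c..d} \<Longrightarrow> fub_a I \<gamma> t \<noteq> 0"
  shows "(total_strain I \<epsilon> g has_real_derivative
     integral {c..d} (\<lambda>t. - (root 3 \<bar>fA (t, 0)\<bar> * stress I \<gamma> t / (9 * fA (t, 0) ^ 6)) * vw (t, 0))) (at 0)"
proof -
  define K where "K = var_support I \<epsilon> g"
  have cK: "compact K" and Kcd: "K \<subseteq> {c<..<d}" using K by (auto simp: K_def)
  have KI: "K \<subseteq> I" using Kcd cd by force
  define W where "W = {q \<in> vdom I \<epsilon>. fA q \<noteq> 0}"
  have oW: "open W"
  proof -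
    have "open (vdom I \<epsilon> \<inter> fA -` (- {0}))"
      by (rule continuous_open_preimage[OF smooth_on2_continuous[OF smooth_fA] open_U]) auto
    moreover have "W = vdom I \<epsilon> \<inter> fA -` (- {0})" by (auto simp: W_def)
    ultimately show ?thesis by simp
  qed
  have "K \<times> {0} \<subseteq> W"
    using KI Kcd nz fub_base in_vdom0 by (force simp: W_def)
  then obtain \<delta> where \<delta>: "\<delta> > 0" "(\<Union>x\<in>K \<times> {0}. cball x \<delta>) \<subseteq> W"
    using compact_subset_open_imp_cball_epsilon_subset[OF compact_Times[OF cK] oW, of "{0}"] by auto
  have KW: "(t, \<tau>) \<in> W" if "t \<in> K" "\<bar>\<tau>\<bar> \<le> \<delta>" for t \<tau>
  proof -
    have "(t, \<tau>) \<in> cball (t, 0) \<delta>" using that by (simp add: dist_Pair_Pair dist_real_def)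
    then show ?thesis using \<delta>(2) that(1) by blast
  qed
  define s where "s q = root 3 \<bar>fA q\<bar>" for q
  define s' where "s' q = s q * pd2 fA q / (3 * fA q)" for q
  have ds: "((\<lambda>r. s (t, r)) has_real_derivative s' (t, \<tau>)) (at \<tau>)" if "(t, \<tau>) \<in> W" for t \<tau>
  proof -
    have "((\<lambda>r. fA (t, r)) has_real_derivative pd2 fA (t, \<tau>)) (at \<tau>)"
      using smooth_on2_has_pd2[OF smooth_fA, of t \<tau>] that
      by (simp add: W_def has_real_derivative_iff_has_vector_derivative)
    then show ?thesis unfolding s_def s'_def by (rule DERIV_root3_abs) (use that in \<open>simp add: W_def\<close>)
  qed
  have cs: "continuous_on W s" unfolding s_def[abs_def]
    by (intro continuous_intros continuous_on_subset[OF smooth_on2_continuous[OF smooth_fA]]) (auto simp: W_def)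
  have cs': "continuous_on W s'" unfolding s'_def[abs_def]
    by (intro continuous_intros cs continuous_on_subset[OF smooth_on2_continuous[OF smooth_fA]]
         continuous_on_subset[OF smooth_on2_continuous[OF smooth_on2_pd2[OF smooth_fA]]]) (auto simp: W_def)
  have sub: "K \<times> {-\<delta>..\<delta>} \<subseteq> W" using KW by auto
  have D1: "((\<lambda>\<tau>. integral K (\<lambda>t. s (t, \<tau>))) has_real_derivative integral K (\<lambda>t. s' (t, 0))) (at 0)"
    by (rule DERIV_integral_compact[OF cK \<delta>(1) _ continuous_on_subset[OF cs sub] continuous_on_subset[OF cs' sub]])
       (use ds KW in auto)
  have D2: "(total_strain I \<epsilon> g has_real_derivative integral K (\<lambda>t. s' (t, 0))) (at 0)"
  proof (rule has_field_derivative_transform_within_open[OF D1, of "{-\<epsilon><..<\<epsilon>}"])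
    fix \<tau> assume "\<tau> \<in> {-\<epsilon><..<\<epsilon>}"
    then have "\<bar>\<tau>\<bar> < \<epsilon>" by auto
    then show "integral K (\<lambda>t. s (t, \<tau>)) = total_strain I \<epsilon> g \<tau>"
      unfolding total_strain_def K_def[symmetric]
      by (intro integral_cong) (use KI strain_variation in \<open>auto simp: s_def\<close>)
  qed (use \<epsilon> in auto)
  \<comment> \<open>The complement of the support in \<open>I\<close> is open, so on it all
    \<open>t\<close>-derivatives of \<open>vw\<close> and \<open>vv\<close> vanish as well.\<close>
  have oT: "open (I - K)" using I(1) compact_imp_closed[OF cK] by (rule open_Diff)
  have van: "vw (t, 0) = 0" "vv (t, 0) = 0" if "t \<in> I - K" for t
  proof -
    have "varfield_vanishes I \<epsilon> g t"
      using that closure_subset[of "{t \<in> I. \<not> varfield_vanishes I \<epsilon> g t}"] unfolding K_def var_support_def by blast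
    then show "vw (t, 0) = 0" "vv (t, 0) = 0" by (rule varfield_vanishes_imp)+
  qed
  have vank: "(pd1 ^^ k) vw (t, 0) = 0" "(pd1 ^^ k) vv (t, 0) = 0" if "t \<in> I - K" for t k
    by (rule pd1_funpow_zero[OF oT _ that], rule van, assumption)+
  let ?E = "\<lambda>t. - (s (t, 0) * stress I \<gamma> t / (9 * fA (t, 0) ^ 6)) * vw (t, 0)"
  have J: "t \<in> I" "(t, 0) \<in> vdom I \<epsilon>" "fA (t, 0) \<noteq> 0" "(t, 0) \<in> W" if "t \<in> {c..d}" for t
    using that cd nz[OF that] fub_base(1)[of t] in_vdom0[of t] by (auto simp: W_def)
  have fvar: "pd2 fA q = (pd1 ^^ 0) vv q * (pd1 ^^ 1) fA q + 3 * (pd1 ^^ 1) vv q * (pd1 ^^ 0) fA q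
     + (8/3 * (pd1 ^^ 0) fB q * (pd1 ^^ 1) fB q + 1/3 * (pd1 ^^ 3) fB q) * (pd1 ^^ 0) vw q
     + (8/3 * (pd1 ^^ 0) fB q ^ 2 + 3/2 * (pd1 ^^ 2) fB q) * (pd1 ^^ 1) vw q
     + 5/2 * (pd1 ^^ 1) fB q * (pd1 ^^ 2) vw q + 5/3 * (pd1 ^^ 0) fB q * (pd1 ^^ 3) vw q
     + 1/6 * (pd1 ^^ 5) vw q" if "q \<in> vdom I \<epsilon>" for q
    using first_variation_fA[OF that] by (simp add: eval_nat_numeral)
  have s'0: "s' (t, 0) = 0" if "t \<in> {c..d} - K" for t
  proof -
    have "t \<in> I - K" using that cd by auto
    then have "pd2 fA (t, 0) = 0" unfolding fvar[OF J(2)[OF DiffD1[OF that]]] vank[OF \<open>t \<in> I - K\<close>] by simp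
    then show ?thesis by (simp add: s'_def)
  qed
  obtain B where B: "\<And>t. t \<in> {c..d} \<Longrightarrow> (B has_real_derivative s' (t, 0) - ?E t) (at t)"
    and B0: "\<And>t. t \<in> {c..d} \<Longrightarrow> (\<And>k. (pd1 ^^ k) vw (t, 0) = 0) \<Longrightarrow> (pd1 ^^ 0) vv (t, 0) = 0 \<Longrightarrow> B t = 0"
  proof (rule variation_boundary_term[where J = "{c..d}" and a = "\<lambda>k r. (pd1 ^^ k) fA (r, 0)"
        and b = "\<lambda>k r. (pd1 ^^ k) fB (r, 0)" and v = "\<lambda>k r. (pd1 ^^ k) vv (r, 0)"
        and w = "\<lambda>k r. (pd1 ^^ k) vw (r, 0)" and S = "\<lambda>r. s (r, 0)"])
    fix k t assume t: "t \<in> {c..d}"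
    show "((\<lambda>r. (pd1 ^^ k) fA (r, 0)) has_real_derivative (pd1 ^^ Suc k) fA (t, 0)) (at t)"
      "((\<lambda>r. (pd1 ^^ k) fB (r, 0)) has_real_derivative (pd1 ^^ Suc k) fB (t, 0)) (at t)"
      "((\<lambda>r. (pd1 ^^ k) vv (r, 0)) has_real_derivative (pd1 ^^ Suc k) vv (t, 0)) (at t)"
      "((\<lambda>r. (pd1 ^^ k) vw (r, 0)) has_real_derivative (pd1 ^^ Suc k) vw (t, 0)) (at t)"
      by (intro pd1_funpow_DERIV[OF smooth_fA J(2)[OF t]] pd1_funpow_DERIV[OF smooth_fB J(2)[OF t]]
         pd1_funpow_DERIV[OF smooth_vv J(2)[OF t]] pd1_funpow_DERIV[OF smooth_vw J(2)[OF t]])+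
  next
    fix t assume t: "t \<in> {c..d}"
    show "(pd1 ^^ 0) fA (t, 0) \<noteq> 0" using J(3)[OF t] by simp
    show "((\<lambda>r. s (r, 0)) has_real_derivative s (t, 0) * (pd1 ^^ 1) fA (t, 0) / (3 * (pd1 ^^ 0) fA (t, 0))) (at t)"
      using DERIV_root3_abs[OF pd1_funpow_DERIV[OF smooth_fA J(2)[OF t], of 0]] J(3)[OF t] by (simp add: s_def)
  next
    fix B
    assume 1: "\<And>t. t \<in> {c..d} \<Longrightarrow> (B has_real_derivative
       s (t, 0) / (3 * (pd1 ^^ 0) fA (t, 0)) * ((pd1 ^^ 0) vv (t, 0) * (pd1 ^^ 1) fA (t, 0) + 3 * (pd1 ^^ 1) vv (t, 0) * (pd1 ^^ 0) fA (t, 0)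
         + (8/3 * (pd1 ^^ 0) fB (t, 0) * (pd1 ^^ 1) fB (t, 0) + 1/3 * (pd1 ^^ 3) fB (t, 0)) * (pd1 ^^ 0) vw (t, 0)
         + (8/3 * (pd1 ^^ 0) fB (t, 0) ^ 2 + 3/2 * (pd1 ^^ 2) fB (t, 0)) * (pd1 ^^ 1) vw (t, 0)
         + 5/2 * (pd1 ^^ 1) fB (t, 0) * (pd1 ^^ 2) vw (t, 0) + 5/3 * (pd1 ^^ 0) fB (t, 0) * (pd1 ^^ 3) vw (t, 0)
         + 1/6 * (pd1 ^^ 5) vw (t, 0))
       + s (t, 0) * stress_poly (\<lambda>k. (pd1 ^^ k) fA (t, 0)) (\<lambda>k. (pd1 ^^ k) fB (t, 0)) / (9 * (pd1 ^^ 0) fA (t, 0) ^ 6) * (pd1 ^^ 0) vw (t, 0)) (at t)"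
      and 2: "\<And>t. t \<in> {c..d} \<Longrightarrow> (\<And>k. (pd1 ^^ k) vw (t, 0) = 0) \<Longrightarrow> (pd1 ^^ 0) vv (t, 0) = 0 \<Longrightarrow> B t = 0"
    show ?thesis
    proof (rule that[OF _ 2])
      fix t assume t: "t \<in> {c..d}"
      from 1[OF t] show "(B has_real_derivative s' (t, 0) - ?E t) (at t)"
        unfolding fvar[OF J(2)[OF t], symmetric] stress_base[OF J(1)[OF t], symmetric]
        by (simp add: s'_def)
    qed
  qed
  have ends: "c \<in> {c..d}" "d \<in> {c..d}" "c \<in> I - K" "d \<in> I - K" using Kcd cd by auto
  have Bcd: "B c = 0" "B d = 0"
    using B0[OF ends(1) vank(1)[OF ends(3)] vank(2)[OF ends(3)]] B0[OF ends(2) vank(1)[OF ends(4)] vank(2)[OF ends(4)]] by auto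
  have "((\<lambda>t. s' (t, 0) - ?E t) has_integral (B d - B c)) {c..d}"
    by (rule fundamental_theorem_of_calculus[OF cd(2)])
       (use B in \<open>auto simp: has_real_derivative_iff_has_vector_derivative intro: has_vector_derivative_at_within\<close>)
  then have hi0: "((\<lambda>t. s' (t, 0) - ?E t) has_integral 0) {c..d}" by (simp add: Bcd)
  have "continuous_on {c..d} (\<lambda>t. s' (t, 0))"
    by (intro continuous_on_compose2[OF cs'] continuous_intros) (use J(4) in auto)
  then have hs: "((\<lambda>t. s' (t, 0)) has_integral integral {c..d} (\<lambda>t. s' (t, 0))) {c..d}"
    by (intro integrable_integral integrable_continuous_interval)
  from has_integral_diff[OF hs hi0]
  have "(?E has_integral integral {c..d} (\<lambda>t. s' (t, 0))) {c..d}" by simp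
  then have "integral {c..d} (\<lambda>t. s' (t, 0)) = integral {c..d} ?E" by (rule integral_unique[symmetric])
  moreover have "integral K (\<lambda>t. s' (t, 0)) = integral {c..d} (\<lambda>t. s' (t, 0))"
  proof -
    have "integral {c..d} (\<lambda>t. s' (t, 0)) = integral {c..d} (\<lambda>t. if t \<in> K then s' (t, 0) else 0)"
      by (intro integral_cong) (use s'0 in auto)
    also have "\<dots> = integral ({c..d} \<inter> K) (\<lambda>t. s' (t, 0))"
      by (simp add: Henstock_Kurzweil_Integration.integral_restrict_Int Int_commute)
    also have "{c..d} \<inter> K = K" using Kcd by auto
    finally show ?thesis by simp
  qed
  ultimately show ?thesis using D2 by (simp add: s_def)
qed

end

section \<open>Variations with prescribed contact Hamiltonian\<close>

lemma power_le_fact_exp: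
  fixes x :: real assumes "x \<ge> 0"
  shows "x ^ n \<le> fact n * exp x"
proof -
  have "sum (\<lambda>n. x ^ n /\<^sub>R fact n) {n} \<le> (\<Sum>n. x ^ n /\<^sub>R fact n)"
    by (rule sum_le_suminf[OF summable_exp_generic]) (use assms in auto)
  then have "x ^ n / fact n \<le> exp x" by (simp add: exp_def divide_inverse mult.commute)
  then show ?thesis by (simp add: field_simps)
qed

text \<open>The negative powers make the span of this family closed under differentiation, so
  smoothness of all members is a single induction.\<close>

definition flat :: "nat \<Rightarrow> real \<Rightarrow> real" where
  "flat k x = (if x > 0 then inverse x ^ k * exp (- inverse x) else 0)"

text \<open>Quadratic decay makes the difference quotient at 0 tend to 0.\<close>

lemma flat_bound: "\<bar>flat k x\<bar> \<le> fact (k + 2) * x\<^sup>2"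
proof (cases "x > 0")
  case True
  have "inverse x ^ (k + 2) * exp (- inverse x) \<le> fact (k + 2)"
    using power_le_fact_exp[of "inverse x" "k + 2"] True by (simp add: exp_minus field_simps)
  then have "inverse x ^ (k + 2) * exp (- inverse x) * x\<^sup>2 \<le> fact (k + 2) * x\<^sup>2"
    by (rule mult_right_mono) simp
  moreover have "inverse x ^ (k + 2) * exp (- inverse x) * x\<^sup>2 = flat k x"
    using True by (simp add: flat_def power_add field_simps power2_eq_square)
  moreover have "flat k x \<ge> 0" using True by (simp add: flat_def)
  ultimately show ?thesis by simp
qed (simp add: flat_def)

lemma flat_deriv: "(flat k has_real_derivative flat (k + 2) x - real k * flat (k + 1) x) (at x)"
proof (cases "x = 0")
  case False
  show ?thesis
  proof (cases "x > 0")
    case True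
    have "((\<lambda>x. inverse x ^ k * exp (- inverse x)) has_real_derivative flat (k + 2) x - real k * flat (k + 1) x) (at x)"
    proof -
      have "((\<lambda>x. inverse x ^ k * exp (- inverse x)) has_real_derivative
         real k * (- (inverse x)\<^sup>2 * inverse x ^ (k - Suc 0)) * exp (- inverse x) + exp (- inverse x) * (inverse x)\<^sup>2 * inverse x ^ k) (at x)"
        using True by (auto intro!: derivative_eq_intros simp: power2_eq_square)
      moreover have e: "real k * (- (inverse x)\<^sup>2 * inverse x ^ (k - Suc 0)) = - real k * inverse x ^ (k + 1)"
        by (cases k) (simp_all add: power2_eq_square algebra_simps)
      have "real k * (- (inverse x)\<^sup>2 * inverse x ^ (k - Suc 0)) * exp (- inverse x) + exp (- inverse x) * (inverse x)\<^sup>2 * inverse x ^ k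
          = flat (k + 2) x - real k * flat (k + 1) x"
        unfolding e using True by (simp add: flat_def power_add power2_eq_square algebra_simps)
      ultimately show ?thesis by metis
    qed
    then show ?thesis
      by (rule has_field_derivative_transform_within_open[of _ _ _ "{0<..}"]) (use True in \<open>auto simp: flat_def\<close>)
  next
    case neg: False
    have "((\<lambda>x. 0) has_real_derivative 0) (at x)" by simp
    then have "(flat k has_real_derivative 0) (at x)"
      by (rule has_field_derivative_transform_within_open[of _ _ _ "{..<0}"]) (use neg False in \<open>auto simp: flat_def\<close>)
    then show ?thesis using neg by (simp add: flat_def)
  qed
next
  case True
  have "((\<lambda>h. (flat k (0 + h) - flat k 0) / h) \<longlongrightarrow> 0) (at 0)"
  proof (rule Lim_null_comparison)
    show "\<forall>\<^sub>F h in at 0. norm ((flat k (0 + h) - flat k 0) / h) \<le> fact (k + 2) * \<bar>h\<bar>"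
    proof (rule eventually_at_filter[THEN iffD2, OF always_eventually], intro allI impI)
      fix h :: real assume "h \<noteq> 0"
      have "\<bar>flat k h\<bar> \<le> fact (k + 2) * \<bar>h\<bar> * \<bar>h\<bar>" using flat_bound[of k h] by (simp add: power2_eq_square mult.assoc)
      then have "\<bar>flat k h\<bar> / \<bar>h\<bar> \<le> fact (k + 2) * \<bar>h\<bar>" using \<open>h \<noteq> 0\<close> by (simp add: divide_le_eq)
      then show "norm ((flat k (0 + h) - flat k 0) / h) \<le> fact (k + 2) * \<bar>h\<bar>" by (simp add: flat_def[of _ 0])
    qed
    have "((\<lambda>h::real. fact (k + 2) * \<bar>h\<bar>) \<longlongrightarrow> fact (k + 2) * \<bar>0\<bar>) (at 0)" by (intro tendsto_intros)
    then show "((\<lambda>h::real. fact (k + 2) * \<bar>h\<bar>) \<longlongrightarrow> 0) (at 0)" by simp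
  qed
  then show ?thesis using True by (simp add: DERIV_def flat_def)
qed

lemma smooth_flat: "smooth_on1 UNIV (flat k)"
proof -
  have "Ck n UNIV (\<lambda>q::real \<times> real. flat k (fst q))" for n
  proof (induction n arbitrary: k)
    case 0
    have "continuous_on UNIV (flat k)"
      using flat_deriv DERIV_isCont continuous_at_imp_continuous_on by blast
    then show ?case by (auto intro!: continuous_on_compose2[of UNIV "flat k"] continuous_intros)
  next
    case (Suc n)
    have "has_partials UNIV (\<lambda>q::real \<times> real. flat k (fst q)) (\<lambda>q. flat (k + 2) (fst q) + (- real k) *\<^sub>R flat (k + 1) (fst q)) (\<lambda>q. 0)"
      using flat_deriv[of k] by (auto simp: has_partials_def has_real_derivative_iff_has_vector_derivative)
    moreover have "Ck n UNIV (\<lambda>q::real \<times> real. flat (k + 2) (fst q) + (- real k) *\<^sub>R flat (k + 1) (fst q))"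
      by (intro Ck_add Suc.IH Ck_bounded_linear[OF bounded_linear_scaleR_right])
    ultimately show ?case using Ck_continuous[OF Suc.IH[of k]] Ck_const[of n UNIV 0] by auto
  qed
  then show ?thesis
    using smooth_on1_iff_fst[of UNIV UNIV "flat k"] by (simp add: smooth_on2_iff_Ck)
qed

lemma smooth_on1_affine:
  fixes f :: "real \<Rightarrow> real"
  assumes "smooth_on1 UNIV f"
  shows "smooth_on1 UNIV (\<lambda>t. f (\<alpha> * t + \<beta>))"
proof -
  have d: "((\<lambda>t. \<alpha> ^ n * (vd ^^ n) f (\<alpha> * t + \<beta>)) has_vector_derivative \<alpha> ^ Suc n * (vd ^^ Suc n) f (\<alpha> * t + \<beta>)) (at t)" for n t
  proof -
    have "((vd ^^ n) f has_vector_derivative (vd ^^ Suc n) f (\<alpha> * t + \<beta>)) (at (\<alpha> * t + \<beta>))"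
      using assms unfolding smooth_on1_def by (simp add: vd_def vector_derivative_works[symmetric])
    then have "((vd ^^ n) f has_real_derivative (vd ^^ Suc n) f (\<alpha> * t + \<beta>)) (at (\<alpha> * t + \<beta>))"
      by (simp add: has_real_derivative_iff_has_vector_derivative)
    then have "((\<lambda>t. (vd ^^ n) f (\<alpha> * t + \<beta>)) has_real_derivative (vd ^^ Suc n) f (\<alpha> * t + \<beta>) * \<alpha>) (at t)"
      by (rule DERIV_chain2) (auto intro!: derivative_eq_intros)
    from DERIV_cmult[OF this, of "\<alpha> ^ n"] show ?thesis
      by (simp add: has_real_derivative_iff_has_vector_derivative mult_ac)
  qed
  have *: "(vd ^^ n) (\<lambda>t. f (\<alpha> * t + \<beta>)) = (\<lambda>t. \<alpha> ^ n * (vd ^^ n) f (\<alpha> * t + \<beta>))" for n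
  proof (induction n)
    case (Suc n)
    have "vd (\<lambda>t. \<alpha> ^ n * (vd ^^ n) f (\<alpha> * t + \<beta>)) t = \<alpha> ^ Suc n * (vd ^^ Suc n) f (\<alpha> * t + \<beta>)" for t
      unfolding vd_def[of "\<lambda>t. \<alpha> ^ n * (vd ^^ n) f (\<alpha> * t + \<beta>)"] by (rule vector_derivative_at[OF d])
    then show ?case by (simp only: funpow.simps o_apply Suc fun_eq_iff) simp
  qed simp
  show ?thesis unfolding smooth_on1_def * by (intro allI ballI differentiableI_vector[OF d])
qed

lemma smooth_on1_via2:
  assumes "open U" "smooth_on2 (U \<times> UNIV) (\<lambda>q. f (fst q))"
  shows "smooth_on1 U f"
  using smooth_on1_iff_fst[OF assms(1) open_UNIV, of f] assms(2) by simp

lemma smooth_on2_of1: "open U \<Longrightarrow> smooth_on1 U f \<Longrightarrow> smooth_on2 (U \<times> UNIV) (\<lambda>q. f (fst q))"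
  by (rule smooth_on2_fst) auto

lemma bump_function:
  fixes c d :: real
  obtains f where "smooth_on1 UNIV f" "\<And>t. t \<in> {c<..<d} \<Longrightarrow> f t > 0" "\<And>t. t \<notin> {c<..<d} \<Longrightarrow> f t = (0::real)"
proof -
  define f where "f t = flat 0 (1 * t + - c) * flat 0 (- 1 * t + d)" for t
  have "smooth_on2 (UNIV \<times> UNIV) (\<lambda>q. f (fst q))"
    unfolding f_def
    by (intro smooth_on2_mult smooth_on2_of1[OF open_UNIV smooth_on1_affine[OF smooth_flat]]) (auto simp: open_Times)
  then have "smooth_on1 UNIV f" by (rule smooth_on1_via2[OF open_UNIV])
  moreover have "f t > 0" if "t \<in> {c<..<d}" for t using that by (simp add: f_def flat_def)
  moreover have "f t = 0" if "t \<notin> {c<..<d}" for t using that by (auto simp: f_def flat_def)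
  ultimately show ?thesis using that by blast
qed

lemma smooth_on1_subset: "smooth_on1 U f \<Longrightarrow> V \<subseteq> U \<Longrightarrow> smooth_on1 V f"
  by (auto simp: smooth_on1_def)

lemma smooth_on1_Un: "smooth_on1 U f \<Longrightarrow> smooth_on1 V f \<Longrightarrow> smooth_on1 (U \<union> V) f"
  by (auto simp: smooth_on1_def)

lemma smooth_on1_cong:
  assumes "open U" "\<And>t. t \<in> U \<Longrightarrow> f t = g t" "smooth_on1 U f"
  shows "smooth_on1 U g"
proof (rule smooth_on1_via2[OF assms(1)])
  show "smooth_on2 (U \<times> UNIV) (\<lambda>q. g (fst q))"
    by (rule smooth_on2_cong[OF _ _ smooth_on2_of1[OF assms(1,3)]]) (use assms in \<open>auto simp: open_Times\<close>)
qed

lemma smooth_on1_const: "open U \<Longrightarrow> smooth_on1 U (\<lambda>t. c)"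
  by (rule smooth_on1_via2) (auto intro!: smooth_on2_const open_Times)

lemma smooth_on1_antiderivative:
  fixes k :: "real \<Rightarrow> real"
  assumes "smooth_on1 UNIV k" "\<And>t. t < c \<Longrightarrow> k t = 0"
  obtains h where "smooth_on1 UNIV h" "\<And>t. (h has_vector_derivative k t) (at t)"
proof -
  have ck: "continuous_on S k" for S
    using smooth_on1_has_vd[OF assms(1)] has_vector_derivative_continuous continuous_at_imp_continuous_on by blast
  \<comment> \<open>The base point lies where \<open>k\<close> vanishes. For
    \<open>t < c - 1\<close> the integral is over an empty interval and is 0, in agreement with
    \<open>k\<close> vanishing there.\<close>
  define h where "h t = integral {c - 1..t} k" for t
  have dh: "(h has_vector_derivative k t) (at t)" for t
  proof (cases "t < c")
    case True
    have "((\<lambda>t. 0) has_vector_derivative 0) (at t)" by simp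
    then have "(h has_vector_derivative 0) (at t)"
    proof (rule has_vector_derivative_transform_within_open[of _ _ _ "{..<c}"])
      fix r assume "r \<in> {..<c}"
      then have "integral {c - 1..r} k = integral {c - 1..r} (\<lambda>t. 0)" by (intro integral_cong) (use assms(2) in auto)
      then show "0 = h r" by (simp add: h_def)
    qed (use True in auto)
    then show ?thesis using assms(2)[OF True] by simp
  next
    case False
    have "(h has_vector_derivative k t) (at t within {c - 1..t + 1})"
      unfolding h_def[abs_def] by (rule integral_has_vector_derivative[OF ck]) (use False in auto)
    then show ?thesis using at_within_interior[of t "{c - 1..t + 1}"] False by simp
  qed
  have "Ck n (UNIV \<times> UNIV) (\<lambda>q::real \<times> real. h (fst q))" for n
  proof -
    have "continuous_on UNIV h"
      using dh has_vector_derivative_continuous continuous_at_imp_continuous_on by blast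
    then have c: "continuous_on (UNIV \<times> UNIV) (\<lambda>q::real \<times> real. h (fst q))"
      by (auto intro!: continuous_on_compose2[of UNIV h] continuous_intros)
    have "has_partials (UNIV \<times> UNIV) (\<lambda>q. h (fst q)) (\<lambda>q. k (fst q)) (\<lambda>q. 0)"
      using dh by (auto simp: has_partials_def)
    moreover have "Ck m (UNIV \<times> UNIV) (\<lambda>q::real \<times> real. k (fst q))" for m
      using smooth_on2_of1[OF open_UNIV assms(1)] by (simp add: smooth_on2_iff_Ck open_Times)
    ultimately show ?thesis using c Ck_const[of _ "UNIV \<times> UNIV" 0] by (cases n) auto
  qed
  then have "smooth_on1 UNIV h"
    by (intro smooth_on1_via2[OF open_UNIV]) (simp add: smooth_on2_iff_Ck open_Times)
  with dh that show ?thesis by blast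
qed

lemma smooth_on2_snd: "smooth_on2 U snd"
proof -
  have "Ck n UNIV (snd :: real \<times> real \<Rightarrow> real)" for n
  proof (cases n)
    case (Suc m)
    have "has_partials UNIV (snd :: real \<times> real \<Rightarrow> real) (\<lambda>q. 0) (\<lambda>q. 1)"
      by (auto simp: has_partials_def has_real_derivative_iff_has_vector_derivative[symmetric])
    then show ?thesis using Suc Ck_const[of m UNIV 0] Ck_const[of m UNIV 1] by (auto intro: continuous_intros)
  qed (auto intro: continuous_intros)
  then show ?thesis using smooth_on2_subset[of UNIV snd U] by (simp add: smooth_on2_iff_Ck)
qed

text \<open>In the chart \<open>z = (p, p \<zeta>, p (u + \<i> \<bar>\<zeta>\<bar>\<^sup>2 / 2))\<close> a Legendrian curve is a plane curve \<open>\<zeta>\<close> together with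
  \<open>u' = - Im (cnj \<zeta> \<zeta>')\<close>. Varying \<open>\<zeta> + \<tau> \<eta>\<close> with \<open>\<eta> = \<i> f' / (2 cnj \<zeta>')\<close> keeps \<open>u\<close> compactly supported
  to first order and has contact Hamiltonian \<open>f\<close>; \<open>\<xi>\<close> is \<open>cnj \<zeta> \<eta>\<close> and \<open>h\<close> is the second order part of \<open>u\<close>.\<close>

lemma variation_lift_null:
  fixes p z2 z3 \<eta> \<xi> :: complex and f h \<tau> :: real and G :: cvec
  assumes n: "\<i> * (cnj p * z3 - cnj z3 * p) + cnj z2 * z2 = 0"
    and R1: "cnj z2 * \<eta> = cnj p * \<xi>"
    and G: "G$1 = p" "G$2 = z2 + \<tau> * (p * \<eta>)" "G$3 = z3 + \<tau> * (p * (f + \<i> * \<xi>)) + \<tau>\<^sup>2 * (p * (h + \<i> * (cnj \<eta> * \<eta> / 2)))"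
  shows "hform G G = 0"
proof -
  have R1': "z2 * cnj \<eta> = p * cnj \<xi>" using arg_cong[OF R1, of cnj] by simp
  have "hform G G = (\<i> * (cnj p * z3 - cnj z3 * p) + cnj z2 * z2)
     + \<tau> * p * (cnj z2 * \<eta> - cnj p * \<xi>) + \<tau> * cnj p * (z2 * cnj \<eta> - p * cnj \<xi>)"
    unfolding hform_def G by (simp add: algebra_simps power2_eq_square)
  then show ?thesis using n R1 R1' by simp
qed

text \<open>The relations for \<open>\<eta>\<close> and \<open>\<xi>\<close> are cleared of the
  denominator \<open>p\<close>, so they make sense where \<open>p\<close> vanishes and the chart
  fails. \<open>R1\<close>, \<open>R1'\<close> and \<open>R2\<close> cancel the coefficient of
  \<open>\<tau>\<close>; the choice of \<open>h'\<close> cancels that of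
  \<open>\<tau>\<^sup>2\<close>.\<close>

lemma variation_lift_legendrian:
  fixes p z2 z3 p' z2' z3' \<eta> \<xi> \<eta>' \<xi>' :: complex and f h f' h' \<tau> :: real and G G' :: cvec
  assumes n: "\<i> * (cnj p * z3' - cnj z3 * p') + cnj z2 * z2' = 0"
    and R1: "cnj z2 * \<eta> = cnj p * \<xi>"
    and R1': "cnj z2' * \<eta> + cnj z2 * \<eta>' = cnj p' * \<xi> + cnj p * \<xi>'"
    and R2: "cnj z2' * \<eta> = cnj p' * \<xi> + cnj p * (\<i> * f' / 2)"
    and h': "h' = - Im (cnj \<eta> * \<eta>')"
    and G: "G$1 = p" "G$2 = z2 + \<tau> * (p * \<eta>)" "G$3 = z3 + \<tau> * (p * (f + \<i> * \<xi>)) + \<tau>\<^sup>2 * (p * (h + \<i> * (cnj \<eta> * \<eta> / 2)))"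
    and G': "G'$1 = p'" "G'$2 = z2' + \<tau> * (p' * \<eta> + p * \<eta>')"
      "G'$3 = z3' + \<tau> * (p' * (f + \<i> * \<xi>) + p * (f' + \<i> * \<xi>'))
        + \<tau>\<^sup>2 * (p' * (h + \<i> * (cnj \<eta> * \<eta> / 2)) + p * (h' + \<i> * ((cnj \<eta>' * \<eta> + cnj \<eta> * \<eta>') / 2)))"
  shows "hform G G' = 0"
proof -
  have R2': "z2' * cnj \<eta> = p' * cnj \<xi> - p * (\<i> * f' / 2)" using arg_cong[OF R2, of cnj] by simp
  have R3: "cnj z2 * \<eta>' = cnj p * \<xi>' - cnj p * (\<i> * f' / 2)" using R1' R2 by (simp add: algebra_simps)
  have h2: "2 * \<i> * complex_of_real h' = cnj \<eta>' * \<eta> - cnj \<eta> * \<eta>'"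
    unfolding h' by (simp add: complex_eq_iff)
  have "hform G G' = (\<i> * (cnj p * z3' - cnj z3 * p') + cnj z2 * z2')
     + \<tau> * (cnj p * (z2' * cnj \<eta> - p' * cnj \<xi> + p * (\<i> * f' / 2)) + p' * (cnj z2 * \<eta> - cnj p * \<xi>)
             + p * (cnj z2 * \<eta>' - cnj p * \<xi>' + cnj p * (\<i> * f' / 2)))
     + \<tau>\<^sup>2 * (cnj p * p / 2 * (2 * \<i> * complex_of_real h' - (cnj \<eta>' * \<eta> - cnj \<eta> * \<eta>')))"
    unfolding hform_def G G' by (simp add: field_simps power2_eq_square)
  then show ?thesis unfolding n R1 R2' R3 h2 by simp
qed

lemma has_vector_derivative_nth:
  "(F has_vector_derivative F') (at t) \<Longrightarrow> ((\<lambda>r. (F r :: cvec) $ i) has_vector_derivative F' $ i) (at t)"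
  by (rule bounded_linear.has_vector_derivative[OF bounded_linear_vec_nth])

lemma has_vector_derivative_cnj':
  "(f has_vector_derivative f') (at t) \<Longrightarrow> ((\<lambda>r. cnj (f r)) has_vector_derivative cnj f') (at t)"
  by (rule bounded_linear.has_vector_derivative[OF bounded_linear_cnj])

lemma has_vector_derivative_cvec:
  fixes F :: "real \<Rightarrow> cvec"
  assumes "\<And>i. ((\<lambda>r. F r $ i) has_vector_derivative F' $ i) (at t)"
  shows "(F has_vector_derivative F') (at t)"
proof -
  have "((\<lambda>r. \<Sum>i\<in>UNIV. axis i (F r $ i)) has_vector_derivative (\<Sum>i\<in>UNIV. axis i (F' $ i))) (at t)"
    by (intro has_vector_derivative_sum bounded_linear.has_vector_derivative[OF bounded_linear_axis3] assms)
  then show ?thesis by (simp add: sum_axis3)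
qed

lemma has_vector_derivative_of_real: "((\<lambda>r. complex_of_real r) has_vector_derivative 1) (at t)"
  using bounded_linear.has_vector_derivative[OF bounded_linear_of_real has_vector_derivative_id[of "at t"]] by simp

text \<open>The plane curve \<open>\<zeta>\<close> is perturbed only where the chart is available.
  Off \<open>{c'..d'}\<close> the function \<open>h\<close> is locally constant but may be nonzero:
  the third coordinate is then shifted in proportion to \<open>\<tau>\<^sup>2\<close>, which does
  not enter the field at \<open>\<tau> = 0\<close>.\<close>

lemma bump_variation_exists:
  assumes I: "open I" "is_interval I" and F0: "framed_lift (vdom I 1) N"
    and lift0: "\<And>q. q \<in> vdom I 1 \<Longrightarrow> N q \<noteq> 0 \<and> \<gamma> (fst q) = proj (N q)"
    and cd: "c < c'" "c' \<le> d'" "d' < d" "{c..d} \<subseteq> I" and p0: "\<And>t. t \<in> {c..d} \<Longrightarrow> N (t, 0) $ 1 \<noteq> 0"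
    and sf: "smooth_on1 UNIV f" and f0: "\<And>t. t \<notin> {c'..d'} \<Longrightarrow> f t = (0::real)"
  obtains \<epsilon> g G where "\<epsilon> > 0" "smooth_variation_map I \<epsilon> g"
    "\<And>\<tau>. \<tau> \<in> {-\<epsilon><..<\<epsilon>} \<Longrightarrow> legendrian I (\<lambda>t. g (t, \<tau>))"
    "\<And>t. t \<in> I \<Longrightarrow> g (t, 0) = \<gamma> t" "local_lift2 (vdom I \<epsilon>) g G"
    "\<And>t. t \<in> I \<Longrightarrow> Im (hform (G (t, 0)) (pd2 G (t, 0))) = (cmod (N (t, 0) $ 1))\<^sup>2 * f t"
    "\<And>t. t \<in> I - {c'..d'} \<Longrightarrow> pd2 G (t, 0) = 0"
proof -
  interpret F0: framed_lift "vdom I 1" N by (rule F0)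
  define K0 where "K0 = {c'..d'}"
  have oK: "open (- K0)" by (auto simp: K0_def)
  define S where "S = {c<..<d}"
  have oS: "open S" and SI: "S \<subseteq> I" and KS: "K0 \<subseteq> S" using cd by (auto simp: S_def K0_def)
  have v0: "(t, 0) \<in> vdom I 1" if "t \<in> I" for t using that by (auto simp: vdom_def)
  define p z2 z3 where "p = (\<lambda>t. N (t, 0) $ 1)" and "z2 = (\<lambda>t. N (t, 0) $ 2)" and "z3 = (\<lambda>t. N (t, 0) $ 3)"
  define p' z2' z3' where "p' = (\<lambda>t. pd1 N (t, 0) $ 1)" and "z2' = (\<lambda>t. pd1 N (t, 0) $ 2)" and "z3' = (\<lambda>t. pd1 N (t, 0) $ 3)"
  have dN: "((\<lambda>r. N (r, 0) $ i) has_vector_derivative pd1 N (t, 0) $ i) (at t)" if "t \<in> I" for t i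
    by (rule has_vector_derivative_nth[OF smooth_on2_has_pd1[OF F0.smooth_N v0[OF that]]])
  have dp: "(p has_vector_derivative p' t) (at t)" and dz2: "(z2 has_vector_derivative z2' t) (at t)"
    and dz3: "(z3 has_vector_derivative z3' t) (at t)" if "t \<in> I" for t
    using dN[OF that] by (simp_all add: p_def p'_def z2_def z2'_def z3_def z3'_def)
  have sN: "smooth_on1 I (\<lambda>t. N (t, 0))" by (rule smooth_on1_slice[OF F0.smooth_N[unfolded vdom_def]]) auto
  define V where "V = I \<times> (UNIV :: real set)"
  have oV: "open V" using I(1) by (simp add: V_def open_Times)
  have sNV: "smooth_on2 V (\<lambda>q. N (fst q, 0))" using smooth_on2_of1[OF I(1) sN] by (simp add: V_def)
  have sp: "smooth_on2 V (\<lambda>q. p (fst q))" and sz2: "smooth_on2 V (\<lambda>q. z2 (fst q))" and sz3: "smooth_on2 V (\<lambda>q. z3 (fst q))"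
    unfolding p_def z2_def z3_def by (intro smooth_intros oV sNV)+
  have n0: "\<i> * (cnj (p t) * z3 t - cnj (z3 t) * p t) + cnj (z2 t) * z2 t = 0"
    and n1: "\<i> * (cnj (p t) * z3' t - cnj (z3 t) * p' t) + cnj (z2 t) * z2' t = 0" if "t \<in> I" for t
    using F0.null[OF v0[OF that]] F0.leg[OF v0[OF that]]
    by (simp_all add: hform_def p_def z2_def z3_def p'_def z2'_def z3'_def)
  have pS: "p t \<noteq> 0" if "t \<in> S" for t using p0[of t] that by (auto simp: p_def S_def)
  define \<zeta> where "\<zeta> t = z2 t / p t" for t
  have s\<zeta>: "smooth_on1 S \<zeta>"
  proof (rule smooth_on1_via2[OF oS])
    have sub: "S \<times> UNIV \<subseteq> V" using SI by (auto simp: V_def)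
    show "smooth_on2 (S \<times> UNIV) (\<lambda>q. \<zeta> (fst q))" unfolding \<zeta>_def
      by (intro smooth_on2_divide smooth_on2_subset[OF sz2 sub] smooth_on2_subset[OF sp sub]) (use pS oS in \<open>auto simp: open_Times\<close>)
  qed
  have d\<zeta>: "(\<zeta> has_vector_derivative vd \<zeta> t) (at t)" if "t \<in> S" for t by (rule smooth_on1_has_vd[OF s\<zeta> that])
  have z2\<zeta>: "z2' t = p' t * \<zeta> t + p t * vd \<zeta> t" if t: "t \<in> S" for t
  proof -
    have tI: "t \<in> I" using SI t by blast
    have "((\<lambda>r. p r * \<zeta> r) has_vector_derivative p t * vd \<zeta> t + p' t * \<zeta> t) (at t)"
      by (rule has_vector_derivative_mult[OF dp[OF tI] d\<zeta>[OF t]])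
    then have "(z2 has_vector_derivative p t * vd \<zeta> t + p' t * \<zeta> t) (at t)"
      by (rule has_vector_derivative_transform_within_open[OF _ oS t]) (use pS in \<open>auto simp: \<zeta>_def\<close>)
    then show ?thesis using dz2[OF tI] vector_derivative_unique_at by (metis add.commute)
  qed
  \<comment> \<open>Otherwise \<open>N'\<close> minus a multiple of \<open>N\<close> has only a
    third coordinate and is therefore null, against \<open>h11\<close>.\<close>
  have \<zeta>'0: "vd \<zeta> t \<noteq> 0" if t: "t \<in> S" for t
  proof
    assume z: "vd \<zeta> t = 0"
    have tI: "t \<in> I" using SI t by blast
    note q = v0[OF tI]
    define u where "u = pd1 N (t, 0) - (p' t / p t) *s N (t, 0)"
    have "u $ 1 = 0" using pS[OF t] by (simp add: u_def p_def p'_def)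
    moreover have "u $ 2 = 0"
      using z2\<zeta>[OF t] pS[OF t] z unfolding u_def \<zeta>_def by (simp add: z2_def z2'_def)
    ultimately have "hform u u = 0" by (simp add: hform_def)
    moreover have "hform u u = 1"
      unfolding u_def using F0.null[OF q] F0.leg[OF q] F0.leg'[OF q] F0.h11[OF q] by (simp add: hform_simps)
    ultimately show False by simp
  qed
  define f' where "f' = vd f"
  have sf': "smooth_on1 UNIV f'" unfolding f'_def by (rule smooth_on1_vd[OF sf])
  have df: "(f has_vector_derivative f' t) (at t)" for t unfolding f'_def by (rule smooth_on1_has_vd[OF sf]) simp
  have f'0: "f' t = 0" if "t \<notin> K0" for t
  proof -
    have "(f has_vector_derivative 0) (at t)"
      by (rule has_vector_derivative_transform_within_open[OF has_vector_derivative_const oK]) (use that f0 in \<open>auto simp: K0_def\<close>)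
    then show ?thesis using df vector_derivative_unique_at by blast
  qed
  \<comment> \<open>The formula for \<open>\<eta>\<close> has a meaning only on \<open>S\<close>.
    Since \<open>f'\<close> vanishes off \<open>K0\<close>, the cut-off does not alter it and gives
    a function smooth on the whole line.\<close>
  define \<eta> where "\<eta> t = (if t \<in> K0 then \<i> * f' t / (2 * cnj (vd \<zeta> t)) else 0)" for t
  define \<xi> where "\<xi> t = (if t \<in> K0 then cnj (\<zeta> t) * \<eta> t else 0)" for t
  have \<eta>S: "\<eta> t = \<i> * f' t / (2 * cnj (vd \<zeta> t))" "\<xi> t = cnj (\<zeta> t) * \<eta> t" for t
    using f'0[of t] by (auto simp: \<eta>_def \<xi>_def)
  have cover: "UNIV = S \<union> - K0" using KS by auto
  have oSU: "open (S \<times> (UNIV :: real set))" by (intro open_Times oS open_UNIV)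
  have s\<zeta>2: "smooth_on2 (S \<times> UNIV) (\<lambda>q. \<zeta> (fst q))" "smooth_on2 (S \<times> UNIV) (\<lambda>q. vd \<zeta> (fst q))"
    using smooth_on2_of1[OF oS s\<zeta>] smooth_on2_of1[OF oS smooth_on1_vd[OF s\<zeta>]] by auto
  have sf'2: "smooth_on2 (S \<times> UNIV) (\<lambda>q. f' (fst q))"
    by (rule smooth_on2_of1[OF oS smooth_on1_subset[OF sf']]) simp
  have s\<eta>S: "smooth_on2 (S \<times> UNIV) (\<lambda>q. \<eta> (fst q))"
    unfolding \<eta>S(1) by (intro smooth_intros oSU s\<zeta>2 sf'2) (use \<zeta>'0 in auto)
  have s\<eta>: "smooth_on1 UNIV \<eta>"
    unfolding cover
  proof (rule smooth_on1_Un)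
    show "smooth_on1 S \<eta>" by (rule smooth_on1_via2[OF oS s\<eta>S])
    show "smooth_on1 (- K0) \<eta>" by (rule smooth_on1_cong[OF oK _ smooth_on1_const[OF oK, of 0]]) (simp add: \<eta>_def)
  qed
  have s\<xi>: "smooth_on1 UNIV \<xi>"
    unfolding cover
  proof (rule smooth_on1_Un)
    have "smooth_on2 (S \<times> UNIV) (\<lambda>q. \<xi> (fst q))"
      unfolding \<eta>S(2) by (intro smooth_intros oSU s\<zeta>2 s\<eta>S)
    then show "smooth_on1 S \<xi>" by (rule smooth_on1_via2[OF oS])
    show "smooth_on1 (- K0) \<xi>" by (rule smooth_on1_cong[OF oK _ smooth_on1_const[OF oK, of 0]]) (simp add: \<xi>_def)
  qed
  define \<eta>' \<xi>' where "\<eta>' = vd \<eta>" and "\<xi>' = vd \<xi>"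
  have d\<eta>: "(\<eta> has_vector_derivative \<eta>' t) (at t)" and d\<xi>: "(\<xi> has_vector_derivative \<xi>' t) (at t)" for t
    unfolding \<eta>'_def \<xi>'_def by (rule smooth_on1_has_vd[OF s\<eta>] smooth_on1_has_vd[OF s\<xi>], simp)+
  have \<eta>'0: "\<eta>' t = 0" if "t \<notin> K0" for t
  proof -
    have "(\<eta> has_vector_derivative 0) (at t)"
      by (rule has_vector_derivative_transform_within_open[OF has_vector_derivative_const oK]) (use that in \<open>auto simp: \<eta>_def\<close>)
    then show ?thesis using d\<eta> vector_derivative_unique_at by blast
  qed
  have oUU: "open (UNIV \<times> (UNIV :: real set) :: (real \<times> real) set)" by (simp add: open_Times)
  have s\<eta>2: "smooth_on2 (UNIV \<times> UNIV) (\<lambda>q. \<eta> (fst q))" and s\<eta>'2: "smooth_on2 (UNIV \<times> UNIV) (\<lambda>q. \<eta>' (fst q))"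
    using smooth_on2_of1[OF open_UNIV s\<eta>] smooth_on2_of1[OF open_UNIV smooth_on1_vd[OF s\<eta>]] by (auto simp: \<eta>'_def)
  define h' where "h' t = - Im (cnj (\<eta> t) * \<eta>' t)" for t
  have "smooth_on2 (UNIV \<times> UNIV) (\<lambda>q. h' (fst q))"
    unfolding h'_def by (intro smooth_intros oUU s\<eta>2 s\<eta>'2)
  then have sh': "smooth_on1 UNIV h'" by (rule smooth_on1_via2[OF open_UNIV])
  have "h' t = 0" if "t < c'" for t using that by (simp add: h'_def \<eta>_def K0_def)
  then obtain h where sh: "smooth_on1 UNIV h" and dh: "\<And>t. (h has_vector_derivative h' t) (at t)"
    using smooth_on1_antiderivative[OF sh'] by blast
  have R1: "cnj (z2 t) * \<eta> t = cnj (p t) * \<xi> t" if "t \<in> I" for t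
  proof (cases "t \<in> K0")
    case True
    then show ?thesis using pS[of t] KS by (auto simp: \<xi>_def \<zeta>_def)
  qed (simp add: \<eta>_def \<xi>_def)
  have R1': "cnj (z2' t) * \<eta> t + cnj (z2 t) * \<eta>' t = cnj (p' t) * \<xi> t + cnj (p t) * \<xi>' t" if t: "t \<in> I" for t
  proof -
    have "((\<lambda>r. cnj (p r) * \<xi> r) has_vector_derivative cnj (p t) * \<xi>' t + cnj (p' t) * \<xi> t) (at t)"
      by (rule has_vector_derivative_mult[OF has_vector_derivative_cnj'[OF dp[OF t]] d\<xi>])
    moreover have "((\<lambda>r. cnj (z2 r) * \<eta> r) has_vector_derivative cnj (z2 t) * \<eta>' t + cnj (z2' t) * \<eta> t) (at t)"
      by (rule has_vector_derivative_mult[OF has_vector_derivative_cnj'[OF dz2[OF t]] d\<eta>])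
    then have "((\<lambda>r. cnj (p r) * \<xi> r) has_vector_derivative cnj (z2 t) * \<eta>' t + cnj (z2' t) * \<eta> t) (at t)"
      by (rule has_vector_derivative_transform_within_open[OF _ I(1) t]) (rule R1)
    ultimately show ?thesis using vector_derivative_unique_at by (metis add.commute)
  qed
  have R2: "cnj (z2' t) * \<eta> t = cnj (p' t) * \<xi> t + cnj (p t) * (\<i> * f' t / 2)" if "t \<in> I" for t
  proof (cases "t \<in> K0")
    case True
    then have t: "t \<in> S" using KS by blast
    have "cnj (vd \<zeta> t) * \<eta> t = \<i> * f' t / 2" using \<zeta>'0[OF t] by (simp add: \<eta>S(1))
    then show ?thesis unfolding z2\<zeta>[OF t] \<eta>S(2) by (simp add: algebra_simps)
  next
    case False
    then show ?thesis using f'0[OF False] by (simp add: \<eta>_def \<xi>_def)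
  qed
  \<comment> \<open>The perturbed plane curve has velocity
    \<open>\<zeta>' + \<tau> * \<eta>'\<close>; bounding \<open>\<eta>'\<close> by \<open>M\<close>
    times \<open>\<zeta>'\<close> keeps this nonzero for \<open>|\<tau>| < 1 / M\<close>.\<close>
  obtain M where M: "M > 0" "\<And>t. t \<in> K0 \<Longrightarrow> cmod (\<eta>' t) \<le> M * cmod (vd \<zeta> t)"
  proof -
    have "continuous_on S (vd \<zeta>)"
      using smooth_on1_has_vd[OF smooth_on1_vd[OF s\<zeta>]] has_vector_derivative_continuous continuous_at_imp_continuous_on by blast
    moreover have "continuous_on S \<eta>'"
      using smooth_on1_has_vd[OF smooth_on1_vd[OF s\<eta>]] has_vector_derivative_continuous continuous_at_imp_continuous_on
      unfolding \<eta>'_def by (metis UNIV_I)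
    ultimately have "continuous_on K0 (\<lambda>t. \<eta>' t / vd \<zeta> t)"
      using KS \<zeta>'0 by (intro continuous_intros) (auto intro: continuous_on_subset)
    then have "bounded ((\<lambda>t. \<eta>' t / vd \<zeta> t) ` K0)"
      by (intro compact_imp_bounded compact_continuous_image) (auto simp: K0_def)
    then obtain M where M: "M > 0" "\<forall>x\<in>(\<lambda>t. \<eta>' t / vd \<zeta> t) ` K0. norm x \<le> M" unfolding bounded_pos by blast
    have "cmod (\<eta>' t) \<le> M * cmod (vd \<zeta> t)" if "t \<in> K0" for t
    proof -
      have "cmod (\<eta>' t / vd \<zeta> t) \<le> M" using M(2) that by blast
      then show ?thesis using \<zeta>'0[of t] that KS by (simp add: norm_divide divide_le_eq subset_iff)
    qed
    with M(1) that show ?thesis by blast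
  qed
  define \<epsilon> where "\<epsilon> = 1 / M"
  have \<epsilon>0: "\<epsilon> > 0" using M(1) by (simp add: \<epsilon>_def)
  have imm: "vd \<zeta> t + \<tau> * \<eta>' t \<noteq> 0" if t: "t \<in> S" and \<tau>: "\<tau> \<in> {-\<epsilon><..<\<epsilon>}" for t \<tau>
  proof
    assume "vd \<zeta> t + \<tau> * \<eta>' t = 0"
    then have "vd \<zeta> t = - (\<tau> * \<eta>' t)" by (simp add: eq_neg_iff_add_eq_0)
    then have e: "cmod (vd \<zeta> t) = \<bar>\<tau>\<bar> * cmod (\<eta>' t)" by (simp add: norm_mult)
    show False
    proof (cases "t \<in> K0")
      case True
      have "\<bar>\<tau>\<bar> * M < 1" using \<tau> M(1) by (auto simp: \<epsilon>_def field_simps abs_if)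
      have "cmod (vd \<zeta> t) \<le> \<bar>\<tau>\<bar> * (M * cmod (vd \<zeta> t))" unfolding e[symmetric] using M(2)[OF True] e by (metis abs_ge_zero mult_left_mono)
      also have "\<dots> = (\<bar>\<tau>\<bar> * M) * cmod (vd \<zeta> t)" by simp
      also have "\<dots> < 1 * cmod (vd \<zeta> t)" using \<open>\<bar>\<tau>\<bar> * M < 1\<close> \<zeta>'0[OF t] by (intro mult_strict_right_mono) auto
      finally show False by simp
    next
      case False
      then show False using e \<eta>'0[OF False] \<zeta>'0[OF t] by simp
    qed
  qed
  \<comment> \<open>\<open>p * m\<close> and \<open>p * k\<close> are the coefficients of
    \<open>\<tau>\<close> and \<open>\<tau>\<^sup>2\<close> in the third coordinate of the lift
    \<open>G\<close>.\<close>
  define k where "k t = complex_of_real (h t) + \<i> * (cnj (\<eta> t) * \<eta> t / 2)" for t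
  define k' where "k' t = complex_of_real (h' t) + \<i> * ((cnj (\<eta>' t) * \<eta> t + cnj (\<eta> t) * \<eta>' t) / 2)" for t
  define m where "m t = complex_of_real (f t) + \<i> * \<xi> t" for t
  define m' where "m' t = complex_of_real (f' t) + \<i> * \<xi>' t" for t
  define G :: "real \<times> real \<Rightarrow> cvec" where "G q = vector [p (fst q),
     z2 (fst q) + complex_of_real (snd q) * (p (fst q) * \<eta> (fst q)),
     z3 (fst q) + complex_of_real (snd q) * (p (fst q) * m (fst q)) + (complex_of_real (snd q))\<^sup>2 * (p (fst q) * k (fst q))]" for q
  define G' :: "real \<times> real \<Rightarrow> cvec" where "G' q = vector [p' (fst q),
     z2' (fst q) + complex_of_real (snd q) * (p' (fst q) * \<eta> (fst q) + p (fst q) * \<eta>' (fst q)),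
     z3' (fst q) + complex_of_real (snd q) * (p' (fst q) * m (fst q) + p (fst q) * m' (fst q))
      + (complex_of_real (snd q))\<^sup>2 * (p' (fst q) * k (fst q) + p (fst q) * k' (fst q))]" for q
  have sV: "smooth_on2 V (\<lambda>q. F (fst q))" if "smooth_on1 UNIV F" for F :: "real \<Rightarrow> 'z::real_normed_vector"
    using smooth_on2_of1[OF I(1) smooth_on1_subset[OF that]] by (simp add: V_def)
  have skm: "smooth_on2 V (\<lambda>q. k (fst q))" "smooth_on2 V (\<lambda>q. m (fst q))"
    unfolding k_def m_def by (intro smooth_intros oV sV[OF s\<eta>] sV[OF sh] sV[OF s\<xi>] sV[OF sf]; simp)+
  have sG: "smooth_on2 V G"
  proof (rule smooth_on2_vec[OF oV])
    have 1: "smooth_on2 V (\<lambda>q. G q $ 1)" unfolding G_def vector_3 by (rule sp)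
    have 2: "smooth_on2 V (\<lambda>q. G q $ 2)" unfolding G_def vector_3
      by (intro smooth_intros oV sp sz2 sV[OF s\<eta>] smooth_on2_snd)
    have 3: "smooth_on2 V (\<lambda>q. G q $ 3)" unfolding G_def vector_3
      by (intro smooth_intros oV sp sz3 skm smooth_on2_snd)
    show "smooth_on2 V (\<lambda>q. G q $ i)" for i using exhaust_3[of i] 1 2 3 by auto
  qed
  have subV: "vdom I \<epsilon> \<subseteq> V" by (auto simp: vdom_def V_def)
  have dofr: "((\<lambda>r. complex_of_real (F r)) has_vector_derivative complex_of_real F') (at t)"
    if "(F has_vector_derivative F') (at t)" for F F' t
    by (rule bounded_linear.has_vector_derivative[OF bounded_linear_of_real that])
  have dk: "(k has_vector_derivative k' t) (at t)" for t
    unfolding k_def[abs_def] k'_def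
    by (rule has_vector_derivative_eq_rhs, (rule has_vector_derivative_add has_vector_derivative_mult has_vector_derivative_divide
          has_vector_derivative_const dofr[OF dh] has_vector_derivative_cnj'[OF d\<eta>] d\<eta>)+) (simp add: algebra_simps)
  have dm: "(m has_vector_derivative m' t) (at t)" for t
    unfolding m_def[abs_def] m'_def
    by (rule has_vector_derivative_eq_rhs, (rule has_vector_derivative_add has_vector_derivative_mult
          has_vector_derivative_const dofr[OF df] d\<xi>)+) simp
  have dG: "((\<lambda>r. G (r, \<tau>)) has_vector_derivative G' (t, \<tau>)) (at t)" if t: "t \<in> I" for t \<tau>
  proof (rule has_vector_derivative_cvec)
    have 1: "((\<lambda>r. G (r, \<tau>) $ 1) has_vector_derivative G' (t, \<tau>) $ 1) (at t)"
      unfolding G_def G'_def vector_3 fst_conv by (rule dp[OF t])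
    have 2: "((\<lambda>r. G (r, \<tau>) $ 2) has_vector_derivative G' (t, \<tau>) $ 2) (at t)"
      unfolding G_def G'_def vector_3 fst_conv snd_conv
      by (rule has_vector_derivative_eq_rhs, (rule has_vector_derivative_add has_vector_derivative_mult
          has_vector_derivative_const dp[OF t] dz2[OF t] d\<eta>)+) (simp add: algebra_simps)
    have 3: "((\<lambda>r. G (r, \<tau>) $ 3) has_vector_derivative G' (t, \<tau>) $ 3) (at t)"
      unfolding G_def G'_def vector_3 fst_conv snd_conv
      by (rule has_vector_derivative_eq_rhs, (rule has_vector_derivative_add has_vector_derivative_mult
          has_vector_derivative_const dp[OF t] dz3[OF t] dk dm)+) (simp add: algebra_simps)
    show "((\<lambda>r. G (r, \<tau>) $ i) has_vector_derivative G' (t, \<tau>) $ i) (at t)" for i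
      using exhaust_3[of i] 1 2 3 by auto
  qed
  have pdG: "pd1 G (t, \<tau>) = G' (t, \<tau>)" if "t \<in> I" for t \<tau>
    using vector_derivative_at[OF dG[OF that]] by (simp add: pd1_def)
  have pd2G: "pd2 G (t, 0) = vector [0, p t * \<eta> t, p t * m t]" for t
  proof -
    have dr: "((\<lambda>r. complex_of_real r * x) has_vector_derivative x) (at 0)"
      "((\<lambda>r. (complex_of_real r)\<^sup>2 * x) has_vector_derivative 0) (at 0)" for x
      unfolding power2_eq_square
      by (rule has_vector_derivative_eq_rhs, (rule has_vector_derivative_mult has_vector_derivative_const has_vector_derivative_of_real)+, simp)+
    have "((\<lambda>r. G (t, r)) has_vector_derivative vector [0, p t * \<eta> t, p t * m t]) (at 0)"
    proof (rule has_vector_derivative_cvec)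
      have 1: "((\<lambda>r. G (t, r) $ 1) has_vector_derivative (vector [0, p t * \<eta> t, p t * m t] :: cvec) $ 1) (at 0)"
        unfolding G_def vector_3 fst_conv by (rule has_vector_derivative_const)
      have 2: "((\<lambda>r. G (t, r) $ 2) has_vector_derivative (vector [0, p t * \<eta> t, p t * m t] :: cvec) $ 2) (at 0)"
        unfolding G_def vector_3 fst_conv snd_conv
        by (rule has_vector_derivative_eq_rhs, (rule has_vector_derivative_add has_vector_derivative_const dr)+) simp
      have 3: "((\<lambda>r. G (t, r) $ 3) has_vector_derivative (vector [0, p t * \<eta> t, p t * m t] :: cvec) $ 3) (at 0)"
        unfolding G_def vector_3 fst_conv snd_conv
        by (rule has_vector_derivative_eq_rhs, (rule has_vector_derivative_add has_vector_derivative_const dr)+) simp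
      show "((\<lambda>r. G (t, r) $ i) has_vector_derivative (vector [0, p t * \<eta> t, p t * m t] :: cvec) $ i) (at 0)" for i
        using exhaust_3[of i] 1 2 3 by auto
    qed
    then show ?thesis by (simp add: pd2_def vector_derivative_at)
  qed
  have hG: "hform (G (t, \<tau>)) (G (t, \<tau>)) = 0" if "t \<in> I" for t \<tau>
    by (rule variation_lift_null[OF n0[OF that] R1[OF that]]) (simp_all add: G_def m_def k_def)
  have lG: "hform (G (t, \<tau>)) (G' (t, \<tau>)) = 0" if "t \<in> I" for t \<tau>
    by (rule variation_lift_legendrian[OF n1[OF that] R1[OF that] R1'[OF that] R2[OF that] h'_def])
       (simp_all add: G_def m_def k_def G'_def m'_def k'_def)
  have G0: "G (t, \<tau>) \<noteq> 0" if "t \<in> I" for t \<tau>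
  proof
    assume "G (t, \<tau>) = 0"
    then have "p t = 0" "z2 t = 0" "z3 t = 0" by (auto simp: G_def cvec_eq_iff)
    then have "N (t, 0) = 0" by (simp add: cvec_eq_iff p_def z2_def z3_def)
    then show False using lift0[OF v0[OF that]] by simp
  qed
  have iG: "\<nexists>a. G' (t, \<tau>) = a *s G (t, \<tau>)" if t: "t \<in> I" and \<tau>: "\<tau> \<in> {-\<epsilon><..<\<epsilon>}" for t \<tau>
  proof
    assume "\<exists>a. G' (t, \<tau>) = a *s G (t, \<tau>)"
    then obtain a where a: "G' (t, \<tau>) = a *s G (t, \<tau>)" by blast
    have "p' t = a * p t \<and>
       z2' t + \<tau> * (p' t * \<eta> t + p t * \<eta>' t) = a * (z2 t + \<tau> * (p t * \<eta> t)) \<and>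
       z3' t + \<tau> * (p' t * m t + p t * m' t) + (complex_of_real \<tau>)\<^sup>2 * (p' t * k t + p t * k' t)
          = a * (z3 t + \<tau> * (p t * m t) + (complex_of_real \<tau>)\<^sup>2 * (p t * k t))"
      using a unfolding cvec_eq_iff G_def G'_def vector_smult_component vector_3 fst_conv snd_conv .
    then have a1: "p' t = a * p t"
      and a2: "z2' t + \<tau> * (p' t * \<eta> t + p t * \<eta>' t) = a * (z2 t + \<tau> * (p t * \<eta> t))"
      and a3: "z3' t + \<tau> * (p' t * m t + p t * m' t) + (complex_of_real \<tau>)\<^sup>2 * (p' t * k t + p t * k' t)
          = a * (z3 t + \<tau> * (p t * m t) + (complex_of_real \<tau>)\<^sup>2 * (p t * k t))"
      by blast+
    show False
    proof (cases "t \<in> S")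
      case True
      have "p t * (vd \<zeta> t + \<tau> * \<eta>' t) = 0"
      proof -
        have "z2 t = p t * \<zeta> t" using pS[OF True] by (simp add: \<zeta>_def)
        then show ?thesis using a2 unfolding z2\<zeta>[OF True] a1 by (simp add: algebra_simps)
      qed
      then show False using pS[OF True] imm[OF True \<tau>] by simp
    next
      case False
      then have tK: "t \<notin> K0" using KS by blast
      have e: "\<eta> t = 0" "\<xi> t = 0" "\<eta>' t = 0" "f t = 0" "f' t = 0"
        using tK f'0 \<eta>'0 f0 by (auto simp: \<eta>_def \<xi>_def K0_def)
      have "(\<xi> has_vector_derivative 0) (at t)"
        by (rule has_vector_derivative_transform_within_open[OF has_vector_derivative_const oK]) (use tK in \<open>auto simp: \<xi>_def\<close>)
      then have e2: "\<xi>' t = 0" using d\<xi> vector_derivative_unique_at by blast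
      have e3: "m t = 0" "m' t = 0" "k' t = 0" using e e2 by (simp_all add: m_def m'_def k'_def h'_def)
      have "pd1 N (t, 0) = a *s N (t, 0)"
        using a1 a2 a3 unfolding e e3 cvec_eq_iff by (simp add: p_def z2_def z3_def p'_def z2'_def z3'_def algebra_simps)
      then have "hform (pd1 N (t, 0)) (pd1 N (t, 0)) = 0" using F0.null[OF v0[OF t]] by (simp add: hform_simps)
      then show False using F0.h11[OF v0[OF t]] by simp
    qed
  qed
  define g where "g q = proj (G q)" for q
  have hs: "g q \<in> heisS" if "q \<in> vdom I \<epsilon>" for q
    using G0[of "fst q" "snd q"] hG[of "fst q" "snd q"] that unfolding g_def heisS_def by (auto simp: vdom_def)
  have ll: "local_lift2 (vdom I \<epsilon>) g G"
    unfolding local_lift2_def using open_vdom[OF I(1)] smooth_on2_subset[OF sG subV] G0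
    by (auto simp: g_def vdom_def)
  show ?thesis
  proof (rule that[of \<epsilon> g G])
    show "smooth_variation_map I \<epsilon> g"
      unfolding smooth_variation_map_def using hs ll by blast
    show "legendrian I (\<lambda>t. g (t, \<tau>))" if \<tau>: "\<tau> \<in> {-\<epsilon><..<\<epsilon>}" for \<tau>
      unfolding legendrian_def
    proof (intro conjI ballI)
      show "g (t, \<tau>) \<in> heisS" if "t \<in> I" for t using hs that \<tau> by (auto simp: vdom_def)
      have l: "local_lift I (\<lambda>t. g (t, \<tau>)) (\<lambda>t. G (t, \<tau>))"
        unfolding local_lift_def using I(1) smooth_on1_slice[OF sG[unfolded V_def], of \<tau>] G0 by (simp add: g_def)
      have "(\<nexists>a. vd (\<lambda>t. G (t, \<tau>)) t = a *s G (t, \<tau>)) \<and> zeta (G (t, \<tau>)) (vd (\<lambda>t. G (t, \<tau>)) t) = 0" if "t \<in> I" for t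
        unfolding vd_slice pdG[OF that] using iG[OF that \<tau>] zeta_zeroI[OF lG[OF that]] by blast
      then show "\<exists>U \<Gamma>. t0 \<in> U \<and> U \<subseteq> I \<and> local_lift U (\<lambda>t. g (t, \<tau>)) \<Gamma> \<and>
         (\<forall>t\<in>U. (\<nexists>c. vd \<Gamma> t = c *s \<Gamma> t) \<and> zeta (\<Gamma> t) (vd \<Gamma> t) = 0)" if "t0 \<in> I" for t0
        using that l by (intro exI[of _ I] exI[of _ "\<lambda>t. G (t, \<tau>)"]) auto
    qed
    show "g (t, 0) = \<gamma> t" if "t \<in> I" for t
    proof -
      have "G (t, 0) = N (t, 0)" by (simp add: G_def cvec_eq_iff p_def z2_def z3_def)
      then show ?thesis using lift0[OF v0[OF that]] by (simp add: g_def)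
    qed
    show "Im (hform (G (t, 0)) (pd2 G (t, 0))) = (cmod (N (t, 0) $ 1))\<^sup>2 * f t" if t: "t \<in> I" for t
    proof -
      have "hform (G (t, 0)) (pd2 G (t, 0)) = \<i> * (cnj (p t) * p t) * f t + p t * (cnj (z2 t) * \<eta> t - cnj (p t) * \<xi> t)"
        unfolding pd2G by (simp add: hform_def G_def m_def algebra_simps)
      also have "\<dots> = \<i> * (p t * cnj (p t)) * f t" using R1[OF t] by simp
      also have "\<dots> = \<i> * complex_of_real ((cmod (p t))\<^sup>2 * f t)" unfolding of_real_mult complex_norm_square by simp
      finally have "hform (G (t, 0)) (pd2 G (t, 0)) = \<i> * complex_of_real ((cmod (p t))\<^sup>2 * f t)" .
      then show ?thesis by (simp add: p_def)
    qed
    show "pd2 G (t, 0) = 0" if "t \<in> I - {c'..d'}" for t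
    proof -
      have tK: "t \<notin> K0" "f t = 0" using that f0[of t] by (auto simp: K0_def)
      then have "\<eta> t = 0" "m t = 0" by (simp_all add: \<eta>_def m_def \<xi>_def)
      then show ?thesis by (simp add: pd2G cvec_eq_iff)
    qed
  qed (fact \<epsilon>0 ll)+
qed

section \<open>Critical curves\<close>

lemma open_nonzero_set:
  fixes f :: "real \<Rightarrow> 'a::real_normed_vector"
  assumes "open I" "continuous_on I f"
  shows "open {t \<in> I. f t \<noteq> 0}"
proof -
  have "open (I \<inter> f -` (- {0}))" by (rule continuous_open_preimage[OF assms(2,1)]) auto
  moreover have "{t \<in> I. f t \<noteq> 0} = I \<inter> f -` (- {0})" by auto
  ultimately show ?thesis by simp
qed

lemma constant_sign_on_interval:
  fixes f :: "real \<Rightarrow> real"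
  assumes "continuous_on {c..d} f" "\<And>t. t \<in> {c..d} \<Longrightarrow> f t \<noteq> 0" "s \<in> {c..d}" "t \<in> {c..d}" "f s > 0"
  shows "f t > 0"
proof (rule ccontr)
  assume "\<not> f t > 0"
  then have "f t < 0" using assms(2)[OF assms(4)] by auto
  have "connected (f ` {c..d})" by (intro connected_continuous_image assms(1) connected_Icc)
  moreover have "f t \<in> f ` {c..d}" "f s \<in> f ` {c..d}" using assms by auto
  ultimately have "0 \<in> f ` {c..d}" using \<open>f t < 0\<close> assms(5) unfolding connected_iff_interval by (meson less_imp_le)
  then show False using assms(2) by auto
qed

text \<open>Near a point of nonzero stress \<open>a\<close> cannot vanish on an open set, since its
  whole jet would. Nor can \<open>N $ 1\<close>: by nullity the second coordinate would vanish too,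
  and \<open>N'\<close> would be null.\<close>

lemma stress_nonzero_interval:
  assumes I: "open I" and F0: "framed_lift (vdom I 1) N"
    and st: "\<And>t. t \<in> I \<Longrightarrow> st t = stress_poly (\<lambda>k. (pd1 ^^ k) (framed_lift.fA N) (t, 0)) (\<lambda>k. (pd1 ^^ k) (framed_lift.fB N) (t, 0))"
    and t0: "t0 \<in> I" "st t0 \<noteq> 0"
  obtains c d where "c < d" "{c..d} \<subseteq> I" "continuous_on {c..d} st"
    "\<And>t. t \<in> {c..d} \<Longrightarrow> st t \<noteq> 0 \<and> framed_lift.fA N (t, 0) \<noteq> 0 \<and> N (t, 0) $ 1 \<noteq> 0"
proof -
  interpret framed_lift "vdom I 1" N by (rule F0)
  have v0: "(t, 0) \<in> vdom I 1" if "t \<in> I" for t using that by (auto simp: vdom_def)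
  have c0: "continuous_on I (\<lambda>t. F (t, 0))" if "smooth_on2 (vdom I 1) F" for F :: "real \<times> real \<Rightarrow> 'z::real_normed_vector"
    by (rule continuous_on_compose2[OF smooth_on2_continuous[OF that]]) (auto intro!: continuous_intros v0)
  have "continuous_on I (\<lambda>t. stress_poly (\<lambda>k. (pd1 ^^ k) fA (t, 0)) (\<lambda>k. (pd1 ^^ k) fB (t, 0)))"
    unfolding stress_poly_def
    by (intro continuous_intros c0 smooth_on2_pd1_funpow smooth_fA smooth_fB)
  then have cst: "continuous_on I st" by (rule continuous_on_eq) (simp add: st)
  define S1 where "S1 = {t \<in> I. st t \<noteq> 0}"
  have oS1: "open S1" and S1I: "S1 \<subseteq> I" unfolding S1_def using open_nonzero_set[OF I cst] by auto
  have "\<exists>t\<in>S1. fA (t, 0) \<noteq> 0"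
  proof (rule ccontr)
    assume "\<not> ?thesis"
    then have z: "fA (t, 0) = 0" if "t \<in> S1" for t using that by blast
    have t0S: "t0 \<in> S1" using t0 by (simp add: S1_def)
    have "(pd1 ^^ k) fA (t0, 0) = 0" for k by (rule pd1_funpow_zero[OF oS1 _ t0S]) (rule z)
    then have "st t0 = 0" unfolding st[OF t0(1)] by (simp add: stress_poly_def)
    then show False using t0 by simp
  qed
  define S2 where "S2 = {t \<in> S1. fA (t, 0) \<noteq> 0}"
  have oS2: "open S2" unfolding S2_def
    by (rule open_nonzero_set[OF oS1 continuous_on_subset[OF c0[OF smooth_fA] S1I]])
  have S2I: "S2 \<subseteq> I" using S1I by (auto simp: S2_def)
  have "\<exists>t\<in>S2. N (t, 0) $ 1 \<noteq> 0"
  proof (rule ccontr)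
    assume "\<not> ?thesis"
    then have z: "N (t, 0) $ 1 = 0" if "t \<in> S2" for t using that by blast
    have z2: "N (t, 0) $ 2 = 0" if "t \<in> S2" for t
      using null[OF v0[OF subsetD[OF S2I that]]] z[OF that] by (simp add: hform_def)
    obtain t where t: "t \<in> S2" using \<open>\<exists>t\<in>S1. fA (t, 0) \<noteq> 0\<close> by (auto simp: S2_def)
    then have tI: "t \<in> I" using S2I by blast
    have "pd1 N (t, 0) $ i = 0" if "\<And>t. t \<in> S2 \<Longrightarrow> N (t, 0) $ i = 0" for i
    proof -
      have "((\<lambda>r. N (r, 0) $ i) has_vector_derivative 0) (at t)"
        by (rule has_vector_derivative_transform_within_open[OF has_vector_derivative_const oS2 t]) (simp add: that)
      moreover have "((\<lambda>r. N (r, 0) $ i) has_vector_derivative pd1 N (t, 0) $ i) (at t)"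
        by (rule has_vector_derivative_nth[OF smooth_on2_has_pd1[OF smooth_N v0[OF tI]]])
      ultimately show ?thesis using vector_derivative_unique_at by blast
    qed
    from this[OF z] this[OF z2] have "hform (pd1 N (t, 0)) (pd1 N (t, 0)) = 0" by (simp add: hform_def)
    then show False using h11[OF v0[OF tI]] by simp
  qed
  then obtain t1 where t1: "t1 \<in> {t \<in> S2. N (t, 0) $ 1 \<noteq> 0}" by blast
  have "continuous_on I (\<lambda>t. N (t, 0) $ 1)" using c0[OF smooth_N] by (intro continuous_intros)
  then have "open {t \<in> S2. N (t, 0) $ 1 \<noteq> 0}"
    by (intro open_nonzero_set[OF oS2] continuous_on_subset[OF _ S2I])
  then obtain e where e: "e > 0" "cball t1 e \<subseteq> {t \<in> S2. N (t, 0) $ 1 \<noteq> 0}" using t1 open_contains_cball by blast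
  have cb: "cball t1 e = {t1 - e..t1 + e}" by (auto simp: dist_real_def)
  have sub: "t \<in> {t \<in> S2. N (t, 0) $ 1 \<noteq> 0}" if "t \<in> {t1 - e..t1 + e}" for t using e(2) that unfolding cb by blast
  show ?thesis
  proof (rule that[of "t1 - e" "t1 + e"])
    show "{t1 - e..t1 + e} \<subseteq> I" using sub S2I by auto
    then show "continuous_on {t1 - e..t1 + e} st" by (rule continuous_on_subset[OF cst])
    show "st t \<noteq> 0 \<and> fA (t, 0) \<noteq> 0 \<and> N (t, 0) $ 1 \<noteq> 0" if "t \<in> {t1 - e..t1 + e}" for t
      using sub[OF that] by (auto simp: S2_def S1_def)
  qed (use e in simp)
qed

text \<open>The usual localization: the bump sits where the stress keeps its sign, and its contact
  Hamiltonian has one sign, so the integrand of the first variation has one sign and is nonzero at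
  the middle.\<close>

lemma critical_imp_stress_zero:
  assumes I: "open I" "is_interval I" and L0: "legendrian I \<gamma>" and crit: "strain_critical I \<gamma>" and t0: "t0 \<in> I"
  shows "stress I \<gamma> t0 = 0"
proof (rule ccontr)
  assume st0: "stress I \<gamma> t0 \<noteq> 0"
  obtain N where N: "framed_lift (vdom I 1) N" "\<And>q. q \<in> vdom I 1 \<Longrightarrow> N q \<noteq> 0 \<and> \<gamma> (fst q) = proj (N q)"
    "normalized_lift I \<gamma> (\<lambda>t. N (t, 0))"
    by (rule legendrian_framed_lift[OF I L0]) (use that in blast)
  \<comment> \<open>Two families are in play: the constant one, whose lift \<open>N\<close> supplies
    the chart, and below the bump variation with its own lift \<open>N'\<close>. At
    \<open>\<tau> = 0\<close> both compute the densities of \<open>\<gamma>\<close>.\<close>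
  interpret V0: legendrian_variation I \<gamma> 1 "\<lambda>q. \<gamma> (fst q)" N
    by (rule legendrian_variation.intro) (use I L0 N constant_variation[OF I(1) L0] in auto)
  obtain c d where cd: "c < d" "{c..d} \<subseteq> I" "continuous_on {c..d} (stress I \<gamma>)"
    and nz: "\<And>t. t \<in> {c..d} \<Longrightarrow> stress I \<gamma> t \<noteq> 0 \<and> V0.fA (t, 0) \<noteq> 0 \<and> N (t, 0) $ 1 \<noteq> 0"
    using stress_nonzero_interval[OF I(1) N(1) V0.stress_base t0 st0] by blast
  define c' d' where "c' = (2 * c + d) / 3" and "d' = (c + 2 * d) / 3"
  have cd': "c < c'" "c' < d'" "d' < d" using cd(1) by (auto simp: c'_def d'_def)
  obtain f where f: "smooth_on1 UNIV f" "\<And>t. t \<in> {c'<..<d'} \<Longrightarrow> f t > 0" "\<And>t. t \<notin> {c'<..<d'} \<Longrightarrow> f t = (0::real)"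
    by (rule bump_function[of c' d']) (use that in blast)
  obtain \<epsilon> g G where g: "\<epsilon> > 0" "smooth_variation_map I \<epsilon> g"
    "\<And>\<tau>. \<tau> \<in> {-\<epsilon><..<\<epsilon>} \<Longrightarrow> legendrian I (\<lambda>t. g (t, \<tau>))"
    "\<And>t. t \<in> I \<Longrightarrow> g (t, 0) = \<gamma> t" and G: "local_lift2 (vdom I \<epsilon>) g G"
    "\<And>t. t \<in> I \<Longrightarrow> Im (hform (G (t, 0)) (pd2 G (t, 0))) = (cmod (N (t, 0) $ 1))\<^sup>2 * f t"
    "\<And>t. t \<in> I - {c'..d'} \<Longrightarrow> pd2 G (t, 0) = 0"
    by (rule bump_variation_exists[OF I N(1,2) cd'(1) less_imp_le[OF cd'(2)] cd'(3) cd(2) _ f(1)]) (use nz f(3) in auto)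
  obtain N' where N': "framed_lift (vdom I \<epsilon>) N'" "\<And>q. q \<in> vdom I \<epsilon> \<Longrightarrow> N' q \<noteq> 0 \<and> g q = proj (N' q)"
    by (rule framed_lift_exists[OF I g(2,3)]) (use that in blast)+
  interpret V: legendrian_variation I \<gamma> \<epsilon> g N'
    by (rule legendrian_variation.intro) (use I L0 N' g in auto)
  define K where "K = var_support I \<epsilon> g"
  have "{t \<in> I. \<not> varfield_vanishes I \<epsilon> g t} \<subseteq> {c'..d'}"
  proof
    fix t assume t: "t \<in> {t \<in> I. \<not> varfield_vanishes I \<epsilon> g t}"
    show "t \<in> {c'..d'}"
    proof (rule ccontr)
      assume "t \<notin> {c'..d'}"
      then have "pd2 G (t, 0) = 0 *s G (t, 0)" using G(3)[of t] t by simp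
      then have "varfield_vanishes I \<epsilon> g t"
        unfolding varfield_vanishes_def using G(1) V.in_vdom0[of t] t by (intro exI[of _ "vdom I \<epsilon>"] exI[of _ G]) auto
      then show False using t by simp
    qed
  qed
  then have "K \<subseteq> {c'..d'}" unfolding K_def var_support_def by (rule closure_minimal) simp
  moreover have "closed K" by (simp add: K_def var_support_def)
  ultimately have cK: "compact K" using bounded_subset[OF bounded_closed_interval] compact_eq_bounded_closed
    by (metis compact_Icc compact_imp_bounded bounded_subset)
  have Kcd: "K \<subseteq> {c<..<d}" using \<open>K \<subseteq> {c'..d'}\<close> cd' by auto
  have KI: "K \<subseteq> I" using Kcd cd(2) by force
  let ?E = "\<lambda>t. - (root 3 \<bar>V.fA (t, 0)\<bar> * stress I \<gamma> t / (9 * V.fA (t, 0) ^ 6)) * V.vw (t, 0)"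
  have fA: "V.fA (t, 0) \<noteq> 0" if "t \<in> {c..d}" for t
    using nz[OF that] V.fub_base(1)[of t] V0.fub_base(1)[of t] that cd(2) by auto
  have D: "(total_strain I \<epsilon> g has_real_derivative integral {c..d} ?E) (at 0)"
    by (rule V.total_strain_first_variation) (use cK Kcd cd V.fub_base(1) fA in \<open>auto simp: K_def\<close>)
  have "admissible_variation I \<gamma> \<epsilon> g"
    unfolding admissible_variation_def
    using g cK KI D by (auto simp: K_def real_differentiable_def)
  then have "deriv (total_strain I \<epsilon> g) 0 = 0" using crit unfolding strain_critical_def by blast
  then have I0: "integral {c..d} ?E = 0" using DERIV_imp_deriv[OF D] by simp
  \<comment> \<open>\<open>vw\<close> belongs to the normalized lift \<open>N'\<close>, whereas the
    bump is prescribed for \<open>G\<close>; the change of lift contributes the positive factor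
    \<open>|k|\<^sup>2\<close>.\<close>
  have vw: "\<exists>r>0. V.vw (t, 0) = - r * f t" if t: "t \<in> {c..d}" for t
  proof -
    have tI: "t \<in> I" using t cd(2) by auto
    obtain k k' where k: "k \<noteq> 0" "N' (t, 0) = k *s G (t, 0)" "pd2 N' (t, 0) = k *s pd2 G (t, 0) + k' *s G (t, 0)"
      using V.lift_change[OF G(1) order_refl V.in_vdom0[OF tI]] by blast
    have "hform (N' (t, 0)) (N' (t, 0)) = 0" by (rule V.null[OF V.in_vdom0[OF tI]])
    then have GG: "hform (G (t, 0)) (G (t, 0)) = 0" using k(1) by (simp add: k(2) hform_simps)
    have "hform (N' (t, 0)) (pd2 N' (t, 0)) = (k * cnj k) * hform (G (t, 0)) (pd2 G (t, 0))"
      unfolding k(3) unfolding k(2) using GG by (simp add: hform_simps)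
    also have "k * cnj k = complex_of_real ((cmod k)\<^sup>2)" by (rule complex_norm_square[symmetric])
    finally have "V.vw (t, 0) = - ((cmod k)\<^sup>2 * (cmod (N (t, 0) $ 1))\<^sup>2) * f t"
      using G(2)[OF tI] by (simp add: V.vw_def)
    moreover have "(cmod k)\<^sup>2 * (cmod (N (t, 0) $ 1))\<^sup>2 > 0" using k(1) nz[OF t] by simp
    ultimately show ?thesis by blast
  qed
  have f0: "f t \<ge> 0" for t using f(2)[of t] f(3)[of t] by fastforce
  define F where "F t = root 3 \<bar>V.fA (t, 0)\<bar> / (9 * V.fA (t, 0) ^ 6) * V.vw (t, 0)" for t
  have F0: "F t \<le> 0" if "t \<in> {c..d}" for t
    using vw[OF that] f0[of t] by (auto simp: F_def intro!: mult_nonneg_nonpos)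
  have cF: "continuous_on {c..d} F"
  proof -
    have c0: "continuous_on {c..d} (\<lambda>t. H (t, 0))" if "smooth_on2 (vdom I \<epsilon>) H" for H :: "real \<times> real \<Rightarrow> real"
      by (rule continuous_on_compose2[OF smooth_on2_continuous[OF that]])
         (use cd(2) V.in_vdom0 in \<open>auto intro!: continuous_intros\<close>)
    show ?thesis unfolding F_def
      by (intro continuous_intros c0 V.smooth_fA V.smooth_vw) (use fA in auto)
  qed
  define t1 where "t1 = (c + d) / 2"
  have t1: "t1 \<in> {c..d}" "t1 \<in> {c'<..<d'}" using cd(1) by (auto simp: t1_def c'_def d'_def)
  have Ft1: "F t1 \<noteq> 0" using vw[OF t1(1)] f(2)[OF t1(2)] fA[OF t1(1)] by (auto simp: F_def)
  have E_F: "?E t = - stress I \<gamma> t * F t" for t by (simp add: F_def)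
  have box: "box c d \<noteq> {}" using cd(1) by simp
  show False
  proof (cases "stress I \<gamma> t1 > 0")
    case True
    then have pos: "stress I \<gamma> t > 0" if "t \<in> {c..d}" for t
      using constant_sign_on_interval[OF cd(3) _ t1(1) that] nz by blast
    have "- stress I \<gamma> t1 * F t1 = 0"
    proof (rule has_integral_0_cbox_imp_0[where f = "\<lambda>t. - stress I \<gamma> t * F t", OF _ _ _ box])
      show "continuous_on (cbox c d) (\<lambda>t. - stress I \<gamma> t * F t)" using cd(3) cF by (auto intro!: continuous_intros)
      then have "(\<lambda>t. - stress I \<gamma> t * F t) integrable_on cbox c d" by (rule integrable_continuous)
      then show "((\<lambda>t. - stress I \<gamma> t * F t) has_integral 0) (cbox c d)"
        using I0 unfolding E_F by (simp add: has_integral_integral)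
      show "0 \<le> - stress I \<gamma> t * F t" if "t \<in> box c d" for t
        using pos[of t] F0[of t] that by (intro mult_nonpos_nonpos) auto
    qed (use t1 in auto)
    then show False using Ft1 pos[OF t1(1)] by simp
  next
    case False
    have neg: "- stress I \<gamma> t > 0" if "t \<in> {c..d}" for t
      by (rule constant_sign_on_interval[OF _ _ t1(1) that, of "\<lambda>t. - stress I \<gamma> t"])
         (use cd(3) nz False t1 in \<open>auto intro!: continuous_intros simp: not_less order.order_iff_strict\<close>)
    have "stress I \<gamma> t1 * F t1 = 0"
    proof (rule has_integral_0_cbox_imp_0[where f = "\<lambda>t. stress I \<gamma> t * F t", OF _ _ _ box])
      show c: "continuous_on (cbox c d) (\<lambda>t. stress I \<gamma> t * F t)" using cd(3) cF by (auto intro!: continuous_intros)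
      then have i: "(\<lambda>t. stress I \<gamma> t * F t) integrable_on cbox c d" by (rule integrable_continuous)
      then show "((\<lambda>t. stress I \<gamma> t * F t) has_integral 0) (cbox c d)"
        using I0 unfolding E_F by (simp add: has_integral_integral)
      show "0 \<le> stress I \<gamma> t * F t" if "t \<in> box c d" for t
        using neg[of t] F0[of t] that by (auto intro!: mult_nonpos_nonpos)
    qed (use t1 in auto)
    then show False using Ft1 neg[OF t1(1)] by simp
  qed
qed

lemma stress_zero_imp_cycle_or_generic:
  assumes I: "open I" "is_interval I" and L0: "legendrian I \<gamma>" and st: "\<forall>t\<in>I. stress I \<gamma> t = 0"
  shows "(\<forall>t\<in>I. fub_a I \<gamma> t = 0) \<or> (\<forall>t\<in>I. fub_a I \<gamma> t \<noteq> 0)"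
proof -
  obtain N where N: "framed_lift (vdom I 1) N" "\<And>q. q \<in> vdom I 1 \<Longrightarrow> N q \<noteq> 0 \<and> \<gamma> (fst q) = proj (N q)"
    "normalized_lift I \<gamma> (\<lambda>t. N (t, 0))"
    by (rule legendrian_framed_lift[OF I L0]) (use that in blast)
  interpret V: legendrian_variation I \<gamma> 1 "\<lambda>q. \<gamma> (fst q)" N
    by (rule legendrian_variation.intro) (use I L0 N constant_variation[OF I(1) L0] in auto)
  have "V.fA (t, 0) \<noteq> 0" if "t0 \<in> I" "V.fA (t0, 0) \<noteq> 0" "t \<in> I" for t0 t
  proof -
    have "(pd1 ^^ 0) V.fA (t, 0) \<noteq> 0"
    proof (rule cycle_or_generic[OF I(2), of "\<lambda>k t. (pd1 ^^ k) V.fA (t, 0)" "\<lambda>k t. (pd1 ^^ k) V.fB (t, 0)" t0])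
      fix k r assume r: "r \<in> I"
      show "((\<lambda>t. (pd1 ^^ k) V.fA (t, 0)) has_real_derivative (pd1 ^^ Suc k) V.fA (r, 0)) (at r)"
        by (rule pd1_funpow_DERIV[OF V.smooth_fA V.in_vdom0[OF r]])
      show "((\<lambda>t. (pd1 ^^ k) V.fB (t, 0)) has_real_derivative (pd1 ^^ Suc k) V.fB (r, 0)) (at r)"
        by (rule pd1_funpow_DERIV[OF V.smooth_fB V.in_vdom0[OF r]])
      show "stress_poly (\<lambda>k. (pd1 ^^ k) V.fA (r, 0)) (\<lambda>k. (pd1 ^^ k) V.fB (r, 0)) = 0"
        using st r V.stress_base[OF r] by simp
    qed (use that in auto)
    then show ?thesis by simp
  qed
  then show ?thesis using V.fub_base(1) by metis
qed

text \<open>The total strain is nonnegative and is 0 at \<open>\<tau> = 0\<close>, so the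
  derivative, which admissibility provides, is that at a minimum.\<close>

lemma cycle_critical:
  assumes z: "\<forall>t\<in>I. fub_a I \<gamma> t = 0"
  shows "strain_critical I \<gamma>"
  unfolding strain_critical_def
proof (intro allI impI)
  fix \<epsilon> g assume a: "admissible_variation I \<gamma> \<epsilon> g"
  then have g: "\<And>t. t \<in> I \<Longrightarrow> g (t, 0) = \<gamma> t" "var_support I \<epsilon> g \<subseteq> I" "total_strain I \<epsilon> g differentiable (at 0)"
    unfolding admissible_variation_def by auto
  \<comment> \<open>\<open>g (t, 0)\<close> is known to equal \<open>\<gamma> t\<close> only on
    \<open>I\<close>; the choice in \<open>nlift\<close> depends on the curve through this predicate
    alone.\<close>
  have "normalized_lift I (\<lambda>s. g (s, 0)) = normalized_lift I \<gamma>"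
    by (simp add: fun_eq_iff normalized_lift_def g(1))
  then have "fub_a I (\<lambda>s. g (s, 0)) = fub_a I \<gamma>" by (simp add: fun_eq_iff fub_a_def nlift_def)
  then have "strain I (\<lambda>s. g (s, 0)) t = 0" if "t \<in> var_support I \<epsilon> g" for t
    using z that g(2) by (auto simp: strain_def)
  then have "total_strain I \<epsilon> g 0 = integral (var_support I \<epsilon> g) (\<lambda>t. 0)"
    unfolding total_strain_def by (intro integral_cong) auto
  then have T0: "total_strain I \<epsilon> g 0 = 0" by simp
  have pos: "total_strain I \<epsilon> g \<tau> \<ge> 0" for \<tau>
  proof (cases "(\<lambda>t. strain I (\<lambda>s. g (s, \<tau>)) t) integrable_on var_support I \<epsilon> g")
    case True
    then show ?thesis unfolding total_strain_def by (rule integral_nonneg) (simp add: strain_def)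
  next
    case False
    \<comment> \<open>The integral of a non-integrable function is 0 by convention, which is still
      nonnegative.\<close>
    then show ?thesis unfolding total_strain_def by (simp add: not_integrable_integral)
  qed
  obtain D where D: "(total_strain I \<epsilon> g has_real_derivative D) (at 0)"
    using g(3) real_differentiableE by blast
  have "D = 0"
    by (rule DERIV_local_min[OF D, of 1]) (use T0 pos in auto)
  then show "deriv (total_strain I \<epsilon> g) 0 = 0" using DERIV_imp_deriv[OF D] by simp
qed

lemma generic_stress_zero_critical:
  assumes I: "open I" "is_interval I" and L0: "legendrian I \<gamma>" and st: "\<forall>t\<in>I. stress I \<gamma> t = 0"
    and nz: "\<forall>t\<in>I. fub_a I \<gamma> t \<noteq> 0"
  shows "strain_critical I \<gamma>"
  unfolding strain_critical_def
proof (intro allI impI)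
  fix \<epsilon> g assume a: "admissible_variation I \<gamma> \<epsilon> g"
  then have g: "\<epsilon> > 0" "smooth_variation_map I \<epsilon> g" "\<And>t. t \<in> I \<Longrightarrow> g (t, 0) = \<gamma> t"
    "\<And>\<tau>. \<tau> \<in> {-\<epsilon><..<\<epsilon>} \<Longrightarrow> legendrian I (\<lambda>t. g (t, \<tau>))"
    and K: "compact (var_support I \<epsilon> g)" "var_support I \<epsilon> g \<subseteq> I"
    unfolding admissible_variation_def by auto
  obtain N where N: "framed_lift (vdom I \<epsilon>) N" "\<And>q. q \<in> vdom I \<epsilon> \<Longrightarrow> N q \<noteq> 0 \<and> g q = proj (N q)"
    by (rule framed_lift_exists[OF I g(2,4)]) (use that in blast)+
  interpret V: legendrian_variation I \<gamma> \<epsilon> g N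
    by (rule legendrian_variation.intro) (use I L0 N g in auto)
  show "deriv (total_strain I \<epsilon> g) 0 = 0"
  proof (cases "var_support I \<epsilon> g = {}")
    case True
    then have "total_strain I \<epsilon> g = (\<lambda>\<tau>. 0)" by (simp add: total_strain_def fun_eq_iff)
    then show ?thesis by simp
  next
    case False
    define K where "K = var_support I \<epsilon> g"
    have K: "compact K" "K \<subseteq> I" "K \<noteq> {}" using K False by (auto simp: K_def)
    obtain m M where mM: "m \<in> K" "M \<in> K" "\<And>t. t \<in> K \<Longrightarrow> m \<le> t \<and> t \<le> M"
      using compact_attains_inf[OF K(1,3)] compact_attains_sup[OF K(1,3)] by metis
    \<comment> \<open>Margins on both sides place the support inside an open interval whose closure
      lies in \<open>I\<close>.\<close>
    obtain e1 where e1: "e1 > 0" "cball m e1 \<subseteq> I" using I(1) mM(1) K(2) open_contains_cball by blast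
    obtain e2 where e2: "e2 > 0" "cball M e2 \<subseteq> I" using I(1) mM(2) K(2) open_contains_cball by blast
    have ends: "m - e1 \<in> I" "M + e2 \<in> I" using e1 e2 by (auto simp: subset_iff dist_real_def)
    have sub: "{m - e1..M + e2} \<subseteq> I" using mem_is_interval_1_I[OF I(2) ends] by auto
    have "m \<le> M" using mM by blast
    have "(total_strain I \<epsilon> g has_real_derivative
       integral {m - e1..M + e2} (\<lambda>t. - (root 3 \<bar>V.fA (t, 0)\<bar> * stress I \<gamma> t / (9 * V.fA (t, 0) ^ 6)) * V.vw (t, 0))) (at 0)"
    proof (rule V.total_strain_first_variation)
      show "var_support I \<epsilon> g \<subseteq> {m - e1<..<M + e2}" using mM(3) e1(1) e2(1) by (force simp: K_def)
    qed (use K sub nz e1 e2 \<open>m \<le> M\<close> in \<open>auto simp: K_def\<close>)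
    moreover have "integral {m - e1..M + e2} (\<lambda>t. - (root 3 \<bar>V.fA (t, 0)\<bar> * stress I \<gamma> t / (9 * V.fA (t, 0) ^ 6)) * V.vw (t, 0))
        = integral {m - e1..M + e2} (\<lambda>t. 0)"
      by (rule integral_cong) (use st sub in auto)
    ultimately have "(total_strain I \<epsilon> g has_real_derivative 0) (at 0)" by simp
    then show ?thesis by (rule DERIV_imp_deriv)
  qed
qed

theorem theoremA:
  fixes I :: "real set" and \<gamma> :: "real \<Rightarrow> cpt"
  assumes "open I" and "is_interval I" and "legendrian I \<gamma>"
  shows "(strain_critical I \<gamma> \<longleftrightarrow> (\<forall>t\<in>I. stress I \<gamma> t = 0)) \<and>
         ((\<forall>t\<in>I. stress I \<gamma> t = 0) \<longrightarrow>
            (\<forall>t\<in>I. fub_a I \<gamma> t = 0) \<or> (\<forall>t\<in>I. fub_a I \<gamma> t \<noteq> 0))"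
  using critical_imp_stress_zero[OF assms] stress_zero_imp_cycle_or_generic[OF assms]
    cycle_critical[of I \<gamma>] generic_stress_zero_critical[OF assms] by blast

end
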